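(* Suppose that an action of a group $G$ by isometries on a hyperbolic graph $X$ is non-elementary and WPD. 1. If $f \in G$ is a chiral element that is loxodromic for the action on $X$, then there exists a homogeneous quasimorphism $h : G \to \mathbb{R}$ such that $h(f) \neq 0$. 2. If $H \leq G$ is a subgroup that is non-elementary with respect to the action on $X$, then the restriction map $Q_h(G) \to Q_h(H)$ has infinite-dimensional image.
   Context: A hyperbolic graph is a connected graph whose path metric is Gromov-hyperbolic. An isometry is loxodromic if its orbits $n \mapsto g^n x$ are quasi-isometric embeddings of $\mathbb{Z}$. An action of a group (or subgroup) on $X$ is non-elementary if the group contains two loxodromic elements with disjoint fixed point pairs on the Gromov boundary. An element $f \in G$ is WPD for the action of $G$ on $X$ if for every $R \ge 0$ and every $x \in X$ there exists $n \ge 1$ such that $\{g \in G : d(x,gx) \le R,\ d(f^n x, g f^n x) \le R\}$ is finite. The action of $G$ on $X$ is WPD if every loxodromic element is WPD. An element $f \in G$ is achiral if $f^k$ is conjugate in $G$ to $f^{-k}$ for some $k \ge 1$, and chiral otherwise. A quasimorphism on a group $G$ is a function $h : G \to \mathbb{R}$ with $\sup_{a,b \in G} |h(a)+h(b)-h(ab)| < \infty$; it is homogeneous if its restriction to every cyclic subgroup is a homomorphism. $Q_h(G)$ denotes the real vector space of homogeneous quasimorphisms on $G$. *)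

theory Defs
  imports Complex_Main "HOL-Algebra.Group_Action" "HOL-Algebra.Generated_Groups"
    "HOL-Library.Function_Algebras"
begin

(* A graph is given by its vertex set V and its adjacency relation E. Loops are allowed and
   multiple edges are not recorded, since neither affects the path metric. The metric space
   attached to the graph is the vertex set with the path metric; it is 1/2-dense in the geometric
   realization, so all the coarse notions below agree for the two spaces. *)

definition connected_graph :: "'v set \<Rightarrow> ('v \<times> 'v) set \<Rightarrow> bool" where
  "connected_graph V E \<longleftrightarrow>
     V \<noteq> {} \<and> E \<subseteq> V \<times> V \<and> sym E \<and> (\<forall>x\<in>V. \<forall>y\<in>V. (x, y) \<in> E\<^sup>*)"

definition graph_dist :: "('v \<times> 'v) set \<Rightarrow> 'v \<Rightarrow> 'v \<Rightarrow> real" where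
  "graph_dist E x y = real (LEAST n. (x, y) \<in> E ^^ n)"

definition gromov_product :: "('v \<Rightarrow> 'v \<Rightarrow> real) \<Rightarrow> 'v \<Rightarrow> 'v \<Rightarrow> 'v \<Rightarrow> real" where
  "gromov_product d p x y = (d x p + d y p - d x y) / 2"

definition gromov_hyperbolic :: "'v set \<Rightarrow> ('v \<Rightarrow> 'v \<Rightarrow> real) \<Rightarrow> bool" where
  "gromov_hyperbolic V d \<longleftrightarrow>
     (\<exists>\<delta>. \<forall>p\<in>V. \<forall>x\<in>V. \<forall>y\<in>V. \<forall>z\<in>V.
        gromov_product d p x z \<ge> min (gromov_product d p x y) (gromov_product d p y z) - \<delta>)"

definition hyperbolic_graph :: "'v set \<Rightarrow> ('v \<times> 'v) set \<Rightarrow> bool" where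
  "hyperbolic_graph V E \<longleftrightarrow> connected_graph V E \<and> gromov_hyperbolic V (graph_dist E)"

(* Gromov boundary: sequences (s i) with (s i | s j)_p -> infinity as i, j -> infinity, modulo
   (s i | t j)_p -> infinity. Quantifying over all base points p is harmless, because changing p
   changes Gromov products by a bounded amount. *)

definition asymptotic :: "'v set \<Rightarrow> ('v \<Rightarrow> 'v \<Rightarrow> real) \<Rightarrow> (nat \<Rightarrow> 'v) \<Rightarrow> (nat \<Rightarrow> 'v) \<Rightarrow> bool" where
  "asymptotic V d s t \<longleftrightarrow>
     (\<forall>p\<in>V. filterlim (\<lambda>(i, j). gromov_product d p (s i) (t j)) at_top
               (sequentially \<times>\<^sub>F sequentially))"

definition sequences_to_infinity :: "'v set \<Rightarrow> ('v \<Rightarrow> 'v \<Rightarrow> real) \<Rightarrow> (nat \<Rightarrow> 'v) set" where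
  "sequences_to_infinity V d = {s. range s \<subseteq> V \<and> asymptotic V d s s}"

definition gromov_boundary :: "'v set \<Rightarrow> ('v \<Rightarrow> 'v \<Rightarrow> real) \<Rightarrow> (nat \<Rightarrow> 'v) set set" where
  "gromov_boundary V d = sequences_to_infinity V d //
     {(s, t). s \<in> sequences_to_infinity V d \<and> t \<in> sequences_to_infinity V d \<and> asymptotic V d s t}"

(* A self-isometry u of V acts on the boundary by [s] |-> [u o s]; as u is bijective on V, the class
   of u o s is the image of the class of s. *)

definition boundary_fixed_points ::
    "'v set \<Rightarrow> ('v \<Rightarrow> 'v \<Rightarrow> real) \<Rightarrow> ('v \<Rightarrow> 'v) \<Rightarrow> (nat \<Rightarrow> 'v) set set" where
  "boundary_fixed_points V d u = {\<xi> \<in> gromov_boundary V d. (\<lambda>s. u \<circ> s) ` \<xi> = \<xi>}"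

definition acts_by_isometries ::
    "('g, 'b) monoid_scheme \<Rightarrow> 'v set \<Rightarrow> ('v \<Rightarrow> 'v \<Rightarrow> real) \<Rightarrow> ('g \<Rightarrow> 'v \<Rightarrow> 'v) \<Rightarrow> bool" where
  "acts_by_isometries G V d \<phi> \<longleftrightarrow>
     group_action G V \<phi> \<and>
     (\<forall>g\<in>carrier G. \<forall>x\<in>V. \<forall>y\<in>V. d (\<phi> g x) (\<phi> g y) = d x y)"

definition quasi_isometric_embedding ::
    "('a \<Rightarrow> 'a \<Rightarrow> real) \<Rightarrow> ('v \<Rightarrow> 'v \<Rightarrow> real) \<Rightarrow> ('a \<Rightarrow> 'v) \<Rightarrow> bool" where
  "quasi_isometric_embedding e d c \<longleftrightarrow>
     (\<exists>K\<ge>1. \<exists>C\<ge>0. \<forall>m n. e m n / K - C \<le> d (c m) (c n) \<and> d (c m) (c n) \<le> K * e m n + C)"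

definition loxodromic ::
    "('g, 'b) monoid_scheme \<Rightarrow> 'v set \<Rightarrow> ('v \<Rightarrow> 'v \<Rightarrow> real) \<Rightarrow> ('g \<Rightarrow> 'v \<Rightarrow> 'v) \<Rightarrow> 'g \<Rightarrow> bool" where
  "loxodromic G V d \<phi> g \<longleftrightarrow>
     (\<forall>x\<in>V. quasi_isometric_embedding (\<lambda>m n::int. real_of_int \<bar>m - n\<bar>) d
        (\<lambda>n::int. \<phi> (g [^]\<^bsub>G\<^esub> n) x))"

definition nonelementary ::
    "('g, 'b) monoid_scheme \<Rightarrow> 'v set \<Rightarrow> ('v \<Rightarrow> 'v \<Rightarrow> real) \<Rightarrow> ('g \<Rightarrow> 'v \<Rightarrow> 'v) \<Rightarrow> 'g set \<Rightarrow> bool" where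
  "nonelementary G V d \<phi> H \<longleftrightarrow>
     (\<exists>a\<in>H. \<exists>b\<in>H. loxodromic G V d \<phi> a \<and> loxodromic G V d \<phi> b \<and>
        boundary_fixed_points V d (\<phi> a) \<inter> boundary_fixed_points V d (\<phi> b) = {})"

definition WPD_element ::
    "('g, 'b) monoid_scheme \<Rightarrow> 'v set \<Rightarrow> ('v \<Rightarrow> 'v \<Rightarrow> real) \<Rightarrow> ('g \<Rightarrow> 'v \<Rightarrow> 'v) \<Rightarrow> 'g \<Rightarrow> bool" where
  "WPD_element G V d \<phi> f \<longleftrightarrow>
     (\<forall>R\<ge>0. \<forall>x\<in>V. \<exists>n::nat. n \<ge> 1 \<and>
        finite {g \<in> carrier G. d x (\<phi> g x) \<le> R \<and>
                  d (\<phi> (f [^]\<^bsub>G\<^esub> n) x) (\<phi> g (\<phi> (f [^]\<^bsub>G\<^esub> n) x)) \<le> R})"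

definition WPD_action ::
    "('g, 'b) monoid_scheme \<Rightarrow> 'v set \<Rightarrow> ('v \<Rightarrow> 'v \<Rightarrow> real) \<Rightarrow> ('g \<Rightarrow> 'v \<Rightarrow> 'v) \<Rightarrow> bool" where
  "WPD_action G V d \<phi> \<longleftrightarrow>
     (\<forall>f\<in>carrier G. loxodromic G V d \<phi> f \<longrightarrow> WPD_element G V d \<phi> f)"

definition achiral :: "('g, 'b) monoid_scheme \<Rightarrow> 'g \<Rightarrow> bool" where
  "achiral G f \<longleftrightarrow>
     (\<exists>k::int. k \<ge> 1 \<and>
        (\<exists>c\<in>carrier G. c \<otimes>\<^bsub>G\<^esub> (f [^]\<^bsub>G\<^esub> k) \<otimes>\<^bsub>G\<^esub> inv\<^bsub>G\<^esub> c = f [^]\<^bsub>G\<^esub> (- k)))"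

abbreviation chiral :: "('g, 'b) monoid_scheme \<Rightarrow> 'g \<Rightarrow> bool" where
  "chiral G f \<equiv> \<not> achiral G f"

definition quasimorphism :: "('g, 'b) monoid_scheme \<Rightarrow> ('g \<Rightarrow> real) \<Rightarrow> bool" where
  "quasimorphism G h \<longleftrightarrow>
     bdd_above {\<bar>h a + h b - h (a \<otimes>\<^bsub>G\<^esub> b)\<bar> | a b. a \<in> carrier G \<and> b \<in> carrier G}"

definition homogeneous :: "('g, 'b) monoid_scheme \<Rightarrow> ('g \<Rightarrow> real) \<Rightarrow> bool" where
  "homogeneous G h \<longleftrightarrow>
     (\<forall>g\<in>carrier G. \<forall>a\<in>generate G {g}. \<forall>b\<in>generate G {g}. h (a \<otimes>\<^bsub>G\<^esub> b) = h a + h b)"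

(* Functions on the carrier of a group are represented by total functions vanishing off the carrier,
   so that they form a linear subspace of the space of all functions on the type. *)

definition Qh :: "('g, 'b) monoid_scheme \<Rightarrow> ('g \<Rightarrow> real) set" where
  "Qh G = {h. quasimorphism G h \<and> homogeneous G h \<and> (\<forall>x. x \<notin> carrier G \<longrightarrow> h x = 0)}"

interpretation real_fun: vector_space "\<lambda>(c::real) (h::'g \<Rightarrow> real) x. c * h x"
  by unfold_locales (auto simp: fun_eq_iff algebra_simps)

definition infinite_dimensional :: "('g \<Rightarrow> real) set \<Rightarrow> bool" where
  "infinite_dimensional W \<longleftrightarrow>
     \<not> (\<exists>B. finite B \<and> B \<subseteq> W \<and> W \<subseteq> real_fun.span B)"

lemma quasimorphism_iff:
  "quasimorphism G h \<longleftrightarrow>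
     (\<exists>C. \<forall>a\<in>carrier G. \<forall>b\<in>carrier G. \<bar>h a + h b - h (a \<otimes>\<^bsub>G\<^esub> b)\<bar> \<le> C)"
  unfolding quasimorphism_def bdd_above_def by blast

lemma subspace_Qh: "real_fun.subspace (Qh G)"
proof (rule real_fun.subspaceI)
  show "0 \<in> Qh G"
    by (auto simp: Qh_def quasimorphism_iff homogeneous_def)
next
  fix h k assume hk: "h \<in> Qh G" "k \<in> Qh G"
  from hk obtain C D where
    C: "\<And>a b. a \<in> carrier G \<Longrightarrow> b \<in> carrier G \<Longrightarrow> \<bar>h a + h b - h (a \<otimes>\<^bsub>G\<^esub> b)\<bar> \<le> C" and
    D: "\<And>a b. a \<in> carrier G \<Longrightarrow> b \<in> carrier G \<Longrightarrow> \<bar>k a + k b - k (a \<otimes>\<^bsub>G\<^esub> b)\<bar> \<le> D"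
    unfolding Qh_def quasimorphism_iff by blast
  have "\<bar>(h + k) a + (h + k) b - (h + k) (a \<otimes>\<^bsub>G\<^esub> b)\<bar> \<le> C + D"
    if "a \<in> carrier G" "b \<in> carrier G" for a b
    using C[OF that] D[OF that] by simp
  then have "quasimorphism G (h + k)"
    unfolding quasimorphism_iff by blast
  then show "h + k \<in> Qh G"
    using hk by (auto simp: Qh_def homogeneous_def)
next
  fix c h assume h: "h \<in> Qh G"
  then obtain C where
    C: "\<And>a b. a \<in> carrier G \<Longrightarrow> b \<in> carrier G \<Longrightarrow> \<bar>h a + h b - h (a \<otimes>\<^bsub>G\<^esub> b)\<bar> \<le> C"
    unfolding Qh_def quasimorphism_iff by blast
  have "\<bar>c * h a + c * h b - c * h (a \<otimes>\<^bsub>G\<^esub> b)\<bar> \<le> \<bar>c\<bar> * C"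
    if "a \<in> carrier G" "b \<in> carrier G" for a b
  proof -
    have "\<bar>c * h a + c * h b - c * h (a \<otimes>\<^bsub>G\<^esub> b)\<bar> = \<bar>c\<bar> * \<bar>h a + h b - h (a \<otimes>\<^bsub>G\<^esub> b)\<bar>"
      by (metis abs_mult distrib_left right_diff_distrib)
    then show ?thesis
      using C[OF that] by (simp add: mult_left_mono)
  qed
  then have "quasimorphism G (\<lambda>x. c * h x)"
    unfolding quasimorphism_iff by blast
  then show "(\<lambda>x. c * h x) \<in> Qh G"
    using h by (auto simp: Qh_def homogeneous_def algebra_simps)
qed

definition restriction_map :: "'g set \<Rightarrow> ('g \<Rightarrow> real) \<Rightarrow> 'g \<Rightarrow> real" where
  "restriction_map H h = (\<lambda>x. if x \<in> H then h x else 0)"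

lemma restriction_map_Qh:
  assumes "group G" "subgroup H G" "h \<in> Qh G"
  shows "restriction_map H h \<in> Qh (G\<lparr>carrier := H\<rparr>)"
proof -
  interpret group G by fact
  have HG: "H \<subseteq> carrier G" and
    cl: "\<And>a b. a \<in> H \<Longrightarrow> b \<in> H \<Longrightarrow> a \<otimes>\<^bsub>G\<^esub> b \<in> H"
    using assms(2) by (auto simp: subgroup.subset subgroup.m_closed)
  have gen: "generate (G\<lparr>carrier := H\<rparr>) {g} = generate G {g}" "generate G {g} \<subseteq> H"
    if "g \<in> H" for g
    using that assms(2) generate_consistent[of "{g}" H] generate_subgroup_incl[of "{g}" H] by auto
  obtain C where
    C: "\<And>a b. a \<in> carrier G \<Longrightarrow> b \<in> carrier G \<Longrightarrow> \<bar>h a + h b - h (a \<otimes>\<^bsub>G\<^esub> b)\<bar> \<le> C"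
    using assms(3) unfolding Qh_def quasimorphism_iff by blast
  have "quasimorphism (G\<lparr>carrier := H\<rparr>) (restriction_map H h)"
    unfolding quasimorphism_iff restriction_map_def
    using C HG cl by (intro exI[of _ C]) auto
  moreover have "homogeneous (G\<lparr>carrier := H\<rparr>) (restriction_map H h)"
    unfolding homogeneous_def
  proof (intro ballI)
    fix g a b
    assume "g \<in> carrier (G\<lparr>carrier := H\<rparr>)"
      and "a \<in> generate (G\<lparr>carrier := H\<rparr>) {g}" "b \<in> generate (G\<lparr>carrier := H\<rparr>) {g}"
    then have g: "g \<in> H" and ab: "a \<in> generate G {g}" "b \<in> generate G {g}"
      using gen by auto
    then have "a \<in> H" "b \<in> H" "g \<in> carrier G"
      using gen HG by auto
    moreover have "h (a \<otimes>\<^bsub>G\<^esub> b) = h a + h b"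
      using assms(3) ab \<open>g \<in> carrier G\<close> unfolding Qh_def homogeneous_def by blast
    ultimately show "restriction_map H h (a \<otimes>\<^bsub>G\<lparr>carrier := H\<rparr>\<^esub> b)
        = restriction_map H h a + restriction_map H h b"
      using cl by (simp add: restriction_map_def)
  qed
  ultimately show ?thesis
    by (simp add: Qh_def restriction_map_def)
qed

end

theory Submission imports Defs begin

text \<open>
  Fix a group element \<open>w\<close> moving the base point \<open>x\<^sub>0\<close> far, and let \<open>D x y\<close> be the cheapest way of going from \<open>x\<close>
  to \<open>y\<close> when each jump from \<open>g x\<^sub>0\<close> to \<open>g w x\<^sub>0\<close> is granted a fixed discount \<open>W\<close>, small compared with
  \<open>d x\<^sub>0 (w x\<^sub>0)\<close>. An almost cheapest path is a broken geodesic with long segments and little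
  backtracking, so \<open>D\<close> is additive along geodesics up to a bounded error; comparing
  both orientations of a geodesic triangle through its centre shows that
  \<open>D x\<^sub>0 (g x\<^sub>0) - D (g x\<^sub>0) x\<^sub>0\<close> is a quasimorphism. Its homogenization is nonzero on \<open>f = w u\<close> as soon as no
  translate of \<open>w\<close> runs backwards along the axis of \<open>f\<close>, and it vanishes on \<open>f\<close> if no
  translate of \<open>w\<close> follows this axis in either direction.

  By WPD and the pigeonhole principle, a long overlap of the axis of a loxodromic element \<open>a\<close> with its
  translate by \<open>e\<close> implies that \<open>e\<close> conjugates a power of \<open>a\<close> to itself or to its
  inverse. For chiral \<open>a\<close> this excludes reversed copies of \<open>w = a\<^sup>N\<close>. For independent \<open>a\<close> and \<open>b\<close> in \<open>H\<close> it bounds the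
  overlap of the axis of \<open>a\<close> with its translate by \<open>b\<close>, so a copy of \<open>a\<^sup>m\<close> along a path spelled by
  long powers of \<open>a\<close> separated by \<open>b\<close> lies in a single piece. The lengths \<open>2n, 3n, n\<close> of the pieces of
  \<open>f\<^sub>n = (a\<^sup>2\<^sup>n b a\<^sup>3\<^sup>n) (b a\<^sup>n b)\<close> occur in another cyclic order when read backwards, so the
  quasimorphism of \<open>w = a\<^sup>2\<^sup>n b a\<^sup>3\<^sup>n\<close> does not vanish on \<open>f\<^sub>n\<close>; it vanishes on \<open>f\<^sub>m\<close> for \<open>m\<close> much smaller than \<open>n\<close>, where all pieces
  are too short. This gives a triangular system.
\<close>

section \<open>Hyperbolic pseudometrics\<close>

text \<open>Distinct points may have distance zero, so the path metric of a graph qualifies after it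
  is pulled back to the whole type along a retraction.\<close>

locale hyp_metric =
  fixes d :: "'v \<Rightarrow> 'v \<Rightarrow> real" and \<delta> :: real
  assumes d_self [simp]: "d x x = 0"
    and d_sym: "d x y = d y x"
    and d_triangle: "d x z \<le> d x y + d y z"
    and delta_nonneg: "0 \<le> \<delta>"
    and hyperbolic: "gromov_product d p x z \<ge> min (gromov_product d p x y) (gromov_product d p y z) - \<delta>"
begin

abbreviation gp :: "'v \<Rightarrow> 'v \<Rightarrow> 'v \<Rightarrow> real" where
  "gp \<equiv> gromov_product d"

lemma d_nonneg: "0 \<le> d x y"
  using d_triangle[of x x y] d_sym[of x y] by simp

lemma gp_sym: "gp p x y = gp p y x"
  by (simp add: gromov_product_def d_sym)

lemma gp_nonneg: "0 \<le> gp p x y"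
  using d_triangle[of x y p] d_sym by (simp add: gromov_product_def)

lemma gp_le_dist: "gp p x y \<le> d x p"
  using d_triangle[of y p x] d_sym[of x y] by (simp add: gromov_product_def)

lemma gp_switch: "gp p x y = d p x - gp x p y"
  by (simp add: gromov_product_def d_sym field_simps)

lemma gp_perturb1: "gp p x' y \<le> gp p x y + d x x'"
  using d_triangle[of x' p x] d_triangle[of x y x'] d_sym[of x x'] by (simp add: gromov_product_def field_simps)

lemma gp_perturb2: "gp p x y' \<le> gp p x y + d y y'"
  using gp_perturb1[of p y' x y] by (simp add: gp_sym)

lemma gp_perturb0: "gp p' x y \<le> gp p x y + d p p'"
  using d_triangle[of x p' p] d_triangle[of y p' p] by (simp add: gromov_product_def field_simps)

text \<open>Expanding the Gromov products in \<open>hyperbolic\<close> with base point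
  \<open>w\<close> gives this symmetric form.\<close>

lemma four_point:
  "d x y + d z w \<le> d x z + d y w + 2 * \<delta> \<or> d x y + d z w \<le> d x w + d y z + 2 * \<delta>"
proof -
  have "min (gp w x z) (gp w z y) - \<delta> \<le> gp w x y"
    by (rule hyperbolic)
  then show ?thesis
    by (auto simp: gromov_product_def min_def d_sym field_simps split: if_splits)
qed

text \<open>A point that nearly lies between \<open>x\<close> and \<open>y\<close> is determined, up
  to a bounded error, by its distance from \<open>x\<close>: in the four-point condition the
  distances to \<open>y\<close> can be exchanged for \<open>d x y\<close> minus those to
  \<open>x\<close>.\<close>

lemma fellow_travel:
  assumes "gp p x y \<le> C" "gp q x y \<le> C"
  shows "d p q \<le> \<bar>d x p - d x q\<bar> + 2 * C + 2 * \<delta>"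
  using four_point[of p q x y] assms by (auto simp: gromov_product_def d_sym)

text \<open>By \<open>fellow_travel\<close>, distances among such points are differences of their
  distances from \<open>x\<close> up to an error, so these distances behave like positions on a
  line.\<close>

lemma between_of_order:
  assumes "gp p x y \<le> C" "gp q x y \<le> C" "gp c x y \<le> C" "d x p \<le> d x c" "d x c \<le> d x q"
  shows "gp c p q \<le> 2 * C + 2 * \<delta>"
proof -
  have "d p c \<le> d x c - d x p + 2 * C + 2 * \<delta>" "d c q \<le> d x q - d x c + 2 * C + 2 * \<delta>"
    using fellow_travel[of p x y C c] fellow_travel[of c x y C q] assms by auto
  then show ?thesis
    using d_triangle[of x q p] by (simp add: gromov_product_def d_sym)
qed

text \<open>In the local-to-global principle the two extreme segments may be short.\<close>

lemma local_to_global_left: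
  fixes X :: "nat \<Rightarrow> 'v"
  assumes loc: "\<And>i. i + 2 \<le> n \<Longrightarrow> gp (X (i + 1)) (X i) (X (i + 2)) \<le> C"
    and long: "\<And>i. 1 \<le> i \<Longrightarrow> i + 2 \<le> n \<Longrightarrow> d (X i) (X (i + 1)) > 2 * C + 4 * \<delta>"
    and "j < i" "i + 1 \<le> n"
  shows "gp (X i) (X j) (X (i + 1)) \<le> C + \<delta>"
  using \<open>j < i\<close> \<open>i + 1 \<le> n\<close>
proof (induction i)
  case (Suc i)
  show ?case
  proof (cases "j = i")
    case True
    then show ?thesis using loc[of i] Suc.prems delta_nonneg by simp
  next
    case False
    then have IH: "gp (X i) (X j) (X (i + 1)) \<le> C + \<delta>"
      using Suc by simp
    have l: "d (X i) (X (i + 1)) > 2 * C + 4 * \<delta>"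
      using long[of i] False Suc.prems by simp
    \<comment> \<open>Since the segment is long, \<open>X i\<close> and \<open>X j\<close> lie in
      the same direction as seen from \<open>X (i+1)\<close>, so the bound for \<open>X i\<close>
      passes to \<open>X j\<close>.\<close>
    have "gp (X (i+1)) (X i) (X j) = d (X i) (X (i+1)) - gp (X i) (X (i+1)) (X j)"
      using gp_switch d_sym by metis
    then have "gp (X (i+1)) (X i) (X j) > C + \<delta>"
      using IH l delta_nonneg gp_sym[of "X i" "X (i+1)"] by simp
    moreover have "gp (X (i+1)) (X i) (X (i+2)) \<le> C"
      using loc[of i] Suc.prems by simp
    ultimately show ?thesis
      using hyperbolic[of "X (i+1)" "X i" "X j" "X (i+2)"] by (simp add: min_def split: if_splits)
  qed
qed simp

text \<open>The left-hand bound for the reversed chain shows that \<open>X k\<close> and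
  \<open>X (i + 1)\<close> lie in the same direction as seen from \<open>X i\<close>; hyperbolicity
  then replaces \<open>X (i + 1)\<close> by \<open>X k\<close>.\<close>

lemma local_to_global:
  fixes X :: "nat \<Rightarrow> 'v"
  assumes loc: "\<And>i. i + 2 \<le> n \<Longrightarrow> gp (X (i + 1)) (X i) (X (i + 2)) \<le> C"
    and long: "\<And>i. 1 \<le> i \<Longrightarrow> i + 2 \<le> n \<Longrightarrow> d (X i) (X (i + 1)) > 2 * C + 4 * \<delta>"
    and "j < i" "i < k" "k \<le> n"
  shows "gp (X i) (X j) (X k) \<le> C + 2 * \<delta>"
proof -
  have a: "gp (X i) (X j) (X (i + 1)) \<le> C + \<delta>"
    using local_to_global_left[OF loc long, of n j i] assms by simp
  show ?thesis
  proof (cases "k = i + 1")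
    case True
    then show ?thesis using a delta_nonneg by simp
  next
    case False
    define Y where "Y = (\<lambda>m. X (k - m))"
    have "gp (Y (k - (i+1))) (Y 0) (Y (k - (i+1) + 1)) \<le> C + \<delta>"
    proof (rule local_to_global_left[where n = k])
      show "gp (Y (m + 1)) (Y m) (Y (m + 2)) \<le> C" if "m + 2 \<le> k" for m
      proof -
        have "Suc (Suc (k - (2 + m))) = k - m" "Suc (k - (2 + m)) = k - (m + 1)" using that by auto
        then show ?thesis
          using loc[of "k - (m + 2)"] that \<open>k \<le> n\<close> gp_sym by (simp add: Y_def)
      qed
      show "d (Y m) (Y (m + 1)) > 2 * C + 4 * \<delta>" if "1 \<le> m" "m + 2 \<le> k" for m
      proof -
        have "Suc (k - (1 + m)) = k - m" using that by auto
        then show ?thesis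
          using long[of "k - (m + 1)"] that \<open>k \<le> n\<close> d_sym by (simp add: Y_def)
      qed
    qed (use False assms in auto)
    moreover have "k - (k - (i+1)) = i + 1" "k - (k - (i+1) + 1) = i"
      using assms False by auto
    ultimately have b: "gp (X (i+1)) (X k) (X i) \<le> C + \<delta>"
      by (simp add: Y_def)
    have l: "d (X i) (X (i + 1)) > 2 * C + 4 * \<delta>"
      using long[of i] False assms by simp
    have "gp (X i) (X (i+1)) (X k) = d (X i) (X (i+1)) - gp (X (i+1)) (X i) (X k)"
      by (rule gp_switch)
    then have "gp (X i) (X k) (X (i+1)) > C + 2 * \<delta>"
      using b l delta_nonneg gp_sym[of "X (i+1)"] gp_sym[of "X i"] by (simp add: gp_sym)
    then show ?thesis
      using hyperbolic[of "X i" "X j" "X k" "X (i+1)"] a by (simp add: min_def split: if_splits)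
  qed
qed

text \<open>By \<open>local_to_global_left\<close>, each further segment increases the distance from
  \<open>X 0\<close> by its length, up to twice \<open>C + \<delta>\<close>.\<close>

lemma local_to_global_length:
  fixes X :: "nat \<Rightarrow> 'v"
  assumes loc: "\<And>i. i + 2 \<le> n \<Longrightarrow> gp (X (i + 1)) (X i) (X (i + 2)) \<le> C"
    and long: "\<And>i. 1 \<le> i \<Longrightarrow> i + 2 \<le> n \<Longrightarrow> d (X i) (X (i + 1)) > 2 * C + 4 * \<delta>"
    and "0 \<le> C" "m \<le> n"
  shows "(\<Sum>i<m. d (X i) (X (i + 1)) - 2 * C - 2 * \<delta>) \<le> d (X 0) (X m)"
  using \<open>m \<le> n\<close>
proof (induction m)
  case (Suc m)
  have "gp (X m) (X 0) (X (m + 1)) \<le> C + \<delta>"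
  proof (cases "m = 0")
    case True
    then show ?thesis using assms delta_nonneg by (simp add: gromov_product_def d_sym)
  next
    case False
    show ?thesis
      by (rule local_to_global_left[OF loc long]) (use False Suc.prems in auto)
  qed
  then have "d (X 0) (X m) + (d (X m) (X (m+1)) - 2 * C - 2 * \<delta>) \<le> d (X 0) (X (Suc m))"
    by (simp add: gromov_product_def d_sym)
  with Suc show ?case by simp
qed (simp add: d_nonneg)

text \<open>A discrete intermediate value property, used to find the segment of a chain that crosses
  a given level.\<close>

lemma last_below:
  fixes u :: "nat \<Rightarrow> real"
  assumes "u 0 \<le> t" "t < u n"
  shows "\<exists>i<n. u i \<le> t \<and> t < u (Suc i)"
  using assms
proof (induction n)
  case (Suc n)
  then show ?case by (cases "t < u n") (auto intro: less_SucI)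
qed simp

text \<open>The point \<open>c\<close> lies between consecutive vertices whose distances from
  \<open>X 0\<close> enclose its own; if it is as far from \<open>X 0\<close> as \<open>X n\<close>,
  it is close to \<open>X n\<close> itself.\<close>

lemma chain_between:
  fixes X :: "nat \<Rightarrow> 'v"
  assumes "\<And>i. i \<le> n \<Longrightarrow> gp (X i) (X 0) (X n) \<le> C" "gp c (X 0) (X n) \<le> C" "1 \<le> n"
  shows "\<exists>i<n. gp c (X i) (X (Suc i)) \<le> 2 * C + 2 * \<delta>"
proof (cases "d (X 0) c < d (X 0) (X n)")
  case True
  then obtain i where "i < n" "d (X 0) (X i) \<le> d (X 0) c" "d (X 0) c < d (X 0) (X (Suc i))"
    using last_below[of "\<lambda>i. d (X 0) (X i)" "d (X 0) c" n] d_nonneg by auto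
  then have "gp c (X i) (X (Suc i)) \<le> 2 * C + 2 * \<delta>"
    using assms by (intro between_of_order[of _ "X 0" "X n"]) auto
  then show ?thesis using \<open>i < n\<close> by blast
next
  case False
  then have "d c (X n) \<le> 2 * C"
    using assms(2) by (simp add: gromov_product_def d_sym)
  moreover have "gp c (X (n - 1)) (X n) \<le> d c (X n)"
    using gp_le_dist[of c "X n" "X (n-1)"] d_sym gp_sym by metis
  moreover have "Suc (n - 1) = n" using assms(3) by simp
  ultimately show ?thesis
    using assms(3) delta_nonneg by (intro exI[of _ "n - 1"]) auto
qed

lemma chain_near:
  fixes X :: "nat \<Rightarrow> 'v"
  assumes "\<And>i. i \<le> n \<Longrightarrow> gp (X i) (X 0) (X n) \<le> C" "gp c (X 0) (X n) \<le> C"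
    and "\<And>i. i < n \<Longrightarrow> d (X i) (X (Suc i)) \<le> s" "0 \<le> s"
  shows "\<exists>i\<le>n. d c (X i) \<le> 2 * C + 2 * \<delta> + s"
proof (cases "1 \<le> n")
  case True
  then obtain i where i: "i < n" "gp c (X i) (X (Suc i)) \<le> 2 * C + 2 * \<delta>"
    using chain_between[OF assms(1,2)] by auto
  have "d c (X i) \<le> gp c (X i) (X (Suc i)) + d (X i) (X (Suc i))"
    using d_triangle[of c "X i" "X (Suc i)"] by (simp add: gromov_product_def d_sym field_simps)
  then show ?thesis
    using i assms(3)[of i] by (intro exI[of _ i]) auto
next
  case False
  then have "n = 0" by simp
  then show ?thesis
    using assms delta_nonneg gp_nonneg[of c "X 0" "X n"] by (intro exI[of _ 0]) (auto simp: gromov_product_def d_sym)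
qed

end

section \<open>Homogenization and the jump distance\<close>

text \<open>The limit of \<open>q (g [^] n) / n\<close> stays within \<open>2 * C\<close> of
  \<open>q\<close> and is linear on powers; oddness of \<open>q\<close> settles the negative
  exponents. The final estimate lets the size of \<open>q\<close> along the powers of
  \<open>g\<close> decide whether \<open>h g\<close> vanishes.\<close>

lemma (in group) homogenization:
  assumes quasi: "\<And>a b. a \<in> carrier G \<Longrightarrow> b \<in> carrier G \<Longrightarrow> \<bar>q a + q b - q (a \<otimes> b)\<bar> \<le> C"
    and odd: "\<And>a. a \<in> carrier G \<Longrightarrow> q (inv a) = - q a"
  shows "\<exists>h\<in>Qh G. \<forall>g\<in>carrier G. \<forall>k::nat. \<bar>real k * h g - q (g [^] k)\<bar> \<le> 2 * C"
proof -
  have C0: "0 \<le> C"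
    using quasi[of \<one> \<one>] by (meson abs_ge_zero one_closed order_trans)
  have pow: "\<bar>q (g [^] k) - real k * q g\<bar> \<le> (real k + 1) * C" if g: "g \<in> carrier G" for g and k :: nat
  proof (induction k)
    case 0
    have "q \<one> = 0" using odd[of \<one>] by simp
    then show ?case using C0 by simp
  next
    case (Suc k)
    have "\<bar>q (g [^] k) + q g - q (g [^] Suc k)\<bar> \<le> C"
      using quasi[of "g [^] k" g] g by simp
    with Suc show ?case
      by (simp add: algebra_simps abs_le_iff)
  qed
  \<comment> \<open>Indexing by \<open>Suc n\<close> avoids the division by zero.\<close>
  define u where "u = (\<lambda>g n. q (g [^] (Suc n)) / real (Suc n))"
  have uc: "\<bar>u (g [^] k) n - real k * u g n\<bar> \<le> 2 * C * (real k + 1) / real (Suc n)"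
    if g: "g \<in> carrier G" for g and k n :: nat
  proof -
    have "(g [^] k) [^] Suc n = (g [^] Suc n) [^] k"
      by (metis g nat_pow_pow mult.commute)
    then have "\<bar>q ((g [^] k) [^] Suc n) - real k * q (g [^] Suc n)\<bar> \<le> (real k + 1) * C"
      using pow[of "g [^] Suc n" k] g by simp
    also have "\<dots> \<le> 2 * C * (real k + 1)"
      using C0 by simp
    finally have "\<bar>q ((g [^] k) [^] Suc n) - real k * q (g [^] Suc n)\<bar> / real (Suc n) \<le> 2 * C * (real k + 1) / real (Suc n)"
      by (simp add: divide_right_mono)
    moreover have "u (g [^] k) n - real k * u g n = (q ((g [^] k) [^] Suc n) - real k * q (g [^] Suc n)) / real (Suc n)"
      by (simp add: u_def diff_divide_distrib)
    ultimately show ?thesis by (simp add: abs_divide)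
  qed
  \<comment> \<open>Both quotients are compared with the value of \<open>q\<close> at the common
    power of exponent \<open>Suc m * Suc n\<close>.\<close>
  have near: "\<bar>u g m - u g n\<bar> \<le> 2 * C / real (Suc n) + 2 * C / real (Suc m)"
    if g: "g \<in> carrier G" for g m n
  proof -
    have frac: "\<bar>x / M - y / N\<bar> \<le> 2 * C / N + 2 * C / M"
      if "M > 0" "N > 0" "\<bar>N * x - M * y\<bar> \<le> 2 * C * N + 2 * C * M" for x y M N :: real
    proof -
      have "\<bar>x / M - y / N\<bar> = \<bar>N * x - M * y\<bar> / (M * N)"
        using that by (simp add: diff_frac_eq abs_divide abs_mult mult.commute)
      also have "\<dots> \<le> (2 * C * N + 2 * C * M) / (M * N)"
        using that by (intro divide_right_mono) auto
      also have "\<dots> = 2 * C / N + 2 * C / M"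
        using that by (simp add: add_divide_distrib)
      finally show ?thesis .
    qed
    have pow2: "\<bar>q (g [^] (i * Suc j)) - real (Suc j) * q (g [^] i)\<bar> \<le> (real (Suc j) + 1) * C" for i j
      using pow[OF nat_pow_closed[OF g], of i "Suc j"] unfolding nat_pow_pow[OF g] .
    have "(real (Suc n) + 1) * C + (real (Suc m) + 1) * C \<le> 2 * C * real (Suc n) + 2 * C * real (Suc m)"
      using C0 by (simp add: algebra_simps)
    then have "\<bar>real (Suc n) * q (g [^] Suc m) - real (Suc m) * q (g [^] Suc n)\<bar>
        \<le> 2 * C * real (Suc n) + 2 * C * real (Suc m)"
      using pow2[of "Suc m" n] pow2[of "Suc n" m] unfolding mult.commute[of "Suc n" "Suc m"]
      by arith
    then show ?thesis
      unfolding u_def by (intro frac) auto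
  qed
  have small: "(\<lambda>n. B / real (Suc n)) \<longlonglongrightarrow> 0" for B :: real
    using LIMSEQ_Suc[OF lim_const_over_n[of B]] by simp
  have conv: "convergent (u g)" if g: "g \<in> carrier G" for g
  proof (rule Cauchy_convergent, rule metric_CauchyI)
    fix e :: real assume "0 < e"
    then obtain N where N: "\<And>n. n \<ge> N \<Longrightarrow> \<bar>2 * C / real (Suc n)\<bar> < e / 2"
      using LIMSEQ_D[OF small[of "2 * C"], of "e / 2"] by auto
    have "dist (u g m) (u g n) < e" if "m \<ge> N" "n \<ge> N" for m n
      using near[OF g, of m n] N[OF that(1)] N[OF that(2)] unfolding dist_real_def by linarith
    then show "\<exists>M. \<forall>m\<ge>M. \<forall>n\<ge>M. dist (u g m) (u g n) < e" by blast
  qed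
  define h where "h = (\<lambda>g. if g \<in> carrier G then lim (u g) else 0)"
  have lim: "u g \<longlonglongrightarrow> h g" if "g \<in> carrier G" for g
    using conv[OF that] that by (simp add: h_def convergent_LIMSEQ_iff)
  have close: "\<bar>h g - q g\<bar> \<le> 2 * C" if g: "g \<in> carrier G" for g
  proof (rule tendsto_upperbound)
    show "(\<lambda>n. \<bar>u g n - q g\<bar>) \<longlonglongrightarrow> \<bar>h g - q g\<bar>"
      by (intro tendsto_intros lim g)
    have "\<bar>u g n - q g\<bar> \<le> 2 * C" for n
    proof -
      have "(real (Suc n) + 1) * C \<le> (2 * C) * real (Suc n)"
        using C0 by (simp add: algebra_simps)
      then have "\<bar>q (g [^] Suc n) - real (Suc n) * q g\<bar> \<le> (2 * C) * real (Suc n)"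
        using pow[OF g, of "Suc n"] by (rule order_trans[rotated])
      moreover have "u g n - q g = (q (g [^] Suc n) - real (Suc n) * q g) / real (Suc n)"
        unfolding u_def by (simp only: diff_divide_distrib) simp
      ultimately show ?thesis
        by (simp add: abs_divide pos_divide_le_eq del: nat_pow_Suc of_nat_Suc)
    qed
    then show "\<forall>\<^sub>F n in sequentially. \<bar>u g n - q g\<bar> \<le> 2 * C" by simp
  qed simp
  have hpow: "h (g [^] k) = real k * h g" if g: "g \<in> carrier G" for g and k :: nat
  proof -
    have "(\<lambda>n. \<bar>u (g [^] k) n - real k * u g n\<bar>) \<longlonglongrightarrow> 0"
      by (rule tendsto_sandwich[OF _ _ tendsto_const small[of "2 * C * (real k + 1)"]])
        (use uc[OF g, of k] in auto)
    moreover have "(\<lambda>n. \<bar>u (g [^] k) n - real k * u g n\<bar>) \<longlonglongrightarrow> \<bar>h (g [^] k) - real k * h g\<bar>"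
      by (intro tendsto_intros lim) (use g in auto)
    ultimately show ?thesis
      using LIMSEQ_unique by fastforce
  qed
  have hinv: "h (inv g) = - h g" if g: "g \<in> carrier G" for g
  proof -
    have "q (inv g [^] k) = - q (g [^] k)" for k :: nat
      using odd[of "g [^] k"] g by (simp add: nat_pow_inv)
    then have "u (inv g) = (\<lambda>n. - u g n)"
      by (simp only: u_def minus_divide_left)
    then have "u (inv g) \<longlonglongrightarrow> - h g"
      using lim[OF g] tendsto_minus by fastforce
    then show ?thesis
      using lim[of "inv g"] g LIMSEQ_unique by auto
  qed
  have hint: "h (g [^] k) = real_of_int k * h g" if g: "g \<in> carrier G" for g and k :: int
  proof (cases k)
    case (nonneg n)
    then show ?thesis using hpow[OF g, of n] by (simp add: int_pow_int)
  next
    case (neg n)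
    have "h (g [^] k) = - h (g [^] Suc n)"
      unfolding neg int_pow_neg_int[OF g] by (rule hinv) (use g in simp)
    also have "\<dots> = real_of_int k * h g"
      unfolding hpow[OF g] neg by (simp add: algebra_simps)
    finally show ?thesis .
  qed
  have "h \<in> Qh G"
    unfolding Qh_def
  proof (intro CollectI conjI allI impI)
    \<comment> \<open>Three times the distance \<open>2 * C\<close> between \<open>h\<close> and
      \<open>q\<close>, plus the defect \<open>C\<close> of \<open>q\<close>.\<close>
    have "\<bar>h a + h b - h (a \<otimes> b)\<bar> \<le> 7 * C" if "a \<in> carrier G" "b \<in> carrier G" for a b
      using quasi[OF that] close[OF that(1)] close[OF that(2)] close[of "a \<otimes> b"] that m_closed[OF that]
      by linarith
    then show "quasimorphism G h"
      unfolding quasimorphism_iff by blast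
    show "homogeneous G h"
      unfolding homogeneous_def
    proof (intro ballI)
      fix g a b assume g: "g \<in> carrier G" and "a \<in> generate G {g}" "b \<in> generate G {g}"
      then obtain i j :: int where "a = g [^] i" "b = g [^] j"
        using generate_pow[OF g] by auto
      then show "h (a \<otimes> b) = h a + h b"
        by (simp only: int_pow_mult[OF g, symmetric] hint[OF g] of_int_add distrib_right)
    qed
  qed (simp add: h_def)
  moreover have "\<bar>real k * h g - q (g [^] k)\<bar> \<le> 2 * C" if "g \<in> carrier G" for g and k :: nat
    using close[of "g [^] k"] hpow[OF that] that by simp
  ultimately show ?thesis by blast
qed

text \<open>The action is recorded through the orbit map \<open>pt\<close> of a base point. Coarse
  centres of triangles, lying nearly on all three sides, take the place of geodesics.\<close>

locale hyp_group = hyp_metric d \<delta> + group G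
  for d :: "'v \<Rightarrow> 'v \<Rightarrow> real" and \<delta> and G :: "('g, 'b) monoid_scheme" (structure) +
  fixes pt :: "'g \<Rightarrow> 'v" and tripod :: real
  assumes pt_invariant: "g \<in> carrier G \<Longrightarrow> h \<in> carrier G \<Longrightarrow> k \<in> carrier G \<Longrightarrow>
      d (pt (g \<otimes> h)) (pt (g \<otimes> k)) = d (pt h) (pt k)"
    and tripod_centre: "\<exists>c. gromov_product d c x y \<le> tripod \<and> gromov_product d c y z \<le> tripod \<and> gromov_product d c x z \<le> tripod"
begin

definition len :: "'g \<Rightarrow> real" where "len g = d (pt \<one>) (pt g)"

lemma gp_invariant:
  assumes "g \<in> carrier G" "h \<in> carrier G" "k \<in> carrier G" "l \<in> carrier G"
  shows "gp (pt (g \<otimes> h)) (pt (g \<otimes> k)) (pt (g \<otimes> l)) = gp (pt h) (pt k) (pt l)"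
  using assms by (simp add: gromov_product_def pt_invariant)

lemma d_len:
  assumes "g \<in> carrier G" "h \<in> carrier G"
  shows "d (pt g) (pt (g \<otimes> h)) = len h"
  using pt_invariant[OF assms(1) one_closed assms(2)] assms by (simp add: len_def)

text \<open>The path from \<open>x\<close> to \<open>y\<close> that jumps, for each \<open>g\<close> in the list, from \<open>pt g\<close> to \<open>pt (g \<otimes> w)\<close>
  at the discounted price \<open>\<kappa>\<close>.\<close>

primrec cost :: "'g \<Rightarrow> real \<Rightarrow> 'v \<Rightarrow> 'g list \<Rightarrow> 'v \<Rightarrow> real" where
  "cost w \<kappa> x [] y = d x y"
| "cost w \<kappa> x (g # gs) y = d x (pt g) + \<kappa> + cost w \<kappa> (pt (g \<otimes> w)) gs y"

text \<open>Not symmetric in general, since the discount is granted only from \<open>pt g\<close> to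
  \<open>pt (g \<otimes> w)\<close>; this asymmetry is what the quasimorphism measures.\<close>

definition jdist :: "'g \<Rightarrow> real \<Rightarrow> 'v \<Rightarrow> 'v \<Rightarrow> real" where
  "jdist w \<kappa> x y = (INF gs\<in>lists (carrier G). cost w \<kappa> x gs y)"

definition jend :: "'g \<Rightarrow> 'v \<Rightarrow> 'g list \<Rightarrow> 'v" where
  "jend w x gs = (if gs = [] then x else pt (last gs \<otimes> w))"

lemma cost_append:
  "cost w \<kappa> x (gs @ hs) y = cost w \<kappa> x gs (jend w x gs) + cost w \<kappa> (jend w x gs) hs y"
  by (induction gs arbitrary: x) (auto simp: jend_def)

lemma cost_triangle: "cost w \<kappa> x (gs @ hs) z \<le> cost w \<kappa> x gs y + cost w \<kappa> y hs z"
proof (induction gs arbitrary: x)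
  case Nil
  then show ?case
    by (cases hs) (auto intro: d_triangle)
qed auto

lemma cost_invariant:
  assumes "a \<in> carrier G" "w \<in> carrier G" "x \<in> carrier G" "y \<in> carrier G" "gs \<in> lists (carrier G)"
  shows "cost w \<kappa> (pt (a \<otimes> x)) (map ((\<otimes>) a) gs) (pt (a \<otimes> y)) = cost w \<kappa> (pt x) gs (pt y)"
  using \<open>x \<in> carrier G\<close> \<open>gs \<in> lists (carrier G)\<close>
proof (induction gs arbitrary: x)
  case (Cons g gs)
  then show ?case
    using Cons.IH[of "g \<otimes> w"] assms by (simp add: pt_invariant m_assoc)
qed (use assms in \<open>simp add: pt_invariant\<close>)

context
  fixes w :: 'g and \<kappa> W :: real
  assumes w: "w \<in> carrier G" and kappa: "0 \<le> \<kappa>" "0 \<le> W" "len w = \<kappa> + W"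
    and kappa_large: "2 * W + 2 + 4 * \<delta> < \<kappa>"
begin

private abbreviation "D \<equiv> jdist w \<kappa>"

lemma cost_nonneg: "0 \<le> cost w \<kappa> x gs y"
  by (induction gs arbitrary: x) (auto simp: d_nonneg kappa)

lemma jdist_le_cost: "gs \<in> lists (carrier G) \<Longrightarrow> D x y \<le> cost w \<kappa> x gs y"
  unfolding jdist_def by (rule cINF_lower) (auto simp: bdd_below_def intro: cost_nonneg)

lemma jdist_near: "e > 0 \<Longrightarrow> \<exists>gs\<in>lists (carrier G). cost w \<kappa> x gs y < D x y + e"
proof -
  assume "e > 0"
  have "lists (carrier G) \<noteq> {}" by (metis empty_iff lists.Nil)
  then show ?thesis
    using cINF_less_iff[of "lists (carrier G)" "\<lambda>gs. cost w \<kappa> x gs y" "D x y + e"] \<open>e > 0\<close>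
    unfolding jdist_def by (auto simp: bdd_below_def intro: cost_nonneg)
qed

lemma jdist_le_dist: "D x y \<le> d x y"
  using jdist_le_cost[of "[]"] by simp

lemma jdist_triangle: "D x z \<le> D x y + D y z"
proof (rule field_le_epsilon)
  fix e :: real assume "e > 0"
  then obtain gs hs where "gs \<in> lists (carrier G)" "hs \<in> lists (carrier G)"
      "cost w \<kappa> x gs y < D x y + e / 2" "cost w \<kappa> y hs z < D y z + e / 2"
    using jdist_near[of "e / 2"] by (meson half_gt_zero)
  then show "D x z \<le> D x y + D y z + e"
    using jdist_le_cost[of "gs @ hs" x z] cost_triangle[of w \<kappa> x gs hs z y] by auto
qed

lemma jdist_invariant_le:
  assumes "a \<in> carrier G" "x \<in> carrier G" "y \<in> carrier G"
  shows "D (pt (a \<otimes> x)) (pt (a \<otimes> y)) \<le> D (pt x) (pt y)"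
proof (rule field_le_epsilon)
  fix e :: real assume "e > 0"
  then obtain gs where gs: "gs \<in> lists (carrier G)" "cost w \<kappa> (pt x) gs (pt y) < D (pt x) (pt y) + e"
    using jdist_near by blast
  then have "map ((\<otimes>) a) gs \<in> lists (carrier G)"
    using assms by auto
  then have "D (pt (a \<otimes> x)) (pt (a \<otimes> y)) \<le> cost w \<kappa> (pt (a \<otimes> x)) (map ((\<otimes>) a) gs) (pt (a \<otimes> y))"
    by (rule jdist_le_cost)
  then show "D (pt (a \<otimes> x)) (pt (a \<otimes> y)) \<le> D (pt x) (pt y) + e"
    using gs cost_invariant[OF assms(1) w assms(2,3) gs(1)] by simp
qed

lemma jdist_invariant:
  assumes "a \<in> carrier G" "x \<in> carrier G" "y \<in> carrier G"
  shows "D (pt (a \<otimes> x)) (pt (a \<otimes> y)) = D (pt x) (pt y)"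
proof (rule antisym)
  show "D (pt x) (pt y) \<le> D (pt (a \<otimes> x)) (pt (a \<otimes> y))"
    using jdist_invariant_le[of "inv a" "a \<otimes> x" "a \<otimes> y"] assms by (simp add: m_assoc[symmetric])
qed (rule jdist_invariant_le[OF assms])

text \<open>If two consecutive jumps of an almost cheapest path backtracked by much more than the
  discount \<open>W\<close>, going directly would be cheaper. So its vertices form a broken geodesic to which
  the local-to-global principle applies.\<close>

lemma almost_cheapest_path:
  obtains X :: "nat \<Rightarrow> 'v" and n where "X 0 = x" "X (Suc n) = y"
    "\<And>i. i \<le> Suc n \<Longrightarrow> gp (X i) x y \<le> W + 1/2 + 2 * \<delta>"
    "\<And>i. i \<le> n \<Longrightarrow> D x (X i) + d (X i) (X (Suc i)) + D (X (Suc i)) y \<le> D x y + W + 1"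
    "D x y + 1 < d x y \<Longrightarrow>
       \<exists>g\<in>carrier G. d x (pt g) + len w + d (pt (g \<otimes> w)) y \<le> d x y + 3 * W + 2 + 4 * \<delta>"
proof -
  obtain gs where gs: "gs \<in> lists (carrier G)" and cheap: "cost w \<kappa> x gs y \<le> D x y + 1"
    using jdist_near[of 1 x y] by fastforce
  define n where "n = length gs"
  define Y where "Y = (\<lambda>i. jend w x (take i gs))"
  define X where "X = (\<lambda>i. if i \<le> n then Y i else y)"
  have inl: "take i (drop j gs) \<in> lists (carrier G)" "take i gs \<in> lists (carrier G)" "drop i gs \<in> lists (carrier G)" for i j
    using gs by (auto dest: in_set_takeD in_set_dropD)
  have gi: "gs ! i \<in> carrier G" if "i < n" for i
    using gs that by (auto simp: n_def)
  have Y0: "Y 0 = x" by (simp add: Y_def jend_def)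
  have YS: "Y (Suc i) = pt (gs ! i \<otimes> w)" if "i < n" for i
    using that by (auto simp: Y_def jend_def n_def take_Suc_conv_app_nth)
  define P where "P = (\<lambda>i. cost w \<kappa> x (take i gs) (Y i))"
  define S where "S = (\<lambda>i. cost w \<kappa> (Y i) (drop i gs) y)"
  have PS: "P i + S i = cost w \<kappa> x gs y" for i
    using cost_append[of w \<kappa> x "take i gs" "drop i gs" y] by (simp add: P_def S_def Y_def)
  define c where "c = (\<lambda>i. d (Y i) (pt (gs ! i)) + \<kappa>)"
  have Sstep: "S i = c i + S (Suc i)" if "i < n" for i
    using that by (simp add: S_def c_def YS n_def Cons_nth_drop_Suc[symmetric])
  have Send: "S n = d (Y n) y" by (simp add: S_def n_def)
  have DP: "D x (Y i) \<le> P i" and DS: "D (Y i) y \<le> S i" for i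
    unfolding P_def S_def by (rule jdist_le_cost, rule inl)+
  \<comment> \<open>Going directly from \<open>Y i\<close> to \<open>Y j\<close> saves at most 1,
    the amount by which the list may miss the infimum.\<close>
  have shortcut: "S i - S j \<le> d (Y i) (Y j) + 1" for i j
  proof -
    have "D x y \<le> P i + d (Y i) (Y j) + S j"
      using jdist_triangle[of x y "Y i"] jdist_triangle[of "Y i" y "Y j"] DP[of i] DS[of j]
        jdist_le_dist[of "Y i" "Y j"] by linarith
    then show ?thesis using PS[of i] cheap by linarith
  qed
  have shortcut_end: "S i \<le> d (Y i) y + 1" for i
    using jdist_triangle[of x y "Y i"] DP[of i] jdist_le_dist[of "Y i" y] PS[of i] cheap by linarith
  \<comment> \<open>The true length of a step exceeds its price by at most the discount.\<close>
  have step: "d (Y i) (Y (Suc i)) \<le> c i + W" if "i < n" for i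
  proof -
    have "d (pt (gs ! i)) (Y (Suc i)) = len w"
      using d_len[OF gi[OF that] w] that by (simp add: YS)
    then show ?thesis
      using d_triangle[of "Y i" "Y (Suc i)" "pt (gs ! i)"] kappa by (simp add: c_def)
  qed
  \<comment> \<open>Two steps exceed their price by at most \<open>W\<close> each, and the price
    exceeds the direct distance by at most 1; halving gives the bound.\<close>
  have loc: "gp (X (i + 1)) (X i) (X (i + 2)) \<le> W + 1/2" if "i + 2 \<le> Suc n" for i
  proof (cases "i + 2 \<le> n")
    case True
    have "c i + c (Suc i) \<le> d (Y i) (Y (Suc (Suc i))) + 1"
      using shortcut[of i "Suc (Suc i)"] Sstep[of i] Sstep[of "Suc i"] True by simp
    then show ?thesis
      using step[of i] step[of "Suc i"] True by (simp add: X_def gromov_product_def d_sym field_simps)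
  next
    case False
    then have n: "n = Suc i" using that by simp
    have "c i + d (Y n) y \<le> d (Y i) y + 1"
      using shortcut_end[of i] Sstep[of i] n Send by simp
    then show ?thesis
      using step[of i] n kappa by (simp add: X_def gromov_product_def d_sym field_simps)
  qed
  \<comment> \<open>A step ending in a jump has length at least \<open>\<kappa> - 1\<close>, so
    \<open>kappa_large\<close> is the threshold of \<open>local_to_global\<close> for the constant
    \<open>W + 1/2\<close>.\<close>
  have long: "d (X i) (X (i + 1)) > 2 * (W + 1/2) + 4 * \<delta>" if "1 \<le> i" "i + 2 \<le> Suc n" for i
  proof -
    have "c i \<le> d (Y i) (Y (Suc i)) + 1"
      using shortcut[of i "Suc i"] Sstep[of i] that by simp
    moreover have "\<kappa> \<le> c i" by (simp add: c_def d_nonneg)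
    ultimately show ?thesis
      using that kappa_large by (simp add: X_def field_simps)
  qed
  have X0: "X 0 = x" and Xn: "X (Suc n) = y"
    by (auto simp: X_def Y0)
  have gpX: "gp (X i) x y \<le> W + 1/2 + 2 * \<delta>" if "i \<le> Suc n" for i
  proof -
    consider "i = 0" | "i = Suc n" | "0 < i" "i < Suc n" using \<open>i \<le> Suc n\<close> by linarith
    then show ?thesis
    proof cases
      case 3
      then show ?thesis
        using local_to_global[OF loc long, of "Suc n" 0 i "Suc n"] by (simp add: X0 Xn)
    qed (use X0 Xn kappa delta_nonneg in \<open>auto simp: gromov_product_def d_sym\<close>)
  qed
  have mid: "D x (X i) + d (X i) (X (Suc i)) + D (X (Suc i)) y \<le> D x y + W + 1" if "i \<le> n" for i
  proof (cases "i < n")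
    case True
    then show ?thesis
      using DP[of i] DS[of "Suc i"] step[of i] Sstep[of i] PS[of i] cheap by (simp add: X_def)
  next
    case False
    then have "i = n" using that by simp
    moreover have "D y y \<le> 0" using jdist_le_dist[of y y] by simp
    ultimately show ?thesis
      using DP[of n] Send PS[of n] cheap kappa by (simp add: X_def)
  qed
  \<comment> \<open>The direct path is too expensive, so the list contains a jump; its first one is
    the required copy.\<close>
  have "\<exists>g\<in>carrier G. d x (pt g) + len w + d (pt (g \<otimes> w)) y \<le> d x y + 3 * W + 2 + 4 * \<delta>"
    if "D x y + 1 < d x y"
  proof -
    have n: "0 < n"
      using that cheap by (cases gs) (auto simp: n_def)
    have "c 0 \<le> d x (Y 1) + 1"
      using shortcut[of 0 1] Sstep[of 0] n Y0 by simp
    then have "d x (pt (gs ! 0)) + len w \<le> d x (Y 1) + 1 + W"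
      using Y0 kappa by (simp add: c_def)
    moreover have "d x (Y 1) + d (Y 1) y \<le> d x y + 2 * W + 1 + 4 * \<delta>"
      using gpX[of 1] n by (simp add: X_def gromov_product_def d_sym field_simps)
    ultimately have "d x (pt (gs ! 0)) + len w + d (pt (gs ! 0 \<otimes> w)) y \<le> d x y + 3 * W + 2 + 4 * \<delta>"
      using YS[of 0] n by simp
    then show ?thesis using gi[of 0] n by blast
  qed
  with X0 Xn gpX mid show ?thesis by (rule that)
qed

text \<open>The point \<open>c\<close> is near some segment of an almost cheapest path, and breaking
  this segment at \<open>c\<close> costs a bounded amount.\<close>

lemma jdist_additive:
  assumes "gp c x y \<le> B" "W + 1/2 + 2 * \<delta> \<le> B"
  shows "D x c + D c y \<le> D x y + (W + 1 + 4 * B + 4 * \<delta>)"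
proof -
  obtain X n where X: "X 0 = x" "X (Suc n) = y"
    and g: "\<And>i. i \<le> Suc n \<Longrightarrow> gp (X i) x y \<le> W + 1/2 + 2 * \<delta>"
    and m: "\<And>i. i \<le> n \<Longrightarrow> D x (X i) + d (X i) (X (Suc i)) + D (X (Suc i)) y \<le> D x y + W + 1"
    using almost_cheapest_path[of x y] by metis
  obtain i where "i < Suc n" and i: "gp c (X i) (X (Suc i)) \<le> 2 * B + 2 * \<delta>"
    using chain_between[of "Suc n" X B c] X g assms by force
  then have "D x (X i) + d (X i) (X (Suc i)) + D (X (Suc i)) y \<le> D x y + W + 1"
    using m by simp
  moreover have "D x c \<le> D x (X i) + d (X i) c"
    using jdist_triangle[of x c "X i"] jdist_le_dist[of "X i" c] by linarith
  moreover have "D c y \<le> D (X (Suc i)) y + d c (X (Suc i))"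
    using jdist_triangle[of c y "X (Suc i)"] jdist_le_dist[of c "X (Suc i)"] by linarith
  moreover have "d (X i) c + d c (X (Suc i)) \<le> d (X i) (X (Suc i)) + 4 * B + 4 * \<delta>"
    using i by (simp add: gromov_product_def d_sym field_simps)
  ultimately show ?thesis by linarith
qed

definition jq :: "'g \<Rightarrow> real" where
  "jq g = D (pt \<one>) (pt g) - D (pt g) (pt \<one>)"

text \<open>Each side of the triangle is broken at a coarse centre, in both orientations; the
  resulting terms cancel in pairs and leave six errors of size \<open>K\<close>.\<close>

lemma jq_quasi:
  "\<exists>C. \<forall>a\<in>carrier G. \<forall>b\<in>carrier G. \<bar>jq a + jq b - jq (a \<otimes> b)\<bar> \<le> C"
proof -
  define B where "B = max tripod (W + 1/2 + 2 * \<delta>)"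
  define K where "K = W + 1 + 4 * B + 4 * \<delta>"
  have "\<bar>jq a + jq b - jq (a \<otimes> b)\<bar> \<le> 6 * K" if ab: "a \<in> carrier G" "b \<in> carrier G" for a b
  proof -
    define x y z where "x = pt \<one>" and "y = pt a" and "z = pt (a \<otimes> b)"
    have jb: "jq b = D y z - D z y"
      using jdist_invariant[of a \<one> b] jdist_invariant[of a b \<one>] ab by (simp add: jq_def y_def z_def)
    obtain c where c: "gp c x y \<le> B" "gp c y z \<le> B" "gp c x z \<le> B"
      using tripod_centre[of x y z] unfolding B_def by (meson max.coboundedI1)
    have add: "\<bar>D p c + D c q - D p q\<bar> \<le> K" "\<bar>D q c + D c p - D q p\<bar> \<le> K" if "gp c p q \<le> B" for p q
      using jdist_additive[of c p q B] jdist_additive[of c q p B] that gp_sym[of c p q]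
        jdist_triangle[of p q c] jdist_triangle[of q p c] delta_nonneg kappa
      by (auto simp: K_def B_def)
    show ?thesis
      using add[OF c(1)] add[OF c(2)] add[OF c(3)] unfolding jb unfolding jq_def x_def[symmetric] y_def[symmetric] z_def[symmetric]
      by linarith
  qed
  then show ?thesis by blast
qed

end

end

section \<open>Quasimorphisms counting copies of a word\<close>

context hyp_group begin

text \<open>What \<open>almost_cheapest_path\<close> yields when jumps pay off: a translate of
  \<open>w\<close> nearly on a geodesic from \<open>x\<close> to \<open>y\<close> and running in
  that direction.\<close>

definition copy_between :: "'g \<Rightarrow> real \<Rightarrow> 'v \<Rightarrow> 'v \<Rightarrow> bool" where
  "copy_between w W x y \<longleftrightarrow>
     (\<exists>g\<in>carrier G. d x (pt g) + len w + d (pt (g \<otimes> w)) y \<le> d x y + 3 * W + 2 + 4 * \<delta>)"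

text \<open>Where no copy occurs in a direction, \<open>jdist\<close> agrees with \<open>d\<close>
  up to 1 in this direction. With copies in neither direction \<open>jq\<close> is bounded on the
  powers of \<open>f\<close>; with copies forwards only, each factor \<open>w\<close> gains, and
  \<open>\<eta>\<close> is the net gain per power.\<close>

lemma jump_quasimorphism:
  assumes w: "w \<in> carrier G" and W: "0 \<le> W" "3 * W + 2 + 4 * \<delta> < len w"
  shows "\<exists>h\<in>Qh G. \<forall>f\<in>carrier G. (\<forall>k::nat. \<not> copy_between w W (pt (f [^] k)) (pt \<one>)) \<longrightarrow>
     ((\<forall>k::nat. \<not> copy_between w W (pt \<one>) (pt (f [^] k))) \<longrightarrow> h f = 0) \<and>
     (\<forall>u\<in>carrier G. \<forall>\<eta>>0. f = w \<otimes> u \<and> (\<forall>k::nat. real k * (len w + len u - W + \<eta>) \<le> len (f [^] k)) \<longrightarrow> h f \<noteq> 0)"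
proof -
  define \<kappa> where "\<kappa> = len w - W"
  have \<kappa>: "0 \<le> \<kappa>" "0 \<le> W" "len w = \<kappa> + W" "2 * W + 2 + 4 * \<delta> < \<kappa>"
    using W delta_nonneg by (auto simp: \<kappa>_def)
  note ctx = w \<kappa>
  let ?D = "jdist w \<kappa>" and ?q = "jq w \<kappa>"
  obtain C where C: "\<And>a b. a \<in> carrier G \<Longrightarrow> b \<in> carrier G \<Longrightarrow> \<bar>?q a + ?q b - ?q (a \<otimes> b)\<bar> \<le> C"
    using jq_quasi[OF ctx] by blast
  have "?q (inv a) = - ?q a" if "a \<in> carrier G" for a
    using jdist_invariant[OF ctx, of a \<one> "inv a"] jdist_invariant[OF ctx, of a "inv a" \<one>] that
    by (simp add: jq_def[OF ctx])
  then obtain h where h: "h \<in> Qh G"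
      and hk: "\<And>g k. g \<in> carrier G \<Longrightarrow> \<bar>real k * h g - ?q (g [^] k)\<bar> \<le> 2 * C"
    using homogenization[of ?q C] C by blast
  have no_copy: "d x y \<le> ?D x y + 1" if "\<not> copy_between w W x y" for x y
    using almost_cheapest_path[OF ctx, of x y] that unfolding copy_between_def by (metis not_le)
  have bounded_zero: "t = 0" if "\<And>k::nat. \<bar>real k * t\<bar> \<le> M" for t M :: real
  proof (rule ccontr)
    assume "t \<noteq> 0"
    then obtain k :: nat where "M < real k * \<bar>t\<bar>"
      using reals_Archimedean3[of "\<bar>t\<bar>"] by auto
    then show False using that[of k] by (simp add: abs_mult)
  qed
  have "h f = 0"
    if f: "f \<in> carrier G" and "\<forall>k::nat. \<not> copy_between w W (pt (f [^] k)) (pt \<one>)"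
      "\<forall>k::nat. \<not> copy_between w W (pt \<one>) (pt (f [^] k))" for f
  proof (rule bounded_zero)
    fix k :: nat
    have "\<bar>?q (f [^] k)\<bar> \<le> 1"
      using that no_copy[of "pt (f [^] k)" "pt \<one>"] no_copy[of "pt \<one>" "pt (f [^] k)"]
        jdist_le_dist[OF ctx, of "pt (f [^] k)" "pt \<one>"] jdist_le_dist[OF ctx, of "pt \<one>" "pt (f [^] k)"]
      by (simp add: jq_def[OF ctx] d_sym abs_le_iff)
    then show "\<bar>real k * h f\<bar> \<le> 2 * C + 1"
      using hk[OF f, of k] by linarith
  qed
  moreover have "h f \<noteq> 0"
    if f: "f \<in> carrier G" and nc: "\<forall>k::nat. \<not> copy_between w W (pt (f [^] k)) (pt \<one>)"
      and u: "u \<in> carrier G" "\<eta> > 0" "f = w \<otimes> u"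
      and l: "\<forall>k::nat. real k * (len w + len u - W + \<eta>) \<le> len (f [^] k)" for f u \<eta>
  proof
    assume "h f = 0"
    \<comment> \<open>Each of the \<open>k\<close> factors is passed by one jump along
      \<open>w\<close> and a direct walk along \<open>u\<close>.\<close>
    have up: "?D (pt \<one>) (pt (f [^] k)) \<le> real k * (\<kappa> + len u)" for k :: nat
    proof (induction k)
      case 0
      then show ?case using jdist_le_dist[OF ctx, of "pt \<one>" "pt \<one>"] by simp
    next
      case (Suc k)
      let ?g = "f [^] k"
      have g: "?g \<in> carrier G" using f by simp
      have "?D (pt ?g) (pt (?g \<otimes> w)) \<le> \<kappa>"
        using jdist_le_cost[OF ctx, of "[?g]" "pt ?g" "pt (?g \<otimes> w)"] g by simp
      moreover have "?D (pt (?g \<otimes> w)) (pt (?g \<otimes> w \<otimes> u)) \<le> len u"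
        using jdist_le_dist[OF ctx, of "pt (?g \<otimes> w)" "pt (?g \<otimes> w \<otimes> u)"] d_len[of "?g \<otimes> w" u] g w u by simp
      moreover have "f [^] Suc k = ?g \<otimes> w \<otimes> u"
        using g w u by (simp add: m_assoc)
      ultimately show ?case
        using Suc jdist_triangle[OF ctx, of "pt \<one>" "pt (f [^] Suc k)" "pt ?g"]
          jdist_triangle[OF ctx, of "pt ?g" "pt (f [^] Suc k)" "pt (?g \<otimes> w)"]
        by (simp add: algebra_simps)
    qed
    \<comment> \<open>The backward distance is at least \<open>len (f [^] k) - 1\<close>, so the
      assumed growth makes \<open>jq\<close> decrease linearly in \<open>k\<close>.\<close>
    have "real k * \<eta> \<le> 2 * C + 1" for k :: nat
    proof -
      have "?q (f [^] k) \<le> real k * (\<kappa> + len u) - (len (f [^] k) - 1)"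
        using up[of k] no_copy[of "pt (f [^] k)" "pt \<one>"] nc by (simp add: jq_def[OF ctx] len_def d_sym)
      also have "\<dots> \<le> 1 - real k * \<eta>"
        using l[rule_format, of k] by (simp add: \<kappa>_def algebra_simps)
      finally show ?thesis
        using hk[OF f, of k] \<open>h f = 0\<close> by simp
    qed
    then have "\<eta> = 0"
      using u(2) by (intro bounded_zero[of \<eta> "2 * C + 1"]) (simp add: abs_mult)
    then show False using u by simp
  qed
  ultimately show ?thesis
    using h by blast
qed

section \<open>Lengths of powers and undistorted elements\<close>

lemma d_pow_int:
  assumes "a \<in> carrier G"
  shows "d (pt (a [^] (i::int))) (pt (a [^] (j::int))) = len (a [^] (j - i))"
  using d_len[of "a [^] i" "a [^] (j - i)"] int_pow_mult[of a i "j - i"] assms by simp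

lemma len_nonneg: "0 \<le> len a"
  by (simp add: len_def d_nonneg)

lemma len_inv:
  assumes "a \<in> carrier G" shows "len (inv a) = len a"
  using pt_invariant[OF assms, of \<one> "inv a"] assms by (simp add: len_def d_sym)

lemma len_mult:
  assumes "a \<in> carrier G" "b \<in> carrier G" shows "len (a \<otimes> b) \<le> len a + len b"
  using d_triangle[of "pt \<one>" "pt (a \<otimes> b)" "pt a"] d_len[OF assms] by (simp add: len_def)

lemma len_one [simp]: "len \<one> = 0"
  by (simp add: len_def)

lemma len_nat_pow:
  assumes "a \<in> carrier G" shows "len (a [^] (n::nat)) \<le> real n * len a"
proof (induction n)
  case (Suc n)
  then show ?case using len_mult[of "a [^] n" a] assms by (simp add: algebra_simps)
qed simp

lemma len_int_pow:
  assumes "a \<in> carrier G" shows "len (a [^] (n::int)) \<le> real_of_int \<bar>n\<bar> * len a"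
proof (cases n)
  case (nonneg m)
  then show ?thesis using len_nat_pow[OF assms, of m] by (simp add: int_pow_int)
next
  case (neg m)
  have "len (a [^] n) = len (a [^] Suc m)"
    unfolding neg int_pow_neg_int[OF assms] by (rule len_inv) (use assms in simp)
  also have "\<dots> \<le> real (Suc m) * len a" by (rule len_nat_pow[OF assms])
  finally show ?thesis unfolding neg by (simp add: add.commute)
qed

text \<open>The matching upper bound is automatic.\<close>

definition undistorted :: "'g \<Rightarrow> bool" where
  "undistorted a \<longleftrightarrow> (\<exists>K>0. \<exists>C\<ge>0. \<forall>n::int. real_of_int \<bar>n\<bar> / K - C \<le> len (a [^] n))"

text \<open>Linear growth yields an \<open>N\<close> for which the multiples of \<open>N\<close>
  satisfy the local-to-global principle; every exponent is within \<open>N\<close> of such a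
  multiple.\<close>

lemma undistorted_quasi_geodesic:
  assumes a: "a \<in> carrier G" and "undistorted a"
  shows "\<exists>Q\<ge>0. \<forall>i j k::int. i \<le> j \<longrightarrow> j \<le> k \<longrightarrow> gp (pt (a [^] j)) (pt (a [^] i)) (pt (a [^] k)) \<le> Q"
proof -
  obtain K C where K: "K > 0" "C \<ge> 0" and grow: "\<And>n::int. real_of_int \<bar>n\<bar> / K - C \<le> len (a [^] n)"
    using assms by (auto simp: undistorted_def)
  let ?P = "\<lambda>i::int. pt (a [^] i)"
  \<comment> \<open>Otherwise each doubling of the exponent would add at most a constant to the
    length, which would then grow only logarithmically along powers of two.\<close>
  have "\<exists>N::nat. N \<ge> 1 \<and> len (a [^] (2 * int N)) > len (a [^] (int N)) + 4 * \<delta> + 1"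
  proof (rule ccontr)
    assume *: "\<not> ?thesis"
    have slow: "len (a [^] int (2 ^ j)) \<le> len a + real j * (4 * \<delta> + 1)" for j
    proof (induction j)
      case 0
      then show ?case using a by (simp add: int_pow_int)
    next
      case (Suc j)
      have "len (a [^] (2 * int (2 ^ j))) \<le> len (a [^] int (2 ^ j)) + 4 * \<delta> + 1"
        using * by (meson not_le one_le_power one_le_numeral)
      then show ?case using Suc by (simp add: algebra_simps)
    qed
    have lin: "real (2 ^ j) \<le> K * (C + len a) + real j * (K * (4 * \<delta> + 1))" for j
    proof -
      have "real (2 ^ j) / K - C \<le> len a + real j * (4 * \<delta> + 1)"
        using grow[of "int (2 ^ j)"] slow[of j] by simp
      then have "real (2 ^ j) / K * K \<le> (C + len a + real j * (4 * \<delta> + 1)) * K"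
        using K by (intro mult_right_mono) auto
      then show ?thesis using K by (simp add: algebra_simps)
    qed
    define A where "A = K * (C + len a)"
    define S where "S = K * (4 * \<delta> + 1)"
    have "S > 0" "A \<ge> 0" using K delta_nonneg len_nonneg by (auto simp: S_def A_def)
    \<comment> \<open>At \<open>j = 2 * m\<close> the left-hand side of \<open>lin\<close> is at
      least the square of \<open>m\<close> and beats the linear right-hand side.\<close>
    obtain m :: nat where m: "real m > A + 2 * S + 2" using reals_Archimedean2 by blast
    have "real m ^ 2 \<le> real (2 ^ (2 * m))"
    proof -
      have "real m \<le> 2 ^ m" using of_nat_less_two_power[of m] by (simp add: less_imp_le)
      then have "real m ^ 2 \<le> (2 ^ m) ^ 2" by (intro power_mono) auto
      then show ?thesis by (simp add: power_mult[symmetric] mult.commute)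
    qed
    also have "\<dots> \<le> A + real (2 * m) * S"
      using lin[of "2 * m"] by (simp add: A_def S_def)
    finally have "real m * real m \<le> A + 2 * S * real m" by (simp add: power2_eq_square mult_ac)
    moreover have "A \<le> A * real m" using \<open>A \<ge> 0\<close> \<open>S > 0\<close> m mult_left_mono[of 1 "real m" A] by simp
    moreover have "(A + 2 * S + 2) * real m \<le> real m * real m"
      using m by (intro mult_right_mono) auto
    ultimately have "real m \<le> 0" by (simp add: algebra_simps)
    then show False using m \<open>S > 0\<close> \<open>A \<ge> 0\<close> by simp
  qed
  then obtain N :: nat where N: "N \<ge> 1" "len (a [^] (2 * int N)) > len (a [^] (int N)) + 4 * \<delta> + 1"
    by blast
  \<comment> \<open>The product at the middle of three consecutive multiples of \<open>N\<close>;
    the choice of \<open>N\<close> makes \<open>len (a [^] int N)\<close> exceed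
    \<open>2 * B + 4 * \<delta>\<close>.\<close>
  define B where "B = len (a [^] int N) - len (a [^] (2 * int N)) / 2"
  have B0: "0 \<le> B"
    using len_mult[of "a [^] int N" "a [^] int N"] a int_pow_mult[of a "int N" "int N"] by (simp add: B_def)
  have mult: "gp (?P (int N * j)) (?P (int N * i)) (?P (int N * k)) \<le> B + 2 * \<delta>" if "i < j" "j < k" for i j k :: int
  proof -
    define X where "X = (\<lambda>m::nat. ?P (int N * (i + int m)))"
    have "gp (X (nat (j - i))) (X 0) (X (nat (k - i))) \<le> B + 2 * \<delta>"
    proof (rule local_to_global[where n = "nat (k - i)"])
      show "gp (X (m + 1)) (X m) (X (m + 2)) \<le> B" for m
      proof -
        have e: "int N * (i + int (m + 1)) - int N * (i + int m) = int N"
          "int N * (i + int (m + 2)) - int N * (i + int m) = 2 * int N"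
          "int N * (i + int (m + 2)) - int N * (i + int (m + 1)) = int N"
          by (auto simp: algebra_simps)
        have "d (X m) (X (m+1)) = len (a [^] int N)" "d (X m) (X (m+2)) = len (a [^] (2 * int N))"
            "d (X (m+1)) (X (m+2)) = len (a [^] int N)"
          unfolding X_def d_pow_int[OF a] e by simp_all
        then show ?thesis by (simp add: gromov_product_def B_def d_sym)
      qed
      show "2 * B + 4 * \<delta> < d (X m) (X (m + 1))" for m
      proof -
        have e: "int N * (i + int (m + 1)) - int N * (i + int m) = int N"
          by (auto simp: algebra_simps)
        show ?thesis unfolding X_def d_pow_int[OF a] e using N by (simp add: B_def)
      qed
    qed (use that in auto)
    then show ?thesis using that by (simp add: X_def)
  qed
  define s where "s = real N * len a"
  have s0: "0 \<le> s" by (simp add: s_def len_nonneg)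
  have close: "d (?P i) (?P (int N * (i div int N))) \<le> s" for i
  proof -
    have "d (?P i) (?P (int N * (i div int N))) = len (a [^] (- (i mod int N)))"
      unfolding d_pow_int[OF a] by (simp add: minus_mod_eq_mult_div[symmetric])
    also have "\<dots> \<le> real_of_int \<bar>i mod int N\<bar> * len a"
      using len_int_pow[OF a, of "- (i mod int N)"] by simp
    also have "\<dots> \<le> real N * len a"
    proof (rule mult_right_mono)
      have "\<bar>i mod int N\<bar> \<le> int N" using N pos_mod_bound[of "int N" i] pos_mod_sign[of "int N" i] by linarith
      then show "real_of_int \<bar>i mod int N\<bar> \<le> real N" by linarith
    qed (rule len_nonneg)
    finally show ?thesis by (simp add: s_def)
  qed
  have "gp (?P j) (?P i) (?P k) \<le> B + 2 * \<delta> + 3 * s" if "i \<le> j" "j \<le> k" for i j k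
  proof -
    let ?f = "\<lambda>i. i div int N"
    have mono: "?f i \<le> ?f j" "?f j \<le> ?f k" using that N by (auto intro: zdiv_mono1)
    \<comment> \<open>For neighbouring indices with the same quotient by \<open>N\<close>, the two
      points are within \<open>2 * s\<close> of each other, which bounds the product.\<close>
    have *: "gp p x y \<le> 2 * s" if "d x y' \<le> s" "d p y' \<le> s" for p x y y'
    proof -
      have "gp p x y \<le> d x p" by (rule gp_le_dist)
      then show ?thesis using d_triangle[of x p y'] that d_sym[of p y'] by simp
    qed
    show ?thesis
    proof (cases "?f i < ?f j \<and> ?f j < ?f k")
      case True
      then have "gp (?P (int N * ?f j)) (?P (int N * ?f i)) (?P (int N * ?f k)) \<le> B + 2 * \<delta>"
        using mult by blast
      then show ?thesis
        using gp_perturb0[of "?P j" "?P i" "?P k" "?P (int N * ?f j)"]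
          gp_perturb1[of "?P (int N * ?f j)" "?P i" "?P k" "?P (int N * ?f i)"]
          gp_perturb2[of "?P (int N * ?f j)" "?P (int N * ?f i)" "?P k" "?P (int N * ?f k)"]
          close[of i] close[of j] close[of k] d_sym by (smt (verit, best))
    next
      case False
      then consider "?f i = ?f j" | "?f k = ?f j" using mono by linarith
      then show ?thesis
      proof cases
        case 1
        then show ?thesis using *[OF close[of i], of "?P j" "?P k"] close[of j] B0 s0 delta_nonneg by simp
      next
        case 2
        then show ?thesis using *[OF close[of k], of "?P j" "?P i"] close[of j] B0 s0 delta_nonneg
          by (simp add: gp_sym)
      qed
    qed
  qed
  then show ?thesis
    using B0 s0 delta_nonneg by (intro exI[of _ "B + 2 * \<delta> + 3 * s"]) auto
qed

end

section \<open>The axis of a loxodromic element\<close>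

context group begin

lemma pow_commutation_nat:
  assumes "e \<in> carrier G" "x \<in> carrier G" "y \<in> carrier G" "e \<otimes> x = y \<otimes> e"
  shows "e \<otimes> x [^] (k::nat) = y [^] k \<otimes> e"
proof (induction k)
  case (Suc k)
  have "e \<otimes> x [^] Suc k = (e \<otimes> x [^] k) \<otimes> x" using assms by (simp add: m_assoc)
  also have "\<dots> = y [^] k \<otimes> (e \<otimes> x)" using Suc assms by (simp add: m_assoc)
  also have "\<dots> = y [^] Suc k \<otimes> e" using assms by (simp add: m_assoc)
  finally show ?case .
qed (use assms in simp)

lemma inv_commutation:
  assumes "e \<in> carrier G" "x \<in> carrier G" "y \<in> carrier G" "e \<otimes> x = y \<otimes> e"
  shows "e \<otimes> inv x = inv y \<otimes> e"
proof -
  have "y \<otimes> (e \<otimes> inv x) = e \<otimes> x \<otimes> inv x"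
    using assms by (simp add: m_assoc[symmetric])
  then have "y \<otimes> (e \<otimes> inv x) = e"
    using assms(1,2) by (simp add: m_assoc)
  then show ?thesis
    using inv_solve_left[of "e \<otimes> inv x" y e] assms by simp
qed

lemma pow_commutation:
  assumes "e \<in> carrier G" "x \<in> carrier G" "y \<in> carrier G" "e \<otimes> x = y \<otimes> e"
  shows "e \<otimes> x [^] (k::int) = y [^] k \<otimes> e"
proof (cases k)
  case (nonneg n)
  then show ?thesis using pow_commutation_nat[OF assms] by (simp add: int_pow_int)
next
  case (neg n)
  then show ?thesis
    using inv_commutation[OF assms(1) _ _ pow_commutation_nat[OF assms, of "Suc n"]] assms
    unfolding neg int_pow_neg_int[OF assms(2)] int_pow_neg_int[OF assms(3)] by simp
qed

end

text \<open>\<open>quasi_geodesic\<close> and \<open>growth\<close> describe the orbit of the cyclic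
  group of \<open>a\<close>; \<open>wpd\<close> is the WPD condition at the base point in terms of
  \<open>pt\<close>.\<close>

locale axis = hyp_group d \<delta> G pt tripod
  for d :: "'v \<Rightarrow> 'v \<Rightarrow> real" and \<delta> and G :: "('g, 'b) monoid_scheme" (structure) and pt tripod +
  fixes a :: 'g and Q K C :: real
  assumes a: "a \<in> carrier G"
    and Q_nonneg: "0 \<le> Q"
    and quasi_geodesic: "\<And>i j k::int. i \<le> j \<Longrightarrow> j \<le> k \<Longrightarrow>
      gromov_product d (pt (a [^] j)) (pt (a [^] i)) (pt (a [^] k)) \<le> Q"
    and KC: "0 < K" "0 \<le> C"
    and growth: "\<And>n::int. real_of_int \<bar>n\<bar> / K - C \<le> d (pt \<one>) (pt (a [^] n))"
    and wpd: "\<And>R. 0 \<le> R \<Longrightarrow> \<exists>n::nat. finite {g \<in> carrier G. d (pt \<one>) (pt g) \<le> R \<and>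
                  d (pt (a [^] n)) (pt (g \<otimes> a [^] n)) \<le> R}"
begin

abbreviation P :: "int \<Rightarrow> 'v" where "P i \<equiv> pt (a [^] i)"
abbreviation L :: "int \<Rightarrow> real" where "L i \<equiv> len (a [^] i)"

lemma apow [simp]: "a [^] (i::int) \<in> carrier G" "a [^] (n::nat) \<in> carrier G"
  using a by auto

lemma d_P: "d (P i) (P j) = L (j - i)"
  by (rule d_pow_int[OF a])

lemma L_minus: "L (- i) = L i"
  using len_inv[of "a [^] i"] int_pow_neg[OF a, of i] by simp

lemma L_le: "L i \<le> real_of_int \<bar>i\<bar> * len a"
  by (rule len_int_pow[OF a])

lemma L_growth: "real_of_int \<bar>i\<bar> / K - C \<le> L i"
  using growth by (simp add: len_def)

lemma quasi_geodesic':
  assumes "j \<in> {min i k..max i k}"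
  shows "gp (P j) (P i) (P k) \<le> Q"
  using quasi_geodesic[of i j k] quasi_geodesic[of k j i] assms gp_sym
  by (cases "i \<le> k") auto

lemma L_superadditive: "0 \<le> m \<Longrightarrow> 0 \<le> n \<Longrightarrow> L m + L n - 2 * Q \<le> L (m + n)"
  using quasi_geodesic[of 0 m "m + n"] d_P[of 0 m] d_P[of m "m+n"] d_P[of 0 "m+n"]
  by (simp add: gromov_product_def d_sym field_simps)

lemma L_unbounded: "\<exists>N::nat. \<forall>n::int. int N \<le> \<bar>n\<bar> \<longrightarrow> R \<le> L n"
proof -
  obtain N :: nat where N: "K * (R + C) \<le> real N" using real_arch_simple by blast
  have "R \<le> L n" if "int N \<le> \<bar>n\<bar>" for n
  proof -
    have "real N \<le> real_of_int \<bar>n\<bar>" using that by linarith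
    then have "K * (R + C) \<le> real_of_int \<bar>n\<bar>" using N by linarith
    then have "R + C \<le> real_of_int \<bar>n\<bar> / K" using KC by (simp add: field_simps)
    then show ?thesis using L_growth[of n] by linarith
  qed
  then show ?thesis by blast
qed

lemma near_axis:
  assumes "Q \<le> B" "i \<le> k" "gp c (P i) (P k) \<le> B"
  shows "\<exists>j\<in>{i..k}. d c (P j) \<le> 2 * B + 2 * \<delta> + len a"
proof -
  define X where "X = (\<lambda>m::nat. P (i + int m))"
  have "\<exists>m\<le>nat (k - i). d c (X m) \<le> 2 * B + 2 * \<delta> + len a"
  proof (rule chain_near)
    show "gp (X m) (X 0) (X (nat (k - i))) \<le> B" if "m \<le> nat (k - i)" for m
    proof -
      have "i + int m \<le> k" using that assms by linarith
      then show ?thesis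
        using quasi_geodesic[of i "i + int m" k] assms by (simp add: X_def)
    qed
    show "d (X m) (X (Suc m)) \<le> len a" for m
      using a by (simp add: X_def d_P)
  qed (use assms len_nonneg in \<open>auto simp: X_def\<close>)
  then obtain m where "m \<le> nat (k - i)" "d c (P (i + int m)) \<le> 2 * B + 2 * \<delta> + len a"
    by (auto simp: X_def)
  then show ?thesis using assms by (intro bexI[of _ "i + int m"]) auto
qed

text \<open>\<open>last_below\<close> along the powers of \<open>a\<close> in the direction of
  \<open>m\<close>; one step changes the length by at most \<open>len a\<close>.\<close>

lemma first_above:
  assumes "t < L m" "0 \<le> t"
  shows "\<exists>i\<in>{min 0 m..max 0 m}. t \<le> L i \<and> L i \<le> t + len a"
proof -
  define \<sigma> where "\<sigma> = sgn m"
  have m: "m = \<sigma> * int (nat \<bar>m\<bar>)" by (simp add: \<sigma>_def sgn_if)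
  obtain k where k: "k < nat \<bar>m\<bar>" "L (\<sigma> * int k) \<le> t" "t < L (\<sigma> * int (Suc k))"
    using last_below[of "\<lambda>k. L (\<sigma> * int k)" t "nat \<bar>m\<bar>"] assms m by auto
  have "L (\<sigma> * int (Suc k)) \<le> L (\<sigma> * int k) + L \<sigma>"
    using len_mult[of "a [^] (\<sigma> * int k)" "a [^] \<sigma>"] int_pow_mult[OF a, of "\<sigma> * int k" \<sigma>]
    by (simp add: algebra_simps)
  moreover have "L \<sigma> \<le> len a"
    using L_le[of \<sigma>] len_nonneg[of a] by (simp add: \<sigma>_def sgn_if split: if_splits)
  moreover have "\<sigma> * int (Suc k) \<in> {min 0 m..max 0 m}"
    using k(1) by (auto simp: \<sigma>_def sgn_if)
  ultimately show ?thesis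
    using k by (intro bexI[of _ "\<sigma> * int (Suc k)"]) auto
qed

text \<open>Written without inverses, so that it can be used as a commutation rule. The sign
  \<open>\<sigma>\<close> tells whether \<open>e\<close> preserves or reverses the direction of the
  axis.\<close>

definition intertwines :: "'g \<Rightarrow> int \<Rightarrow> bool" where
  "intertwines e \<sigma> \<longleftrightarrow> (\<exists>p>0. e \<otimes> a [^] p = a [^] (\<sigma> * p) \<otimes> e)"

text \<open>A long overlap produces many elements \<open>u s\<close> moving two far apart points by a bounded amount; two of them coincide by WPD.\<close>

lemma overlap:
  "\<exists>N::nat. \<forall>e\<in>carrier G. \<forall>n i j::int. int N \<le> n \<longrightarrow> d (pt e) (P i) \<le> B \<longrightarrow>
      d (pt (e \<otimes> a [^] n)) (P j) \<le> B \<longrightarrow> intertwines e (if i \<le> j then 1 else - 1)"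
proof -
  \<comment> \<open>The bound of \<open>fellow_travel\<close> for products up to
    \<open>Q + 2 * \<bar>B\<bar>\<close>, plus the displacement of the initial points.\<close>
  define R where "R = \<bar>B\<bar> + 2 * (Q + 2 * \<bar>B\<bar>) + 2 * \<delta>"
  have "0 \<le> 2 * R" using Q_nonneg delta_nonneg by (simp add: R_def)
  then obtain m :: nat where fin: "finite {g \<in> carrier G. d (pt \<one>) (pt g) \<le> 2 * R \<and>
                  d (pt (a [^] m)) (pt (g \<otimes> a [^] m)) \<le> 2 * R}" (is "finite ?F")
    using wpd by blast
  \<comment> \<open>Room for \<open>card ?F + 1\<close> values of \<open>s\<close>, each followed by
    \<open>m\<close> further steps.\<close>
  define M where "M = card ?F + m"
  obtain N0 :: nat where N0: "\<And>n::int. int N0 \<le> \<bar>n\<bar> \<Longrightarrow> real M * len a + 2 * \<bar>B\<bar> + 1 \<le> L n"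
    using L_unbounded by blast
  define N where "N = max M N0"
  have "intertwines e (if i \<le> j then 1 else - 1)"
    if e: "e \<in> carrier G" and n: "int N \<le> n" and ei: "d (pt e) (P i) \<le> B" and ej: "d (pt (e \<otimes> a [^] n)) (P j) \<le> B"
    for e n i j
  proof -
    define \<sigma> :: int where "\<sigma> = (if i \<le> j then 1 else - 1)"
    have B: "0 \<le> B" using ei d_nonneg order_trans by blast
    have nM: "int M \<le> n" "int N0 \<le> n" using n by (auto simp: N_def)
    have Ln: "d (pt e) (pt (e \<otimes> a [^] n)) = L n" using d_len[OF e] by simp
    \<comment> \<open>If \<open>i\<close> and \<open>j\<close> were closer, the far ends of the
      overlap would be too close for the length of \<open>a [^] n\<close>.\<close>
    have "int M \<le> \<bar>j - i\<bar>"
    proof (rule ccontr)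
      assume "\<not> ?thesis"
      then have "real_of_int \<bar>j - i\<bar> \<le> real M" by linarith
      then have "real_of_int \<bar>j - i\<bar> * len a \<le> real M * len a"
        by (intro mult_right_mono len_nonneg)
      then have "d (P i) (P j) \<le> real M * len a"
        using d_P[of i j] L_le[of "j - i"] by linarith
      then have "L n \<le> real M * len a + 2 * B"
        using Ln d_triangle[of "pt e" "pt (e \<otimes> a [^] n)" "P i"] d_triangle[of "P i" "pt (e \<otimes> a [^] n)" "P j"]
          ei ej d_sym[of "P j" "pt (e \<otimes> a [^] n)"] by linarith
      then show False using N0[of n] nM B by simp
    qed
    have near: "d (P (i + \<sigma> * s)) (pt (e \<otimes> a [^] s)) \<le> R" if "0 \<le> s" "s \<le> int M" for s
    proof -
      let ?x = "pt e" and ?y = "pt (e \<otimes> a [^] n)" and ?p = "pt (e \<otimes> a [^] s)" and ?q = "P (i + \<sigma> * s)"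
      have "gp ?p ?x ?y \<le> Q"
        using gp_invariant[of e "a [^] s" "a [^] (0::int)" "a [^] n"] quasi_geodesic[of 0 s n] e that nM
        by simp
      moreover have "gp ?q (P i) (P j) \<le> Q"
        using that \<open>int M \<le> \<bar>j - i\<bar>\<close> by (intro quasi_geodesic') (auto simp: \<sigma>_def)
      then have "gp ?q ?x ?y \<le> Q + 2 * B"
        using gp_perturb1[of ?q ?x "P j" "P i"] gp_perturb2[of ?q ?x ?y "P j"] ei ej d_sym
        by (smt (verit))
      moreover have "d ?x ?p = L s" using d_len[OF e] by simp
      moreover have "d (P i) ?q = L s"
        by (simp add: d_P \<sigma>_def L_minus)
      ultimately have "d ?q ?p \<le> \<bar>d ?x ?q - d (P i) ?q\<bar> + 2 * (Q + 2 * B) + 2 * \<delta>"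
        using fellow_travel[of ?q ?x ?y "Q + 2 * B" ?p] B by simp
      moreover have "\<bar>d ?x ?q - d (P i) ?q\<bar> \<le> B"
        using d_triangle[of ?x ?q "P i"] d_triangle[of "P i" ?q ?x] ei d_sym[of ?x "P i"] by linarith
      ultimately show ?thesis using B by (simp add: R_def)
    qed
    define u where "u = (\<lambda>s::nat. inv (a [^] (i + \<sigma> * int s)) \<otimes> (e \<otimes> a [^] int s))"
    have uc: "u s \<in> carrier G" for s using e by (simp add: u_def)
    have u1: "d (pt \<one>) (pt (u s)) \<le> R" if "s \<le> card ?F" for s
      using near[of "int s"] that e
        pt_invariant[of "inv (a [^] (i + \<sigma> * int s))" "a [^] (i + \<sigma> * int s)" "e \<otimes> a [^] int s"]
      by (simp add: u_def M_def)
    have u2: "d (P (\<sigma> * int m)) (pt (u s \<otimes> a [^] int m)) \<le> R" if "s \<le> card ?F" for s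
    proof -
      let ?h = "a [^] (i + \<sigma> * int s)"
      have 1: "u s \<otimes> a [^] int m = inv ?h \<otimes> (e \<otimes> a [^] (int s + int m))"
        using e by (simp add: u_def m_assoc int_pow_mult[OF a])
      have "?h \<otimes> a [^] (\<sigma> * int m) = a [^] (i + \<sigma> * (int s + int m))"
        by (simp add: int_pow_mult[OF a, symmetric] algebra_simps)
      then have 2: "inv ?h \<otimes> a [^] (i + \<sigma> * (int s + int m)) = a [^] (\<sigma> * int m)"
        by (metis apow(1) inv_solve_left m_closed)
      show ?thesis
        using near[of "(int s + int m)"] that e
          pt_invariant[of "inv ?h" "a [^] (i + \<sigma> * (int s + int m))" "e \<otimes> a [^] (int s + int m)"]
        by (simp add: 1 2 M_def)
    qed
    \<comment> \<open>Normalised by \<open>u 0\<close>, the elements move the base point and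
      \<open>pt (a [^] m)\<close> by at most \<open>2 * R\<close> and fall into the finite
      set.\<close>
    define v where "v = (\<lambda>s. inv (u 0) \<otimes> u s)"
    have "v s \<in> ?F" if "s \<le> card ?F" for s
    proof -
      have "d (pt (u 0)) (pt (u s)) \<le> 2 * R"
        using d_triangle[of "pt (u 0)" "pt (u s)" "pt \<one>"] u1[of 0] u1[of s] that by (simp add: d_sym)
      moreover have "d (pt (u 0)) (pt (u s)) = d (pt \<one>) (pt (v s))"
        using pt_invariant[of "inv (u 0)" "u 0" "u s"] uc by (simp add: v_def)
      moreover have "d (pt (u 0 \<otimes> a [^] int m)) (pt (u s \<otimes> a [^] int m)) \<le> 2 * R"
        using d_triangle[of "pt (u 0 \<otimes> a [^] int m)" "pt (u s \<otimes> a [^] int m)" "P (\<sigma> * int m)"]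
          u2[of 0] u2[of s] that by (simp add: d_sym)
      moreover have "inv (u 0) \<otimes> (u 0 \<otimes> a [^] int m) = a [^] m"
        using uc[of 0] by (simp add: m_assoc[symmetric] int_pow_int)
      then have "d (pt (u 0 \<otimes> a [^] int m)) (pt (u s \<otimes> a [^] int m)) = d (pt (a [^] m)) (pt (v s \<otimes> a [^] m))"
        using pt_invariant[of "inv (u 0)" "u 0 \<otimes> a [^] int m" "u s \<otimes> a [^] int m"] uc
        by (simp add: v_def m_assoc int_pow_int)
      ultimately show ?thesis using uc by (simp add: v_def)
    qed
    then have "v ` {..card ?F} \<subseteq> ?F" by auto
    then have "card (v ` {..card ?F}) \<le> card ?F" using fin by (rule card_mono[rotated])
    then have "\<not> inj_on v {..card ?F}" using card_image[of v "{..card ?F}"] by fastforce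
    then obtain s t where st: "s < t" "v s = v t"
      unfolding inj_on_def by (metis linorder_neqE_nat)
    then have us: "u s = u t" using uc by (simp add: v_def)
    let ?x = "a [^] (i + \<sigma> * int s)" and ?y = "a [^] (i + \<sigma> * int t)"
    \<comment> \<open>Multiplying \<open>u s = u t\<close> on the left by \<open>?y\<close> and on
      the right by \<open>inv (a [^] int s)\<close> turns it into the required relation with
      exponent \<open>t - s\<close>.\<close>
    have "?y \<otimes> u s \<otimes> inv (a [^] int s) = ?y \<otimes> inv ?x \<otimes> e"
      using e by (simp add: u_def m_assoc)
    moreover have "?y \<otimes> inv ?x = a [^] (\<sigma> * (int t - int s))"
    proof -
      have "a [^] (\<sigma> * (int t - int s)) \<otimes> ?x = ?y"
        by (simp add: int_pow_mult[OF a, symmetric] algebra_simps)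
      then show ?thesis by (metis apow(1) inv_solve_right)
    qed
    moreover have "?y \<otimes> u t \<otimes> inv (a [^] int s) = e \<otimes> a [^] (int t - int s)"
    proof -
      have "a [^] (int t - int s) \<otimes> a [^] int s = a [^] int t"
        by (simp add: int_pow_mult[OF a, symmetric])
      then have *: "a [^] int t \<otimes> inv (a [^] int s) = a [^] (int t - int s)"
        by (metis apow(1) inv_solve_right)
      have "?y \<otimes> u t = e \<otimes> a [^] int t"
        using e by (simp add: u_def m_assoc[symmetric])
      then show ?thesis using e by (simp add: m_assoc *)
    qed
    ultimately have "e \<otimes> a [^] (int t - int s) = a [^] (\<sigma> * (int t - int s)) \<otimes> e"
      using us by simp
    then show ?thesis
      using st(1) unfolding intertwines_def \<sigma>_def[symmetric] by (intro exI[of _ "int t - int s"]) auto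
  qed
  then show ?thesis by blast
qed

end

section \<open>Elements preserving the axis\<close>

context axis begin

text \<open>Both relations are raised to powers with the common exponent
  \<open>p * q\<close>.\<close>

lemma intertwines_mult:
  assumes e: "e \<in> carrier G" "intertwines e \<sigma>" and e': "e' \<in> carrier G" "intertwines e' \<tau>"
  shows "intertwines (e \<otimes> e') (\<sigma> * \<tau>)"
proof -
  obtain p q :: int where p: "p > 0" "e \<otimes> a [^] p = a [^] (\<sigma> * p) \<otimes> e"
    and q: "q > 0" "e' \<otimes> a [^] q = a [^] (\<tau> * q) \<otimes> e'"
    using assms by (auto simp: intertwines_def)
  have "e \<otimes> e' \<otimes> a [^] (p * q) = e \<otimes> (e' \<otimes> (a [^] q) [^] p)"
    using e e' a by (simp add: m_assoc int_pow_pow mult.commute)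
  also have "e' \<otimes> (a [^] q) [^] p = (a [^] (\<tau> * q)) [^] p \<otimes> e'"
    using pow_commutation[OF e'(1) _ _ q(2)] by simp
  also have "(a [^] (\<tau> * q)) [^] p = (a [^] p) [^] (\<tau> * q)"
    using a by (simp add: int_pow_pow mult.commute)
  also have "e \<otimes> ((a [^] p) [^] (\<tau> * q) \<otimes> e') = (e \<otimes> (a [^] p) [^] (\<tau> * q)) \<otimes> e'"
    using e e' a by (simp add: m_assoc)
  also have "e \<otimes> (a [^] p) [^] (\<tau> * q) = (a [^] (\<sigma> * p)) [^] (\<tau> * q) \<otimes> e"
    using pow_commutation[OF e(1) _ _ p(2)] by simp
  also have "(a [^] (\<sigma> * p)) [^] (\<tau> * q) = a [^] (\<sigma> * \<tau> * (p * q))"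
    using a by (simp add: int_pow_pow algebra_simps)
  finally show ?thesis
    using p q e e' unfolding intertwines_def by (intro exI[of _ "p * q"]) (simp add: m_assoc)
qed

lemma intertwines_inv:
  assumes e: "e \<in> carrier G" "intertwines e \<sigma>" and \<sigma>: "\<sigma> * \<sigma> = 1"
  shows "intertwines (inv e) \<sigma>"
proof -
  obtain p :: int where p: "p > 0" "e \<otimes> a [^] p = a [^] (\<sigma> * p) \<otimes> e"
    using assms by (auto simp: intertwines_def)
  have "a [^] p = inv e \<otimes> (a [^] (\<sigma> * p) \<otimes> e)"
    using inv_solve_left[of "a [^] p" e] p(2) e by simp
  then have "inv e \<otimes> a [^] (\<sigma> * p) = a [^] p \<otimes> inv e"
    using e by (simp add: m_assoc)
  then have "inv e \<otimes> (a [^] (\<sigma> * p)) [^] \<sigma> = (a [^] p) [^] \<sigma> \<otimes> inv e"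
    using e by (intro pow_commutation) auto
  moreover have "\<sigma> * p * \<sigma> = p" using \<sigma> by (simp add: mult.assoc mult.commute[of p])
  ultimately show ?thesis
    using p(1) a unfolding intertwines_def
    by (intro exI[of _ p]) (simp only: int_pow_pow mult.commute[of p \<sigma>] simp_thms)
qed

lemma intertwines_pow: "intertwines (a [^] (i::int)) 1"
  unfolding intertwines_def by (intro exI[of _ 1]) (simp add: int_pow_mult[OF a, symmetric] add.commute)

text \<open>The largest elementary subgroup containing \<open>a\<close>, usually written
  E(a).\<close>

definition elementary :: "'g set" where
  "elementary = {e \<in> carrier G. intertwines e 1 \<or> intertwines e (- 1)}"

lemma elementary_mult: "e \<in> elementary \<Longrightarrow> e' \<in> elementary \<Longrightarrow> e \<otimes> e' \<in> elementary"
  using intertwines_mult[of e _ e'] by (fastforce simp: elementary_def)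

lemma elementary_inv: "e \<in> elementary \<Longrightarrow> inv e \<in> elementary"
  using intertwines_inv[of e] by (auto simp: elementary_def)

lemma elementary_pow: "a [^] (i::int) \<in> elementary"
  using intertwines_pow by (simp add: elementary_def)

lemma overlap_elementary:
  "\<exists>N::nat. \<forall>e\<in>carrier G. \<forall>n i j::int. int N \<le> n \<longrightarrow> d (pt e) (P i) \<le> B \<longrightarrow>
      d (pt (e \<otimes> a [^] n)) (P j) \<le> B \<longrightarrow> e \<in> elementary"
proof -
  have "e \<in> elementary" if "e \<in> carrier G" "intertwines e (if P then 1 else - 1)" for e P
    using that by (auto simp: elementary_def split: if_splits)
  then show ?thesis using overlap[of B] by blast
qed

text \<open>If the product were large, a point of the axis and one of its translate, both at height
  about \<open>t\<close>, would be within \<open>B\<close> of each other; as \<open>pt b\<close> is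
  near \<open>P 0\<close>, this overlap is long enough for
  \<open>overlap_elementary\<close>.\<close>

lemma transversal:
  assumes b: "b \<in> carrier G" "b \<notin> elementary"
  shows "\<exists>T\<ge>0. \<forall>m n::int. gp (pt \<one>) (P m) (pt (b \<otimes> a [^] n)) \<le> T"
proof -
  define B where "B = 2 * len a + 2 * Q + 5 * len b + 4 * \<delta>"
  obtain N :: nat where N: "\<And>e n i j. e \<in> carrier G \<Longrightarrow> int N \<le> n \<Longrightarrow> d (pt e) (P i) \<le> B \<Longrightarrow>
      d (pt (e \<otimes> a [^] n)) (P j) \<le> B \<Longrightarrow> e \<in> elementary"
    using overlap_elementary[of B] by blast
  \<comment> \<open>Powers of length at least \<open>t\<close> have exponents of absolute value at
    least \<open>N\<close>, by \<open>L_le\<close>.\<close>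
  define t where "t = 2 * len b + real N * len a + 1"
  have nn: "0 \<le> len a" "0 \<le> len b" "0 \<le> Q" "0 \<le> \<delta>" "0 \<le> B"
    using len_nonneg Q_nonneg delta_nonneg by (auto simp: B_def)
  have t: "0 \<le> t" "len b \<le> t" using nn by (auto simp: t_def)
  have db: "d (pt b) (P 0) = len b"
    by (simp add: len_def d_sym)
  have bpow: "len (b \<otimes> a [^] i) \<le> len b + L i" "L i - len b \<le> len (b \<otimes> a [^] i)" for i :: int
  proof -
    show "len (b \<otimes> a [^] i) \<le> len b + L i" by (rule len_mult) (use b in auto)
    have "d (pt b) (pt (b \<otimes> a [^] i)) = L i" using d_len b by simp
    then show "L i - len b \<le> len (b \<otimes> a [^] i)"
      using d_triangle[of "pt b" "pt (b \<otimes> a [^] i)" "pt \<one>"] by (simp add: len_def d_sym)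
  qed
  have "gp (pt \<one>) (P m) (pt (b \<otimes> a [^] n)) \<le> t + len b" for m n :: int
  proof (rule ccontr)
    let ?y = "pt (b \<otimes> a [^] n)"
    assume "\<not> ?thesis"
    then have big: "t + len b < gp (pt \<one>) (P m) ?y" by simp
    then have "t < L m" "t + len b < len (b \<otimes> a [^] n)"
      using gp_le_dist[of "pt \<one>" "P m" ?y] gp_le_dist[of "pt \<one>" ?y "P m"] gp_sym[of "pt \<one>" ?y] nn
      by (auto simp: len_def d_sym)
    then obtain i where i: "i \<in> {min 0 m..max 0 m}" "t \<le> L i" "L i \<le> t + len a"
      using first_above t by blast
    have "t < L n" using bpow(1)[of n] \<open>t + len b < len (b \<otimes> a [^] n)\<close> by linarith
    then obtain j where j: "j \<in> {min 0 n..max 0 n}" "t \<le> L j" "L j \<le> t + len a"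
      using first_above t by blast
    let ?q = "pt (b \<otimes> a [^] j)"
    have "gp (P i) (P 0) (P m) \<le> Q" "gp (P j) (P 0) (P n) \<le> Q"
      by (rule quasi_geodesic'[OF i(1)], rule quasi_geodesic'[OF j(1)])
    moreover have "gp ?q (pt b) ?y = gp (P j) (P 0) (P n)"
      using gp_invariant[of b "a [^] j" "a [^] (0::int)" "a [^] n"] b by simp
    ultimately have g1: "gp (P i) (pt \<one>) (P m) \<le> Q" and g2: "gp ?q (pt \<one>) ?y \<le> Q + len b"
      using gp_perturb1[of ?q "pt \<one>" ?y "pt b"] db by auto
    have h1: "gp (pt \<one>) (P i) (P m) \<ge> t - Q"
      using gp_switch[of "pt \<one>" "P i" "P m"] g1 i by (simp add: len_def)
    have h2: "gp (pt \<one>) ?q ?y \<ge> t - Q - 2 * len b"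
      using gp_switch[of "pt \<one>" ?q ?y] g2 j bpow(2)[of j] by (simp add: len_def)
    have h3: "gp (pt \<one>) (P i) ?y \<ge> t - Q - \<delta>"
      using hyperbolic[of "pt \<one>" "P i" "P m" ?y] h1 big nn by (simp add: min_def split: if_splits)
    have h4: "gp (pt \<one>) (P i) ?q \<ge> t - Q - 2 * len b - 2 * \<delta>"
      using hyperbolic[of "pt \<one>" "P i" ?y ?q] h2 h3 nn gp_sym[of "pt \<one>" ?y ?q]
      by (simp add: min_def split: if_splits)
    have "d (P i) ?q = L i + len (b \<otimes> a [^] j) - 2 * gp (pt \<one>) (P i) ?q"
      by (simp add: gromov_product_def len_def d_sym field_simps)
    then have close: "d (P i) ?q \<le> 2 * len a + 2 * Q + 5 * len b + 4 * \<delta>"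
      using h4 i j bpow(1)[of j] by linarith
    have close': "d ?q (P i) \<le> B" "d (pt b) (P 0) \<le> B"
      using close db nn by (auto simp: B_def d_sym)
    have "real N * len a < real_of_int \<bar>j\<bar> * len a"
      using L_le[of j] j nn by (simp add: t_def)
    then have "int N \<le> \<bar>j\<bar>" using nn by (auto dest: mult_right_less_imp_less)
    then consider "int N \<le> j" | "int N \<le> - j" by linarith
    then have "b \<in> elementary"
    proof cases
      case 1
      then show ?thesis using N[OF b(1) 1 close'(2,1)] by simp
    next
      \<comment> \<open>For negative \<open>j\<close> the overlap is traversed from
        \<open>b \<otimes> a [^] j\<close> back to \<open>b\<close>.\<close>
      case 2
      have e: "b \<otimes> a [^] j \<otimes> a [^] (- j) = b"
        using b by (simp add: m_assoc int_pow_mult[OF a, symmetric])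
      have "b \<otimes> a [^] j \<in> elementary"
        using N[of "b \<otimes> a [^] j" "- j" i 0] 2 close' b(1) unfolding e by simp
      then show ?thesis using elementary_mult[OF _ elementary_pow[of "- j"]] e by metis
    qed
    then show False using b by simp
  qed
  then show ?thesis using nn t by (intro exI[of _ "t + len b"]) auto
qed

section \<open>Copies of a power of \<open>a\<close> along its axis\<close>

lemma copy_between_near:
  assumes "copy_between w W x y" and w: "w \<in> carrier G"
  obtains g where "g \<in> carrier G" "d x (pt g) + len w + d (pt (g \<otimes> w)) y \<le> d x y + 3 * W + 2 + 4 * \<delta>"
    "gp (pt g) x y \<le> 3 * W + 2 + 4 * \<delta>" "gp (pt (g \<otimes> w)) x y \<le> 3 * W + 2 + 4 * \<delta>"
proof -
  obtain g where g: "g \<in> carrier G" and c: "d x (pt g) + len w + d (pt (g \<otimes> w)) y \<le> d x y + 3 * W + 2 + 4 * \<delta>"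
    using assms by (auto simp: copy_between_def)
  have "d (pt g) (pt (g \<otimes> w)) = len w" using d_len g w by simp
  then have "d (pt g) y \<le> len w + d (pt (g \<otimes> w)) y" "d x (pt (g \<otimes> w)) \<le> d x (pt g) + len w"
    using d_triangle[of "pt g" y "pt (g \<otimes> w)"] d_triangle[of x "pt (g \<otimes> w)" "pt g"] by simp_all
  moreover have "d x y \<le> d x (pt g) + d (pt g) y" "d x y \<le> d x (pt (g \<otimes> w)) + d (pt (g \<otimes> w)) y"
    by (rule d_triangle)+
  ultimately show ?thesis
    using that[OF g c] c d_sym[of x "pt g"] d_sym[of x "pt (g \<otimes> w)"] d_sym[of y "pt g"] d_sym[of y "pt (g \<otimes> w)"]
    by (simp add: gromov_product_def)
qed

text \<open>By \<open>near_axis\<close> and \<open>overlap\<close> the ends of a copy lie near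
  \<open>P i\<close> and \<open>P j\<close> with \<open>i \<le> j\<close>. Going from
  \<open>P k\<close> to \<open>P 0\<close> via this copy covers the stretch between them three
  times, which only short copies can afford.\<close>

lemma no_reversed_copy:
  assumes chiral: "\<And>e. e \<in> carrier G \<Longrightarrow> \<not> intertwines e (- 1)" and W: "0 \<le> W"
  shows "\<exists>N::nat. \<forall>n\<ge>int N. \<forall>k\<ge>0. \<not> copy_between (a [^] n) W (P k) (pt \<one>)"
proof -
  define D where "D = 3 * W + 2 + 4 * \<delta>"
  define B where "B = 2 * max Q D + 2 * \<delta> + len a"
  have nn: "0 \<le> D" "0 \<le> B"
    using W delta_nonneg Q_nonneg len_nonneg[of a] by (auto simp: D_def B_def)
  obtain N1 :: nat where N1: "\<And>e n i j. e \<in> carrier G \<Longrightarrow> int N1 \<le> n \<Longrightarrow> d (pt e) (P i) \<le> B \<Longrightarrow>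
      d (pt (e \<otimes> a [^] n)) (P j) \<le> B \<Longrightarrow> intertwines e (if i \<le> j then 1 else - 1)"
    using overlap[of B] by blast
  obtain N2 :: nat where N2: "\<And>n::int. int N2 \<le> \<bar>n\<bar> \<Longrightarrow> D + 6 * B + 4 * Q + 1 \<le> L n"
    using L_unbounded by blast
  have False if n: "int N1 \<le> n" "int N2 \<le> n" and k: "0 \<le> k" and cb: "copy_between (a [^] n) W (P k) (P 0)" for n k
  proof -
    obtain g where g: "g \<in> carrier G" and c: "d (P k) (pt g) + L n + d (pt (g \<otimes> a [^] n)) (P 0) \<le> d (P k) (P 0) + D"
      and "gp (pt g) (P k) (P 0) \<le> D" "gp (pt (g \<otimes> a [^] n)) (P k) (P 0) \<le> D"
      using copy_between_near[OF cb] by (auto simp: D_def add.assoc)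
    then have "gp (pt g) (P 0) (P k) \<le> max Q D" "gp (pt (g \<otimes> a [^] n)) (P 0) (P k) \<le> max Q D"
      using gp_sym[of _ "P k" "P 0"] by auto
    then obtain i j where ij: "i \<in> {0..k}" "j \<in> {0..k}" "d (pt g) (P i) \<le> B" "d (pt (g \<otimes> a [^] n)) (P j) \<le> B"
      using near_axis[of "max Q D" 0 k "pt g", OF max.cobounded1 k]
        near_axis[of "max Q D" 0 k "pt (g \<otimes> a [^] n)", OF max.cobounded1 k]
      unfolding B_def by blast
    have "i \<le> j"
      using N1[OF g n(1) ij(3,4)] chiral[OF g] by (auto split: if_splits)
    have Lij: "L n \<le> L (j - i) + 2 * B"
      using d_len[OF g, of "a [^] n"] d_triangle[of "pt g" "pt (g \<otimes> a [^] n)" "P i"]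
        d_triangle[of "P i" "pt (g \<otimes> a [^] n)" "P j"] ij d_P[of i j] d_sym[of "P j" "pt (g \<otimes> a [^] n)"] by simp
    have "L k = d (P k) (P 0)" "L (k - i) = d (P k) (P i)" "L j = d (P j) (P 0)"
      using d_P[of 0 k] d_P[of i k] d_P[of 0 j] by (auto simp: d_sym)
    then have c': "L (k - i) + L n + L j \<le> L k + D + 2 * B"
      using c ij d_triangle[of "P k" "P i" "pt g"] d_triangle[of "P j" "P 0" "pt (g \<otimes> a [^] n)"]
        d_sym[of "P j" "pt (g \<otimes> a [^] n)"] by linarith
    have "L (k - j) + L (j - i) - 2 * Q \<le> L (k - i)" "L (j - i) + L i - 2 * Q \<le> L j"
      using L_superadditive[of "k - j" "j - i"] L_superadditive[of "j - i" i] ij \<open>i \<le> j\<close> by auto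
    moreover have "L k \<le> L (k - j) + L j" "L j \<le> L (j - i) + L i"
      using d_triangle[of "P 0" "P k" "P j"] d_triangle[of "P 0" "P j" "P i"] d_P[of j k] d_P[of i j]
      by (simp_all add: len_def)
    ultimately have "L n + L (j - i) \<le> D + 2 * B + 4 * Q"
      using c' len_nonneg[of "a [^] (j - i)"] by linarith
    moreover have "D + 6 * B + 4 * Q + 1 \<le> L n" using N2[of n] n by simp
    ultimately show False using len_nonneg[of "a [^] (j - i)"] nn by linarith
  qed
  moreover have "int N1 \<le> n" "int N2 \<le> n" if "int (max N1 N2) \<le> n" for n
    using that by linarith+
  ultimately have "\<forall>n\<ge>int (max N1 N2). \<forall>k\<ge>0. \<not> copy_between (a [^] n) W (P k) (pt \<one>)"
    by fastforce
  then show ?thesis by blast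
qed

lemma Qh_nat_pow:
  assumes "h \<in> Qh G" shows "h (a [^] (n::nat)) = real n * h a"
proof -
  have gen: "a [^] (i::int) \<in> generate G {a}" for i
    using generate_pow[OF a] by auto
  have hom: "h (x \<otimes> y) = h x + h y" if "x \<in> generate G {a}" "y \<in> generate G {a}" for x y
    using assms a that unfolding Qh_def homogeneous_def by blast
  show ?thesis
  proof (induction n)
    case 0
    then show ?case using hom[OF gen[of 0] gen[of 0]] by simp
  next
    case (Suc n)
    then show ?case using hom[OF gen[of "int n"] gen[of 1]] a by (simp add: int_pow_int algebra_simps)
  qed
qed

text \<open>\<open>jump_quasimorphism\<close> is applied with \<open>w\<close> and \<open>f\<close>
  both equal to a large power of \<open>a\<close> and with trivial \<open>u\<close>; homogeneity
  passes from the power to \<open>a\<close>.\<close>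

lemma chiral_detected:
  assumes chiral: "\<And>e. e \<in> carrier G \<Longrightarrow> \<not> intertwines e (- 1)"
  shows "\<exists>h\<in>Qh G. h a \<noteq> 0"
proof -
  \<comment> \<open>One period loses at most \<open>2 * Q\<close>, by
    \<open>L_superadditive\<close>; the additional 1 is the net gain.\<close>
  define W where "W = 2 * Q + 1"
  have W: "0 \<le> W" using Q_nonneg by (simp add: W_def)
  obtain N1 :: nat where N1: "\<forall>n\<ge>int N1. \<forall>k\<ge>0. \<not> copy_between (a [^] n) W (P k) (pt \<one>)"
    using no_reversed_copy[OF chiral W] by blast
  obtain N2 :: nat where N2: "\<And>n::int. int N2 \<le> \<bar>n\<bar> \<Longrightarrow> 3 * W + 2 + 4 * \<delta> + 1 \<le> L n"
    using L_unbounded by blast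
  define n where "n = max N1 N2"
  have n: "int N1 \<le> int n" by (simp add: n_def)
  let ?w = "a [^] int n"
  have "3 * W + 2 + 4 * \<delta> < len ?w" using N2[of "int n"] by (simp add: n_def)
  then obtain h where h: "h \<in> Qh G" and
    h': "\<And>f u \<eta>. f \<in> carrier G \<Longrightarrow> (\<forall>k::nat. \<not> copy_between ?w W (pt (f [^] k)) (pt \<one>)) \<Longrightarrow>
      u \<in> carrier G \<Longrightarrow> \<eta> > 0 \<Longrightarrow> f = ?w \<otimes> u \<Longrightarrow>
      (\<forall>k::nat. real k * (len ?w + len u - W + \<eta>) \<le> len (f [^] k)) \<Longrightarrow> h f \<noteq> 0"
    using jump_quasimorphism[of ?w W] W by (simp only: apow) blast
  have pow: "?w [^] k = a [^] (int n * int k)" for k :: nat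
    using int_pow_pow[OF a, of "int n" "int k"] by (simp add: int_pow_int)
  have "real k * (L (int n) - 2 * Q) \<le> L (int n * int k)" for k
  proof (induction k)
    case (Suc k)
    then show ?case using L_superadditive[of "int n * int k" "int n"] by (simp add: algebra_simps)
  qed simp
  then have "h ?w \<noteq> 0"
    using N1 n by (intro h'[of ?w \<one> 1]) (auto simp: pow W_def)
  then show ?thesis
    using h Qh_nat_pow[OF h, of n] by (intro bexI[OF _ h]) (auto simp: int_pow_int)
qed

end

section \<open>Broken geodesics in the direction of two independent elements\<close>

lemma sum_lessThan_3_mult:
  fixes f :: "nat \<Rightarrow> real"
  shows "(\<Sum>k<3 * q. f k) = (\<Sum>k<q. f (3 * k) + f (3 * k + 1) + f (3 * k + 2))"
  by (induction q) (auto simp: numeral_3_eq_3)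

locale transversal_axis = axis d \<delta> G pt tripod a Q K C
  for d :: "'v \<Rightarrow> 'v \<Rightarrow> real" and \<delta> and G :: "('g, 'b) monoid_scheme" (structure) and pt tripod a Q K C +
  fixes b :: 'g and T :: real
  assumes b: "b \<in> carrier G" "b \<notin> elementary"
    and T: "0 \<le> T" "\<And>(m::int) (n::int). gromov_product d (pt \<one>) (pt (a [^] m)) (pt (b \<otimes> a [^] n)) \<le> T"
begin

text \<open>The corners, one after each letter \<open>b\<close>, of the path spelled by
  \<open>a [^] \<nu> 0\<close>, \<open>b\<close>, \<open>a [^] \<nu> 1\<close>, \<open>b\<close>,
  and so on.\<close>

primrec vertex :: "(nat \<Rightarrow> int) \<Rightarrow> nat \<Rightarrow> 'g" where
  "vertex \<nu> 0 = \<one>"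
| "vertex \<nu> (Suc k) = vertex \<nu> k \<otimes> a [^] \<nu> k \<otimes> b"

abbreviation X :: "(nat \<Rightarrow> int) \<Rightarrow> nat \<Rightarrow> 'v" where "X \<nu> k \<equiv> pt (vertex \<nu> k)"

lemma vertex_closed [simp]: "vertex \<nu> k \<in> carrier G"
  by (induction k) (auto simp: b)

text \<open>The bound of \<open>gp_vertex_local\<close>: transversality, plus \<open>len b\<close>
  for each of two points displaced by \<open>b\<close>.\<close>

definition S :: real where "S = T + 2 * len b"

text \<open>The threshold of \<open>local_to_global\<close> for the constant \<open>S\<close>, with
  room for one letter \<open>b\<close>.\<close>

definition long :: "(nat \<Rightarrow> int) \<Rightarrow> bool" where
  "long \<nu> \<longleftrightarrow> (\<forall>k. 0 \<le> \<nu> k \<and> 2 * S + 4 * \<delta> + len b < L (\<nu> k))"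

lemma S_nonneg: "0 \<le> S"
  using T len_nonneg by (simp add: S_def)

lemma d_vertex_Suc:
  "d (X \<nu> k) (X \<nu> (Suc k)) \<le> L (\<nu> k) + len b" "L (\<nu> k) - len b \<le> d (X \<nu> k) (X \<nu> (Suc k))"
proof -
  let ?m = "pt (vertex \<nu> k \<otimes> a [^] \<nu> k)"
  have "d (X \<nu> k) ?m = L (\<nu> k)" "d ?m (X \<nu> (Suc k)) = len b"
    using b by (simp_all add: d_len)
  then show "d (X \<nu> k) (X \<nu> (Suc k)) \<le> L (\<nu> k) + len b" "L (\<nu> k) - len b \<le> d (X \<nu> k) (X \<nu> (Suc k))"
    using d_triangle[of "X \<nu> k" "X \<nu> (Suc k)" ?m] d_triangle[of "X \<nu> k" ?m "X \<nu> (Suc k)"]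
      d_sym[of ?m "X \<nu> (Suc k)"] by auto
qed

text \<open>Translating the point before the letter \<open>b\<close> to the base point turns the
  corner into one between the axis and its translate by \<open>b\<close>.\<close>

lemma gp_vertex_local: "gp (X \<nu> (k + 1)) (X \<nu> k) (X \<nu> (k + 2)) \<le> S"
proof -
  let ?g = "vertex \<nu> k \<otimes> a [^] \<nu> k" and ?m = "\<nu> k" and ?n = "\<nu> (Suc k)"
  have g: "?g \<in> carrier G" by simp
  have "?g \<otimes> a [^] (- ?m) = vertex \<nu> k"
    by (simp add: m_assoc int_pow_mult[OF a, symmetric])
  moreover have "X \<nu> (k + 2) = pt (?g \<otimes> (b \<otimes> a [^] ?n \<otimes> b))"
    using b by (simp add: m_assoc)
  ultimately have "gp (X \<nu> (k + 1)) (X \<nu> k) (X \<nu> (k + 2)) = gp (pt b) (P (- ?m)) (pt (b \<otimes> a [^] ?n \<otimes> b))"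
    using gp_invariant[OF g, of b "a [^] (- ?m)" "b \<otimes> a [^] ?n \<otimes> b"] b by simp
  also have "\<dots> \<le> gp (pt \<one>) (P (- ?m)) (pt (b \<otimes> a [^] ?n \<otimes> b)) + len b"
    unfolding len_def by (rule gp_perturb0)
  also have "gp (pt \<one>) (P (- ?m)) (pt (b \<otimes> a [^] ?n \<otimes> b)) \<le> gp (pt \<one>) (P (- ?m)) (pt (b \<otimes> a [^] ?n)) + len b"
    using gp_perturb2[of "pt \<one>" "P (- ?m)" "pt (b \<otimes> a [^] ?n \<otimes> b)" "pt (b \<otimes> a [^] ?n)"] b
    by (simp add: d_len)
  also have "gp (pt \<one>) (P (- ?m)) (pt (b \<otimes> a [^] ?n)) \<le> T" by (rule T(2))
  finally show ?thesis by (simp add: S_def)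
qed

declare vertex.simps(2) [simp del]

lemma long_vertex: "long \<nu> \<Longrightarrow> d (X \<nu> i) (X \<nu> (i + 1)) > 2 * S + 4 * \<delta>"
  using d_vertex_Suc(2)[of \<nu> i] by (auto simp: long_def) (smt (verit))

lemma gp_vertex:
  assumes "long \<nu>" "i \<le> n"
  shows "gp (X \<nu> i) (X \<nu> 0) (X \<nu> n) \<le> S + 2 * \<delta>"
proof -
  consider "i = 0" | "i = n" | "0 < i" "i < n" using assms by linarith
  then show ?thesis
  proof cases
    case 3
    then show ?thesis
      using local_to_global[of n "X \<nu>" S 0 i n] gp_vertex_local long_vertex[OF assms(1)] by simp
  qed (use S_nonneg delta_nonneg in \<open>auto simp: gromov_product_def d_sym\<close>)
qed

lemma len_vertex:
  assumes "long \<nu>"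
  shows "(\<Sum>k<n. L (\<nu> k) - len b - 2 * S - 2 * \<delta>) \<le> len (vertex \<nu> n)"
proof -
  have "(\<Sum>k<n. L (\<nu> k) - len b - 2 * S - 2 * \<delta>) \<le> (\<Sum>k<n. d (X \<nu> k) (X \<nu> (k + 1)) - 2 * S - 2 * \<delta>)"
    using d_vertex_Suc(2) by (intro sum_mono) (simp add: algebra_simps)
  also have "\<dots> \<le> d (X \<nu> 0) (X \<nu> n)"
    using local_to_global_length[of n "X \<nu>" S n] gp_vertex_local long_vertex[OF assms] S_nonneg by simp
  finally show ?thesis by (simp add: len_def)
qed

text \<open>Positions along the broken geodesic are measured by the distance from its origin.\<close>

abbreviation pos :: "'v \<Rightarrow> real" where "pos \<equiv> d (pt \<one>)"

lemma pos_diff: "pos x \<le> pos y + d x y" "pos y \<le> pos x + d x y"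
  using d_triangle[of "pt \<one>" x y] d_triangle[of "pt \<one>" y x] by (simp_all add: d_sym)

lemma pos_vertex_Suc:
  assumes "long \<nu>"
  shows "pos (X \<nu> (Suc k)) \<le> pos (X \<nu> k) + L (\<nu> k) + len b"
    and "pos (X \<nu> k) + L (\<nu> k) - len b - 2 * S - 4 * \<delta> \<le> pos (X \<nu> (Suc k))"
proof -
  show "pos (X \<nu> (Suc k)) \<le> pos (X \<nu> k) + L (\<nu> k) + len b"
    using pos_diff(2)[of "X \<nu> (Suc k)" "X \<nu> k"] d_vertex_Suc(1)[of \<nu> k] by linarith
  show "pos (X \<nu> k) + L (\<nu> k) - len b - 2 * S - 4 * \<delta> \<le> pos (X \<nu> (Suc k))"
    using gp_vertex[OF assms, of k "Suc k"] d_vertex_Suc(2)[of \<nu> k]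
    by (simp add: gromov_product_def d_sym)
qed

text \<open>The point lies nearly between consecutive vertices, by \<open>quasi_geodesic\<close>,
  and these lie nearly on a geodesic to \<open>X \<nu> n\<close>; the errors add up.\<close>

lemma gp_piece:
  assumes "long \<nu>" "k < n" "0 \<le> s" "s \<le> \<nu> k"
  shows "gp (pt (vertex \<nu> k \<otimes> a [^] s)) (pt \<one>) (X \<nu> n) \<le> Q + len b + 2 * S + 4 * \<delta>"
proof -
  let ?q = "pt (vertex \<nu> k \<otimes> a [^] s)" and ?e = "pt (vertex \<nu> k \<otimes> a [^] \<nu> k)"
  have "gp ?q (X \<nu> k) ?e = gp (P s) (P 0) (P (\<nu> k))"
    using gp_invariant[of "vertex \<nu> k" "a [^] s" "a [^] (0::int)" "a [^] \<nu> k"] by simp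
  also have "\<dots> \<le> Q" using assms by (intro quasi_geodesic) auto
  finally have "gp ?q (X \<nu> k) (X \<nu> (Suc k)) \<le> Q + len b"
    using gp_perturb2[of ?q "X \<nu> k" "X \<nu> (Suc k)" ?e] d_len[of "vertex \<nu> k \<otimes> a [^] \<nu> k" b] b
    by (simp add: vertex.simps(2))
  moreover have "gp (X \<nu> k) (pt \<one>) (X \<nu> (Suc k)) \<le> S + 2 * \<delta>" "gp (X \<nu> (Suc k)) (pt \<one>) (X \<nu> n) \<le> S + 2 * \<delta>"
    using gp_vertex[OF assms(1), of k "Suc k"] gp_vertex[OF assms(1), of "Suc k" n] assms by auto
  ultimately have "d (X \<nu> k) ?q + d ?q (X \<nu> (Suc k)) \<le> d (X \<nu> k) (X \<nu> (Suc k)) + 2 * (Q + len b)"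
    "pos (X \<nu> k) + d (X \<nu> k) (X \<nu> (Suc k)) \<le> pos (X \<nu> (Suc k)) + 2 * (S + 2 * \<delta>)"
    "pos (X \<nu> (Suc k)) + d (X \<nu> (Suc k)) (X \<nu> n) \<le> pos (X \<nu> n) + 2 * (S + 2 * \<delta>)"
    by (simp_all add: gromov_product_def d_sym field_simps)
  moreover have "gp ?q (pt \<one>) (X \<nu> n) = (pos ?q + d ?q (X \<nu> n) - pos (X \<nu> n)) / 2"
    by (simp add: gromov_product_def d_sym)
  ultimately show ?thesis
    using d_triangle[of "pt \<one>" ?q "X \<nu> k"] d_triangle[of ?q "X \<nu> n" "X \<nu> (Suc k)"]
    by argo
qed

text \<open>If a vertex were deep inside a translate \<open>g\<close> of the axis, then both pieces meeting at it would overlap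
  this translate, so that \<open>b\<close> would be elementary.\<close>

definition no_deep_vertex :: "real \<Rightarrow> nat \<Rightarrow> real \<Rightarrow> bool" where
  "no_deep_vertex B N M \<longleftrightarrow> (\<forall>\<nu> g. \<forall>m::int. \<forall>n k. long \<nu> \<longrightarrow> (\<forall>k. int N \<le> \<nu> k) \<longrightarrow> g \<in> carrier G \<longrightarrow> 0 \<le> m \<longrightarrow>
    gp (pt g) (pt \<one>) (X \<nu> n) \<le> B \<longrightarrow> gp (pt (g \<otimes> a [^] m)) (pt \<one>) (X \<nu> n) \<le> B \<longrightarrow> Suc k < n \<longrightarrow>
    min (pos (pt g)) (pos (pt (g \<otimes> a [^] m))) + M \<le> pos (X \<nu> (Suc k)) \<longrightarrow>
    pos (X \<nu> (Suc k)) + M \<le> max (pos (pt g)) (pos (pt (g \<otimes> a [^] m))) \<longrightarrow> False)"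

text \<open>After translation by \<open>inv g\<close>, the start of the piece after the vertex and
  the end of the piece before it both run along the axis. Hence both translating elements are in
  \<open>elementary\<close>, and so is their quotient, a power of \<open>a\<close> times
  \<open>b\<close>.\<close>

lemma ex_no_deep_vertex:
  assumes B: "Q + len b + 2 * S + 4 * \<delta> \<le> B"
  shows "\<exists>N M. no_deep_vertex B N M \<and> 2 * B < M"
proof -
  define B3 where "B3 = 2 * (2 * B + 2 * \<delta>) + 2 * \<delta> + len a + len b"
  obtain N :: nat where N: "\<And>e n i j. e \<in> carrier G \<Longrightarrow> int N \<le> n \<Longrightarrow> d (pt e) (P i) \<le> B3 \<Longrightarrow>
      d (pt (e \<otimes> a [^] n)) (P j) \<le> B3 \<Longrightarrow> e \<in> elementary"
    using overlap_elementary[of B3] by blast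
  \<comment> \<open>Covers \<open>int N\<close> steps and a letter \<open>b\<close> on either side
    of the vertex; the other terms ensure \<open>2 * B < M\<close>.\<close>
  define M where "M = L (int N) + len b + 2 * B + 1"
  have nn: "0 \<le> len a" "0 \<le> len b" "0 \<le> L (int N)" "0 \<le> B"
    using len_nonneg B Q_nonneg S_nonneg delta_nonneg by (auto intro: order_trans[rotated, OF B])
  have False if \<nu>: "long \<nu>" "\<And>k. int N \<le> \<nu> k" and g: "g \<in> carrier G" and m: "0 \<le> m"
    and near: "gp (pt g) (pt \<one>) (X \<nu> n) \<le> B" "gp (pt (g \<otimes> a [^] m)) (pt \<one>) (X \<nu> n) \<le> B"
    and k: "Suc k < n"
    and deep: "min (pos (pt g)) (pos (pt (g \<otimes> a [^] m))) + M \<le> pos (X \<nu> (Suc k))"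
      "pos (X \<nu> (Suc k)) + M \<le> max (pos (pt g)) (pos (pt (g \<otimes> a [^] m)))" for \<nu> g n k and m :: int
  proof -
    let ?v = "vertex \<nu> (Suc k)" and ?r = "vertex \<nu> k"
    \<comment> \<open>A point within \<open>M\<close> of a deep vertex still has its position
      between those of the ends of the translate, hence is near the translated axis.\<close>
    have axis_point: "\<exists>j. d (pt (inv g \<otimes> h)) (P j) \<le> B3 - len b"
      if h: "h \<in> carrier G" and hB: "gp (pt h) (pt \<one>) (X \<nu> n) \<le> B" and "d (pt h) (pt ?v) \<le> M" for h
    proof -
      have "min (pos (pt g)) (pos (pt (g \<otimes> a [^] m))) \<le> pos (pt h)"
        "pos (pt h) \<le> max (pos (pt g)) (pos (pt (g \<otimes> a [^] m)))"
        using pos_diff[where x = "pt h" and y = "X \<nu> (Suc k)"] that(3) deep by argo+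
      then have "gp (pt h) (pt g) (pt (g \<otimes> a [^] m)) \<le> 2 * B + 2 * \<delta>"
        using between_of_order[OF near hB] between_of_order[OF near(2,1) hB] gp_sym[of "pt h"]
        by (auto simp: min_def max_def split: if_splits)
      moreover have "gp (pt (inv g \<otimes> h)) (P 0) (P m) = gp (pt h) (pt g) (pt (g \<otimes> a [^] m))"
        using gp_invariant[of "inv g" h g "g \<otimes> a [^] m"] g h by (simp add: m_assoc[symmetric])
      moreover have "Q \<le> 2 * B + 2 * \<delta>"
        using B nn S_nonneg delta_nonneg by linarith
      ultimately show ?thesis
        using near_axis[of "2 * B + 2 * \<delta>" 0 m "pt (inv g \<otimes> h)"] m by (auto simp: B3_def)
    qed
    have gv: "gp (pt ?v) (pt \<one>) (X \<nu> n) \<le> B"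
      using gp_vertex[OF \<nu>(1), of "Suc k" n] k B nn Q_nonneg S_nonneg delta_nonneg by simp
    have piece: "gp (pt (vertex \<nu> i \<otimes> a [^] s)) (pt \<one>) (X \<nu> n) \<le> B" if "i < n" "0 \<le> s" "s \<le> \<nu> i" for i s
      using gp_piece[OF \<nu>(1) that] B by linarith
    obtain j1 where j1: "d (pt (inv g \<otimes> ?v)) (P j1) \<le> B3 - len b"
      using axis_point[of ?v] gv nn by (auto simp: M_def)
    obtain j2 where j2: "d (pt (inv g \<otimes> (?v \<otimes> a [^] int N))) (P j2) \<le> B3 - len b"
      using axis_point[of "?v \<otimes> a [^] int N"] piece[of "Suc k" "int N"] k \<nu>(2)[of "Suc k"] nn
        d_len[of ?v "a [^] int N"] d_sym[of "pt (?v \<otimes> a [^] int N)" "pt ?v"] by (auto simp: M_def)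
    have e1: "inv g \<otimes> ?v \<in> elementary"
      using N[of "inv g \<otimes> ?v" "int N" j1 j2] j1 j2 g nn by (simp add: m_assoc)
    \<comment> \<open>The last \<open>int N\<close> steps of the previous piece stop one letter
      \<open>b\<close> short of the vertex, which \<open>B3\<close> allows for.\<close>
    let ?s = "\<nu> k - int N"
    have s: "?r \<otimes> a [^] ?s \<otimes> a [^] int N = ?r \<otimes> a [^] \<nu> k"
      by (simp add: m_assoc int_pow_mult[OF a, symmetric])
    have dv: "d (pt (?r \<otimes> a [^] \<nu> k)) (pt ?v) = len b"
      using d_len[of "?r \<otimes> a [^] \<nu> k" b] b by (simp add: vertex.simps(2))
    have "d (pt (?r \<otimes> a [^] ?s)) (pt (?r \<otimes> a [^] \<nu> k)) = L (int N)"
      using d_len[of "?r \<otimes> a [^] ?s" "a [^] int N"] unfolding s by simp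
    then have "d (pt (?r \<otimes> a [^] ?s)) (pt ?v) \<le> M"
      using d_triangle[of "pt (?r \<otimes> a [^] ?s)" "pt ?v" "pt (?r \<otimes> a [^] \<nu> k)"] dv nn by (simp add: M_def)
    then obtain j3 where j3: "d (pt (inv g \<otimes> (?r \<otimes> a [^] ?s))) (P j3) \<le> B3 - len b"
      using axis_point[of "?r \<otimes> a [^] ?s"] piece[of k ?s] k \<nu>(2)[of k] by auto
    have "d (pt (inv g \<otimes> (?r \<otimes> a [^] \<nu> k))) (pt (inv g \<otimes> ?v)) = len b"
      using pt_invariant[of "inv g" "?r \<otimes> a [^] \<nu> k" ?v] g dv by simp
    then have "d (pt (inv g \<otimes> (?r \<otimes> a [^] \<nu> k))) (P j1) \<le> B3"
      using j1 d_triangle[of "pt (inv g \<otimes> (?r \<otimes> a [^] \<nu> k))" "P j1" "pt (inv g \<otimes> ?v)"] by linarith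
    moreover have "inv g \<otimes> (?r \<otimes> a [^] ?s) \<otimes> a [^] int N = inv g \<otimes> (?r \<otimes> a [^] \<nu> k)"
      using s g by (simp add: m_assoc)
    ultimately have e2: "inv g \<otimes> (?r \<otimes> a [^] ?s) \<in> elementary"
      using N[of "inv g \<otimes> (?r \<otimes> a [^] ?s)" "int N" j3 j1] j3 g nn by simp
    have "?v = ?r \<otimes> a [^] ?s \<otimes> (a [^] int N \<otimes> b)"
      using s b by (simp add: vertex.simps(2) m_assoc[symmetric])
    then have "inv (inv g \<otimes> (?r \<otimes> a [^] ?s)) \<otimes> (inv g \<otimes> ?v) = a [^] int N \<otimes> b"
      using g b by (simp add: inv_mult_group m_assoc) (simp add: m_assoc[symmetric] inv_solve_left)
    then have "a [^] int N \<otimes> b \<in> elementary"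
      using elementary_mult[OF elementary_inv[OF e2] e1] by simp
    then have "a [^] (- int N) \<otimes> (a [^] int N \<otimes> b) \<in> elementary"
      by (rule elementary_mult[OF elementary_pow])
    moreover have "a [^] (- int N) \<otimes> (a [^] int N \<otimes> b) = b"
      using b by (simp add: m_assoc[symmetric] int_pow_mult[OF a, symmetric])
    ultimately show False using b by simp
  qed
  then have "no_deep_vertex B N M" unfolding no_deep_vertex_def by blast
  moreover have "2 * B < M" using nn by (simp add: M_def)
  ultimately show ?thesis by blast
qed

end

section \<open>Words that are not reversible\<close>

context transversal_axis begin

lemma no_deep_vertexD:
  assumes "no_deep_vertex B N M" "long \<nu>" "\<And>k. int N \<le> \<nu> k" "g \<in> carrier G" "0 \<le> m"
    "gp (pt g) (pt \<one>) (X \<nu> n) \<le> B" "gp (pt (g \<otimes> a [^] (m::int))) (pt \<one>) (X \<nu> n) \<le> B" "Suc k < n"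
    "min (pos (pt g)) (pos (pt (g \<otimes> a [^] m))) + M \<le> pos (X \<nu> (Suc k))"
  shows "max (pos (pt g)) (pos (pt (g \<otimes> a [^] m))) < pos (X \<nu> (Suc k)) + M"
  using assms unfolding no_deep_vertex_def not_le[symmetric] by blast

lemma pos_le_end: "gp x (pt \<one>) y \<le> B \<Longrightarrow> pos x \<le> pos y + 2 * B"
  using d_nonneg[of x y] by (simp add: gromov_product_def d_sym)

text \<open>Otherwise the vertex just past the level \<open>lo + M\<close> comes at most one piece
  later, still more than \<open>M\<close> below \<open>hi\<close>, and is deep.\<close>

lemma segment_bound:
  assumes nd: "no_deep_vertex B N M" and MB: "2 * B < M" "0 \<le> B"
    and \<nu>: "long \<nu>" "\<And>k. int N \<le> \<nu> k" "\<And>k. L (\<nu> k) \<le> \<Lambda>" and g: "g \<in> carrier G" "0 \<le> m"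
    and near: "gp (pt g) (pt \<one>) (X \<nu> n) \<le> B" "gp (pt (g \<otimes> a [^] (m::int))) (pt \<one>) (X \<nu> n) \<le> B"
  shows "L m \<le> \<Lambda> + len b + 2 * M + 2 * B + 2 * \<delta>"
proof (rule ccontr)
  assume neg: "\<not> ?thesis"
  define lo hi where "lo = min (pos (pt g)) (pos (pt (g \<otimes> a [^] m)))"
    and "hi = max (pos (pt g)) (pos (pt (g \<otimes> a [^] m)))"
  have "L m \<le> hi - lo + 2 * B + 2 * \<delta>"
    using fellow_travel[OF near] d_len[of g "a [^] m"] g by (simp add: lo_def hi_def)
  then have gap: "\<Lambda> + len b + 2 * M < hi - lo" using neg by linarith
  have hi: "hi \<le> pos (X \<nu> n) + 2 * B"
    using pos_le_end[OF near(1)] pos_le_end[OF near(2)] by (simp add: hi_def)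
  have lo: "0 \<le> lo" by (simp add: lo_def d_nonneg)
  have "0 \<le> \<Lambda> + len b" using \<nu>(3)[of 0] len_nonneg[of b] len_nonneg[of "a [^] \<nu> 0"] by linarith
  then obtain k where k: "k < n" "pos (X \<nu> k) \<le> lo + M" "lo + M < pos (X \<nu> (Suc k))"
    using last_below[of "\<lambda>k. pos (X \<nu> k)" "lo + M" n] gap hi lo MB by auto
  have top: "pos (X \<nu> (Suc k)) < hi - M"
    using pos_vertex_Suc(1)[OF \<nu>(1), of k] \<nu>(3)[of k] k gap by linarith
  then have "Suc k \<noteq> n" using hi MB by auto
  then have "hi < pos (X \<nu> (Suc k)) + M"
    using no_deep_vertexD[OF nd \<nu>(1,2) g near, of k] k by (simp add: lo_def hi_def)
  then show False using top by simp
qed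

definition pattern :: "int \<Rightarrow> nat \<Rightarrow> int" where
  "pattern n k = (if k mod 3 = 0 then 2 * n else if k mod 3 = 1 then 3 * n else n)"

definition word :: "int \<Rightarrow> 'g" where "word n = a [^] (2 * n) \<otimes> b \<otimes> a [^] (3 * n)"
definition rest :: "int \<Rightarrow> 'g" where "rest n = b \<otimes> a [^] n \<otimes> b"

lemma word_closed [simp]: "word n \<in> carrier G" "rest n \<in> carrier G"
  using b by (auto simp: word_def rest_def)

lemma vertex_pattern: "vertex (pattern n) (3 * q) = (word n \<otimes> rest n) [^] q"
proof (induction q)
  case (Suc q)
  have "3 * Suc q = Suc (Suc (Suc (3 * q)))" by simp
  moreover have "pattern n (3 * q) = 2 * n" "pattern n (Suc (3 * q)) = 3 * n" "pattern n (Suc (Suc (3 * q))) = n"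
    by (auto simp: pattern_def mod_Suc)
  ultimately have "vertex (pattern n) (3 * Suc q) = vertex (pattern n) (3 * q) \<otimes> (word n \<otimes> rest n)"
    using b by (simp only: vertex.simps(2)) (simp add: m_assoc word_def rest_def)
  then show ?case
    using Suc by simp
qed simp

text \<open>The inner vertices of a copy of \<open>word n\<close> are near the geodesic as well, by transversality.\<close>

lemma copy_of_word:
  assumes "copy_between (word n) W x y" "0 \<le> W"
  obtains g where "g \<in> carrier G"
    "d x (pt g) + len (word n) + d (pt (g \<otimes> word n)) y \<le> d x y + 3 * W + 2 + 4 * \<delta>"
    "L (2 * n) + len (b \<otimes> a [^] (3 * n)) - 2 * T \<le> len (word n)"
    "gp (pt g) x y \<le> 3 * W + 2 + 4 * \<delta> + T + len b"
    "gp (pt (g \<otimes> a [^] (2 * n))) x y \<le> 3 * W + 2 + 4 * \<delta> + T + len b"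
    "gp (pt (g \<otimes> a [^] (2 * n) \<otimes> b)) x y \<le> 3 * W + 2 + 4 * \<delta> + T + len b"
    "gp (pt (g \<otimes> word n)) x y \<le> 3 * W + 2 + 4 * \<delta> + T + len b"
proof -
  obtain g where g: "g \<in> carrier G" and c: "d x (pt g) + len (word n) + d (pt (g \<otimes> word n)) y \<le> d x y + 3 * W + 2 + 4 * \<delta>"
    and g1: "gp (pt g) x y \<le> 3 * W + 2 + 4 * \<delta>" "gp (pt (g \<otimes> word n)) x y \<le> 3 * W + 2 + 4 * \<delta>"
    using copy_between_near[OF assms(1)] by auto
  let ?p = "pt (g \<otimes> a [^] (2 * n))" and ?e = "b \<otimes> a [^] (3 * n)"
  have w: "word n = a [^] (2 * n) \<otimes> ?e" using b by (simp add: word_def m_assoc)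
  have nn: "0 \<le> len b" "0 \<le> T" "0 \<le> \<delta>" using len_nonneg T delta_nonneg by auto
  \<comment> \<open>The first corner of the word is moved to the base point, where \<open>T\<close>
    bounds the product of its two sides.\<close>
  have "d (P (- (2 * n))) (pt ?e) = len (word n)"
    using pt_invariant[of "a [^] (2 * n)" "a [^] (- (2 * n))" ?e] b
    by (simp add: int_pow_mult[OF a, symmetric] w len_def)
  then have l: "L (2 * n) + len ?e - 2 * T \<le> len (word n)"
    using T(2)[of "- (2 * n)" "3 * n"] L_minus[of "2 * n"]
    by (simp add: gromov_product_def len_def d_sym)
  have "d (pt g) ?p = L (2 * n)" "d ?p (pt (g \<otimes> word n)) = len ?e"
    using d_len[of g "a [^] (2 * n)"] d_len[of "g \<otimes> a [^] (2 * n)" ?e] g b by (simp_all add: w m_assoc)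
  then have "d x ?p + d ?p y \<le> d x y + 3 * W + 2 + 4 * \<delta> + 2 * T"
    using d_triangle[of x ?p "pt g"] d_triangle[of ?p y "pt (g \<otimes> word n)"] l c by linarith
  then have "2 * gp ?p x y \<le> 3 * W + 2 + 4 * \<delta> + 2 * T"
    by (simp add: gromov_product_def d_sym)
  then have p: "gp ?p x y \<le> 3 * W + 2 + 4 * \<delta> + T" using nn \<open>0 \<le> W\<close> by linarith
  have "gp (pt (g \<otimes> a [^] (2 * n) \<otimes> b)) x y \<le> gp ?p x y + len b"
    using gp_perturb0[of "pt (g \<otimes> a [^] (2 * n) \<otimes> b)" x y ?p] d_len[of "g \<otimes> a [^] (2 * n)" b] g b by simp
  then show ?thesis
    using that[OF g c l] g1 p nn by linarith
qed

text \<open>Seen from the origin, a reversed copy begins with a stretch of exponent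
  \<open>3 * n\<close> and continues with one of exponent \<open>2 * n\<close>. The former fits only
  into a piece of exponent \<open>3 * n\<close>; the next piece has exponent \<open>n\<close>, so
  its end is deep inside the latter.\<close>

lemma no_reversed_word:
  assumes nd: "no_deep_vertex B N M" and MB: "2 * B < M" and W: "0 \<le> W"
    and B: "3 * W + 2 + 4 * \<delta> + T + len b \<le> B"
    and n: "0 \<le> n" "long (pattern n)" "int N \<le> n"
    and big: "2 * M + 16 * B + 4 * S \<le> L n" "L n + 2 * M + 16 * B + 4 * S \<le> L (2 * n)"
      "L (2 * n) + 2 * M + 16 * B + 4 * S \<le> L (3 * n)"
  shows "\<not> copy_between (word n) W (X (pattern n) (3 * q)) (pt \<one>)"
proof
  let ?\<nu> = "pattern n"
  let ?K = "3 * q"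
  let ?X = "X ?\<nu>"
  assume "copy_between (word n) W (?X ?K) (pt \<one>)"
  then obtain g where g: "g \<in> carrier G"
    and c: "d (?X ?K) (pt g) + len (word n) + d (pt (g \<otimes> word n)) (pt \<one>) \<le> d (?X ?K) (pt \<one>) + 3 * W + 2 + 4 * \<delta>"
    and l: "L (2 * n) + len (b \<otimes> a [^] (3 * n)) - 2 * T \<le> len (word n)"
    and near0: "gp (pt g) (?X ?K) (pt \<one>) \<le> 3 * W + 2 + 4 * \<delta> + T + len b"
    "gp (pt (g \<otimes> a [^] (2 * n))) (?X ?K) (pt \<one>) \<le> 3 * W + 2 + 4 * \<delta> + T + len b"
    "gp (pt (g \<otimes> a [^] (2 * n) \<otimes> b)) (?X ?K) (pt \<one>) \<le> 3 * W + 2 + 4 * \<delta> + T + len b"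
    "gp (pt (g \<otimes> word n)) (?X ?K) (pt \<one>) \<le> 3 * W + 2 + 4 * \<delta> + T + len b"
    using copy_of_word[OF _ W] by metis
  let ?h = "g \<otimes> a [^] (2 * n) \<otimes> b"
  have h: "?h \<in> carrier G" "g \<otimes> word n = ?h \<otimes> a [^] (3 * n)"
    using g b by (simp_all add: word_def m_assoc)
  \<comment> \<open>The corners of the copy; \<open>p3\<close> turns out to be nearest to the origin
    and \<open>p0\<close> farthest from it.\<close>
  define p0 p1 p2 p3 where "p0 = pt g" and "p1 = pt (g \<otimes> a [^] (2 * n))" and "p2 = pt ?h" and "p3 = pt (?h \<otimes> a [^] (3 * n))"
  have near: "gp p0 (pt \<one>) (?X ?K) \<le> B" "gp p1 (pt \<one>) (?X ?K) \<le> B" "gp p2 (pt \<one>) (?X ?K) \<le> B" "gp p3 (pt \<one>) (?X ?K) \<le> B"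
    using near0 B gp_sym[of _ "?X ?K" "pt \<one>"] h by (auto simp: p0_def p1_def p2_def p3_def)
  have nn: "0 \<le> len b" "0 \<le> T" "0 \<le> \<delta>" "0 \<le> S" "0 \<le> B"
    using len_nonneg[of b] T delta_nonneg S_nonneg B W by auto
  have dist: "d p0 p1 = L (2 * n)" "d p1 p2 = len b" "d p2 p3 = L (3 * n)" "d p1 p3 = len (b \<otimes> a [^] (3 * n))"
    using d_len[of g "a [^] (2 * n)"] d_len[of "g \<otimes> a [^] (2 * n)" b] d_len[of ?h "a [^] (3 * n)"]
      d_len[of "g \<otimes> a [^] (2 * n)" "b \<otimes> a [^] (3 * n)"] g b h
    by (simp_all add: p0_def p1_def p2_def p3_def m_assoc)
  have l3: "L (3 * n) \<le> len (b \<otimes> a [^] (3 * n)) + len b"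
    using d_triangle[of p2 p3 p1] d_sym[of p2 p1] by (simp add: dist)
  have w0: "pos p3 + len (word n) \<le> pos p0 + B"
    using c d_triangle[of "pt \<one>" "?X ?K" p0] B nn h(2) by (simp add: p0_def p3_def d_sym)
  have TB: "2 * T + 2 * len b \<le> 2 * B" "len b \<le> B" using B nn W by linarith+
  have step: "pos p2 \<le> pos p1 + len b" "pos p1 \<le> pos p2 + len b" "pos p2 \<le> pos p3 + L (3 * n)"
    "pos p1 \<le> pos p3 + len (b \<otimes> a [^] (3 * n))" "pos p0 \<le> pos p1 + L (2 * n)"
    using pos_diff(1)[of p2 p1] pos_diff(1)[of p0 p1] pos_diff(1)[of p1 p2] pos_diff(1)[of p2 p3] pos_diff(1)[of p1 p3]
    by (simp_all add: dist d_sym[of p2 p1])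
  have up: "pos p1 + L (2 * n) \<le> pos p0 + 4 * B" using l w0 TB step(4) nn by linarith
  have up': "pos p3 + L (3 * n) \<le> pos p2 + 4 * B" using l w0 TB step l3 nn by linarith
  have order: "pos p1 + L (2 * n) \<le> pos p0 + 4 * B" "pos p3 + L (3 * n) \<le> pos p2 + 4 * B"
    "pos p1 \<le> pos p2 + B" "pos p2 \<le> pos p1 + B" "pos p2 \<le> pos p3 + L (3 * n)" "pos p3 \<le> pos p2" "pos p1 \<le> pos p0"
    using up up' step TB big MB nn by linarith+
  have N: "int N \<le> ?\<nu> k" for k using n by (auto simp: pattern_def)
  have endp: "pos p2 \<le> pos (?X ?K) + 2 * B" "pos p0 \<le> pos (?X ?K) + 2 * B"
    using near by (auto intro: pos_le_end)
  \<comment> \<open>The piece entered by the stretch from \<open>p3\<close> to \<open>p2\<close>; by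
    \<open>low\<close> it extends almost to \<open>p2\<close>.\<close>
  obtain k where k: "k < ?K" "pos (?X k) \<le> pos p3 + M" "pos p3 + M < pos (?X (Suc k))"
    using last_below[of "\<lambda>k. pos (?X k)" "pos p3 + M" ?K] endp order big MB nn d_nonneg[of "pt \<one>" p3] by auto
  have low: "pos p2 - M < pos (?X (Suc k))"
  proof (cases "Suc k = ?K")
    case True
    then show ?thesis using endp MB by simp
  next
    case False
    then show ?thesis
      using no_deep_vertexD[OF nd n(2) N h(1), of "3 * n" ?K k] near k order n(1)
      by (simp add: p2_def p3_def)
  qed
  have "L (2 * n) < L (?\<nu> k)"
    using low k pos_vertex_Suc(1)[OF n(2), of k] order big nn MB B W by linarith
  then have \<nu>k: "k mod 3 = 1"
    using big nn MB by (auto simp: pattern_def split: if_splits)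
  then have next': "?\<nu> k = 3 * n" "?\<nu> (Suc k) = n" "Suc k \<noteq> ?K"
    by (auto simp: pattern_def mod_Suc) presburger
  have "len b \<le> B" using B nn W by linarith
  have high: "pos (?X (Suc k)) \<le> pos p2 + M + 5 * B"
    using pos_vertex_Suc(1)[OF n(2), of k] k order next' \<open>len b \<le> B\<close> by simp
  have x1: "pos (?X (Suc (Suc k))) \<le> pos p0 - M"
    using high pos_vertex_Suc(1)[OF n(2), of "Suc k"] order next' big \<open>len b \<le> B\<close> nn by simp
  have x2: "pos p1 + M \<le> pos (?X (Suc (Suc k)))"
    using low pos_vertex_Suc(2)[OF n(2), of "Suc k"] order next' big \<open>len b \<le> B\<close> nn B W by simp
  have "Suc (Suc k) \<noteq> ?K" using x1 endp MB by auto
  then have "Suc (Suc k) < ?K" using next' k by linarith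
  then have "pos p0 < pos (?X (Suc (Suc k))) + M"
    using no_deep_vertexD[OF nd n(2) N g, of "2 * n" ?K "Suc k"] near x2 order n(1)
    by (simp add: p0_def p1_def)
  then show False using x1 by simp
qed

text \<open>In either direction, the stretch \<open>a [^] (3 * n)\<close> of a copy would be too
  long for \<open>segment_bound\<close>.\<close>

lemma no_long_word:
  assumes nd: "no_deep_vertex B N M" and MB: "2 * B < M" and W: "0 \<le> W"
    and B: "3 * W + 2 + 4 * \<delta> + T + len b \<le> B"
    and \<nu>: "long \<nu>" "\<And>k. int N \<le> \<nu> k" "\<And>k. L (\<nu> k) \<le> \<Lambda>"
    and n: "0 \<le> n" "\<Lambda> + len b + 2 * M + 2 * B + 2 * \<delta> < L (3 * n)"
  shows "\<not> copy_between (word n) W (X \<nu> J) (pt \<one>)" "\<not> copy_between (word n) W (pt \<one>) (X \<nu> J)"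
proof -
  have "0 \<le> B" using B T W delta_nonneg len_nonneg[of b] by linarith
  have *: False if c: "copy_between (word n) W x y" and xy: "{x, y} = {pt \<one>, X \<nu> J}" for x y
  proof -
    obtain g where g: "g \<in> carrier G"
      and "gp (pt (g \<otimes> a [^] (2 * n) \<otimes> b)) x y \<le> 3 * W + 2 + 4 * \<delta> + T + len b"
      "gp (pt (g \<otimes> word n)) x y \<le> 3 * W + 2 + 4 * \<delta> + T + len b"
      using copy_of_word[OF c W] by metis
    moreover have "gp p x y = gp p (pt \<one>) (X \<nu> J)" for p
      using xy gp_sym[of p] by (auto simp: doubleton_eq_iff)
    ultimately have "gp (pt (g \<otimes> a [^] (2 * n) \<otimes> b)) (pt \<one>) (X \<nu> J) \<le> B"
      "gp (pt (g \<otimes> a [^] (2 * n) \<otimes> b \<otimes> a [^] (3 * n))) (pt \<one>) (X \<nu> J) \<le> B"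
      using B b by (auto simp: word_def m_assoc)
    then have "L (3 * n) \<le> \<Lambda> + len b + 2 * M + 2 * B + 2 * \<delta>"
      using segment_bound[OF nd MB \<open>0 \<le> B\<close> \<nu>, of "g \<otimes> a [^] (2 * n) \<otimes> b" "3 * n" J] g b n by simp
    then show False using n by simp
  qed
  show "\<not> copy_between (word n) W (X \<nu> J) (pt \<one>)" "\<not> copy_between (word n) W (pt \<one>) (X \<nu> J)"
    using * by (metis insert_commute)+
qed

text \<open>The chosen exponents are spaced by \<open>n0\<close>, so each word is too long to occur
  along the earlier elements, while reversed copies of it do not occur along its own
  element.\<close>

lemma independent_family:
  "\<exists>h F. (\<forall>j::nat. h j \<in> Qh G \<and> h j (F j) \<noteq> 0 \<and> (\<forall>i<j. h j (F i) = 0) \<and> (\<exists>n. F j = word n \<otimes> rest n))"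
proof -
  \<comment> \<open>One period loses \<open>3 * (len b + 2 * S + 2 * \<delta>)\<close> in
    \<open>len_vertex\<close> and another \<open>3 * len b\<close> in \<open>lw\<close>; the
    discount exceeds this by 1.\<close>
  define W where "W = 6 * len b + 6 * S + 6 * \<delta> + 1"
  define B where "B = 3 * W + 2 + 4 * \<delta> + T + 2 * len b + Q + 2 * S + 4 * \<delta>"
  have nn: "0 \<le> len b" "0 \<le> T" "0 \<le> \<delta>" "0 \<le> S" "0 \<le> Q" "0 \<le> W" "0 \<le> B"
    using len_nonneg[of b] T delta_nonneg S_nonneg Q_nonneg by (auto simp: W_def B_def)
  have B: "3 * W + 2 + 4 * \<delta> + T + len b \<le> B" "Q + len b + 2 * S + 4 * \<delta> \<le> B"
    using nn by (auto simp: B_def)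
  obtain N M where nd: "no_deep_vertex B N M" "2 * B < M"
    using ex_no_deep_vertex[OF B(2)] by blast
  \<comment> \<open>Dominates the gaps required by \<open>long\<close>,
    \<open>no_reversed_word\<close> and \<open>no_long_word\<close>, with room for errors
    \<open>2 * Q\<close>.\<close>
  define Z where "Z = 2 * M + 16 * B + 4 * S + 8 * Q + 4 * \<delta> + 2 * len b + 1"
  obtain n1 :: nat where n1: "\<And>n::int. int n1 \<le> \<bar>n\<bar> \<Longrightarrow> Z \<le> L n"
    using L_unbounded by blast
  define n0 where "n0 = int (max (max n1 N) 1)"
  have n0: "1 \<le> n0" "int N \<le> n0" "int n1 \<le> n0" by (auto simp: n0_def)
  have big: "Z \<le> L n" if "n0 \<le> n" for n using n1[of n] that n0 by linarith
  have grow: "L n + Z - 2 * Q \<le> L m" if "0 \<le> n" "n + n0 \<le> m" for n m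
    using L_superadditive[of n "m - n"] big[of "m - n"] that n0 by simp
  have mono: "L n \<le> L m + 2 * Q" if "0 \<le> n" "n \<le> m" for n m
    using L_superadditive[of n "m - n"] len_nonneg[of "a [^] (m - n)"] that by simp
  have pat: "long (pattern n)" "int N \<le> pattern n k" "L (pattern n k) \<le> L (3 * n) + 2 * Q" if "n0 \<le> n" for n k
  proof -
    have p: "n0 \<le> pattern n i" "pattern n i \<le> 3 * n" for i
      using that n0 by (auto simp: pattern_def)
    have "2 * S + 4 * \<delta> + len b < Z" using nn nd by (simp add: Z_def)
    then show "long (pattern n)"
      unfolding long_def using p(1) big n0 by (meson dual_order.strict_trans1 order_trans zero_le_one)
    show "int N \<le> pattern n k" using p(1)[of k] n0 by linarith
    show "L (pattern n k) \<le> L (3 * n) + 2 * Q" using p[of k] n0 by (intro mono) auto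
  qed
  have qm: "\<exists>h\<in>Qh G. h (word n \<otimes> rest n) \<noteq> 0 \<and> (\<forall>m. n0 \<le> m \<longrightarrow> m + n0 \<le> n \<longrightarrow> h (word m \<otimes> rest m) = 0)"
    if n: "n0 \<le> n" for n
  proof -
    have L2: "L n + Z - 2 * Q \<le> L (2 * n)" and L3: "L (2 * n) + Z - 2 * Q \<le> L (3 * n)"
      using grow[of n "2 * n"] grow[of "2 * n" "3 * n"] n n0 by auto
    have lw: "len (word n) \<le> L (2 * n) + len b + L (3 * n)" "len (rest n) \<le> 2 * len b + L n"
      using len_mult[of "a [^] (2 * n) \<otimes> b" "a [^] (3 * n)"] len_mult[of "a [^] (2 * n)" b]
        len_mult[of "b \<otimes> a [^] n" b] len_mult[of b "a [^] n"] b by (auto simp: word_def rest_def)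
    have "L (3 * n) \<le> len (word n) + L (2 * n) + len b"
    proof -
      have "d (pt (a [^] (2 * n) \<otimes> b)) (pt (word n)) = L (3 * n)"
        using d_len[of "a [^] (2 * n) \<otimes> b" "a [^] (3 * n)"] b by (simp add: word_def)
      then show ?thesis
        using d_triangle[of "pt (a [^] (2 * n) \<otimes> b)" "pt (word n)" "pt \<one>"] len_mult[of "a [^] (2 * n)" b] b
        by (simp add: len_def d_sym)
    qed
    then have wl: "3 * W + 2 + 4 * \<delta> < len (word n)"
      using L3 B nn nd by (simp add: Z_def)
    obtain h where h: "h \<in> Qh G" and
      h0: "\<And>f. f \<in> carrier G \<Longrightarrow> (\<forall>k::nat. \<not> copy_between (word n) W (pt (f [^] k)) (pt \<one>)) \<Longrightarrow>
        (\<forall>k::nat. \<not> copy_between (word n) W (pt \<one>) (pt (f [^] k))) \<Longrightarrow> h f = 0" and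
      h1: "\<And>f u \<eta>. f \<in> carrier G \<Longrightarrow> (\<forall>k::nat. \<not> copy_between (word n) W (pt (f [^] k)) (pt \<one>)) \<Longrightarrow>
        u \<in> carrier G \<Longrightarrow> \<eta> > 0 \<Longrightarrow> f = word n \<otimes> u \<Longrightarrow>
        (\<forall>k::nat. real k * (len (word n) + len u - W + \<eta>) \<le> len (f [^] k)) \<Longrightarrow> h f \<noteq> 0"
      using jump_quasimorphism[OF word_closed(1) nn(6) wl] by (elim bexE) blast
    have "h (word n \<otimes> rest n) \<noteq> 0"
    proof (rule h1[of _ "rest n" 1])
      show "\<forall>k::nat. \<not> copy_between (word n) W (pt ((word n \<otimes> rest n) [^] k)) (pt \<one>)"
        using no_reversed_word[OF nd nn(6) B(1) _ pat(1)[OF n]] n n0 L2 L3 big[OF n] nn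
        unfolding vertex_pattern[symmetric] by (simp add: Z_def)
      show "\<forall>k::nat. real k * (len (word n) + len (rest n) - W + 1) \<le> len ((word n \<otimes> rest n) [^] k)"
      proof
        fix k :: nat
        let ?c = "len b + 2 * S + 2 * \<delta>"
        have "real k * (len (word n) + len (rest n) - W + 1) \<le> real k * (L (2 * n) + L (3 * n) + L n - 3 * ?c)"
          using lw by (intro mult_left_mono) (auto simp: W_def)
        also have "\<dots> = (\<Sum>i<3 * k. L (pattern n i) - len b - 2 * S - 2 * \<delta>)"
        proof -
          have "pattern n (3 * i) = 2 * n" "pattern n (3 * i + 1) = 3 * n" "pattern n (3 * i + 2) = n" for i
            unfolding pattern_def by presburger+
          then show ?thesis
            unfolding sum_lessThan_3_mult by (simp only:) (simp add: algebra_simps)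
        qed
        also have "\<dots> \<le> len (vertex (pattern n) (3 * k))"
          by (rule len_vertex[OF pat(1)[OF n]])
        finally show "real k * (len (word n) + len (rest n) - W + 1) \<le> len ((word n \<otimes> rest n) [^] k)"
          by (simp only: vertex_pattern)
      qed
    qed auto
    moreover have "h (word m \<otimes> rest m) = 0" if m: "n0 \<le> m" "m + n0 \<le> n" for m
    proof (rule h0)
      have "L (3 * m) + Z - 2 * Q \<le> L (3 * n)"
        using grow[of "3 * m" "3 * n"] m n0 by simp
      then have "L (3 * m) + 2 * Q + len b + 2 * M + 2 * B + 2 * \<delta> < L (3 * n)"
        using nn nd by (simp add: Z_def)
      then have "\<not> copy_between (word n) W (X (pattern m) (3 * k)) (pt \<one>)"
        "\<not> copy_between (word n) W (pt \<one>) (X (pattern m) (3 * k))" for k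
        using no_long_word[OF nd nn(6) B(1) pat[OF m(1)], of n "3 * k"] n n0 by auto
      then show "\<forall>k::nat. \<not> copy_between (word n) W (pt ((word m \<otimes> rest m) [^] k)) (pt \<one>)"
        "\<forall>k::nat. \<not> copy_between (word n) W (pt \<one>) (pt ((word m \<otimes> rest m) [^] k))"
        by (simp_all only: vertex_pattern[symmetric] simp_thms)
    qed simp
    ultimately show ?thesis using h by blast
  qed
  define \<nu> where "\<nu> = (\<lambda>j::nat. n0 * (int j + 1))"
  have \<nu>: "n0 \<le> \<nu> j" for j using n0 by (simp add: \<nu>_def)
  have \<nu>lt: "\<nu> i + n0 \<le> \<nu> j" if "i < j" for i j
  proof -
    have "n0 * (int i + 1 + 1) \<le> n0 * (int j + 1)" using n0 that by (intro mult_left_mono) auto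
    then show ?thesis by (simp add: \<nu>_def algebra_simps)
  qed
  obtain h where "\<And>j. h j \<in> Qh G \<and> h j (word (\<nu> j) \<otimes> rest (\<nu> j)) \<noteq> 0 \<and>
      (\<forall>m. n0 \<le> m \<longrightarrow> m + n0 \<le> \<nu> j \<longrightarrow> h j (word m \<otimes> rest m) = 0)"
    using qm[OF \<nu>] by metis
  then show ?thesis
    using \<nu> \<nu>lt by (intro exI[of _ h] exI[of _ "\<lambda>j. word (\<nu> j) \<otimes> rest (\<nu> j)"]) blast
qed

end

section \<open>Reversing elements, linear algebra and the path metric\<close>

context axis begin

text \<open>Some power \<open>a [^] p\<close> commutes with \<open>c\<close>, so only the remainder
  of \<open>k\<close> modulo \<open>p\<close> matters.\<close>

lemma intertwines_one_bounded:
  assumes c: "c \<in> carrier G" "intertwines c 1"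
  shows "\<exists>R. \<forall>k::int. d (pt (c \<otimes> a [^] k)) (P k) \<le> R"
proof -
  obtain p :: int where p: "p > 0" "c \<otimes> a [^] p = a [^] p \<otimes> c"
    using c by (auto simp: intertwines_def)
  have "d (pt (c \<otimes> a [^] k)) (P k) \<le> len c + 2 * (real_of_int p * len a)" for k
  proof -
    define x r where "x = (a [^] p) [^] (k div p)" and "r = k mod p"
    have x: "x \<in> carrier G" by (simp add: x_def)
    have k: "a [^] k = x \<otimes> a [^] r"
      unfolding x_def r_def int_pow_pow[OF a] int_pow_mult[OF a, symmetric] by simp
    have "c \<otimes> x = x \<otimes> c"
      unfolding x_def by (rule pow_commutation) (use c p in auto)
    then have "c \<otimes> a [^] k = x \<otimes> (c \<otimes> a [^] r)"
      unfolding k using c x by (simp add: m_assoc[symmetric])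
    then have "d (pt (c \<otimes> a [^] k)) (P k) = d (pt (c \<otimes> a [^] r)) (P r)"
      using pt_invariant[of x "c \<otimes> a [^] r" "a [^] r"] c x by (simp add: k)
    also have "\<dots> \<le> d (pt (c \<otimes> a [^] r)) (pt c) + (d (pt c) (pt \<one>) + d (pt \<one>) (P r))"
      using d_triangle[of "pt (c \<otimes> a [^] r)" "P r" "pt c"] d_triangle[of "pt c" "P r" "pt \<one>"] by linarith
    also have "\<dots> = len c + 2 * L r"
      using d_len[of c "a [^] r"] c by (simp add: len_def d_sym)
    also have "L r \<le> real_of_int p * len a"
    proof -
      have "\<bar>r\<bar> \<le> p" using p pos_mod_bound[of p k] pos_mod_sign[of p k] unfolding r_def by linarith
      then have "real_of_int \<bar>r\<bar> * len a \<le> real_of_int p * len a"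
        by (intro mult_right_mono len_nonneg) simp
      then show ?thesis using L_le[of r] by linarith
    qed
    finally show ?thesis by simp
  qed
  then show ?thesis by blast
qed

text \<open>The odd powers of an element reversing the axis all have a base point image near the axis, so
  their squares move the base point by a bounded amount.\<close>

lemma undistorted_not_reversing:
  assumes e: "e \<in> carrier G" "undistorted e"
  shows "\<not> intertwines e (- 1)"
proof
  assume "intertwines e (- 1)"
  then obtain p :: int where p: "p > 0" "e \<otimes> a [^] p = a [^] (- p) \<otimes> e"
    by (auto simp: intertwines_def)
  then have p': "e \<otimes> a [^] (- p) = a [^] p \<otimes> e"
    using inv_commutation[of e "a [^] p" "a [^] (- p)"] e a by (simp add: int_pow_neg)
  have odd: "e [^] Suc (2 * j) \<otimes> a [^] p = a [^] (- p) \<otimes> e [^] Suc (2 * j)" for j :: nat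
  proof (induction j)
    case (Suc j)
    let ?y = "e [^] Suc (2 * j)"
    have "e [^] Suc (2 * Suc j) \<otimes> a [^] p = ?y \<otimes> e \<otimes> (e \<otimes> a [^] p)"
      using e by (simp add: m_assoc)
    also have "\<dots> = ?y \<otimes> (e \<otimes> a [^] (- p)) \<otimes> e"
      unfolding p(2) using e by (simp add: m_assoc)
    also have "\<dots> = (?y \<otimes> a [^] p) \<otimes> e \<otimes> e"
      unfolding p' using e by (simp add: m_assoc)
    also have "\<dots> = a [^] (- p) \<otimes> e [^] Suc (2 * Suc j)"
      unfolding Suc using e by (simp add: m_assoc)
    finally show ?case .
  qed (use e p in simp)
  define B where "B = 2 * (Q + 2 * \<delta>) + 2 * \<delta> + len a"
  have square: "len (y \<otimes> y) \<le> 2 * B + 2 * (real_of_int p * len a)"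
    if y: "y \<in> carrier G" and yp: "y \<otimes> a [^] p = a [^] (- p) \<otimes> y" for y
  proof -
    have comm: "y \<otimes> a [^] (p * m) = a [^] (- (p * m)) \<otimes> y" for m
      using pow_commutation[OF y _ _ yp, of m] by (simp add: int_pow_pow[OF a])
    obtain M :: nat where M: "\<And>n::int. int M \<le> \<bar>n\<bar> \<Longrightarrow> Q + 2 * \<delta> + len y + 1 \<le> L n"
      using L_unbounded by blast
    define m where "m = p * int M"
    have Mp: "int M \<le> m" "0 \<le> m" using p mult_right_mono[of 1 p "int M"] by (auto simp: m_def)
    \<comment> \<open>As \<open>y\<close> turns the axis around, \<open>?u\<close> is near
      \<open>P m\<close> and \<open>?v\<close> is near \<open>P (- m)\<close>; for large
      \<open>m\<close> the point \<open>pt y\<close> between them must be close to the axis.\<close>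
    let ?u = "pt (y \<otimes> a [^] (- m))" and ?v = "pt (y \<otimes> a [^] m)"
    have uv: "d ?u (P m) = len y" "d ?v (P (- m)) = len y"
      using comm[of "- int M"] comm[of "int M"] d_len[of "a [^] m" y] d_len[of "a [^] (- m)" y] y
      by (simp_all add: m_def d_sym)
    have far: "d ?u (pt y) \<ge> Q + 2 * \<delta> + len y + 1" "d ?v (pt y) \<ge> Q + 2 * \<delta> + len y + 1"
      using d_len[of y "a [^] (- m)"] d_len[of y "a [^] m"] M[of m] Mp y by (simp_all add: d_sym L_minus)
    have "gp (pt y) ?u ?v \<le> Q"
      using gp_invariant[of y "a [^] (0::int)" "a [^] (- m)" "a [^] m"] quasi_geodesic[of "- m" 0 m] y Mp by simp
    moreover have "gp (pt y) ?u (P m) > Q + 2 * \<delta>" "gp (pt y) (P (- m)) ?v > Q + 2 * \<delta>"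
      using far uv d_triangle[of ?u "pt y" "P m"] d_triangle[of ?v "pt y" "P (- m)"]
      by (simp_all add: gromov_product_def d_sym field_simps)
    ultimately have "gp (pt y) (P m) (P (- m)) \<le> Q + 2 * \<delta>"
      using hyperbolic[of "pt y" ?u "P m" ?v] hyperbolic[of "pt y" "P m" "P (- m)" ?v] delta_nonneg
      by (simp add: min_def split: if_splits)
    then obtain j where j: "d (pt y) (P j) \<le> B"
      using near_axis[of "Q + 2 * \<delta>" "- m" m "pt y"] gp_sym[of "pt y" "P m"] delta_nonneg Mp by (auto simp: B_def)
    \<comment> \<open>Reducing \<open>j\<close> modulo \<open>p\<close> links
      \<open>y \<otimes> y\<close> to the identity through \<open>y \<otimes> a [^] j\<close>,
      \<open>?g \<otimes> y\<close> and \<open>a [^] ?r\<close>, with bounds independent of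
      \<open>y\<close>.\<close>
    let ?q = "j div p" and ?r = "j mod p"
    let ?g = "a [^] (- (p * ?q))"
    have jr: "a [^] j = a [^] (p * ?q) \<otimes> a [^] ?r" "?g \<otimes> a [^] j = a [^] ?r"
      by (simp_all add: int_pow_mult[OF a, symmetric] minus_mult_div_eq_mod)
    have "y \<otimes> a [^] j = ?g \<otimes> y \<otimes> a [^] ?r"
      unfolding jr(1) using comm[of ?q] y by (simp add: m_assoc[symmetric])
    then have "d (pt (y \<otimes> a [^] j)) (pt (?g \<otimes> y)) = L ?r"
      using d_len[of "?g \<otimes> y" "a [^] ?r"] y by (simp add: d_sym)
    moreover have "d (pt (y \<otimes> y)) (pt (y \<otimes> a [^] j)) \<le> B" "d (pt (?g \<otimes> y)) (P ?r) \<le> B"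
      using pt_invariant[of y y "a [^] j"] pt_invariant[of ?g y "a [^] j"] jr y j by simp_all
    moreover have "L ?r \<le> real_of_int p * len a"
    proof -
      have "\<bar>?r\<bar> \<le> p" using p pos_mod_bound[of p j] pos_mod_sign[of p j] by linarith
      then have "real_of_int \<bar>?r\<bar> * len a \<le> real_of_int p * len a"
        by (intro mult_right_mono len_nonneg) simp
      then show ?thesis using L_le[of ?r] by linarith
    qed
    moreover have "d (P ?r) (pt \<one>) = L ?r" by (simp add: len_def d_sym)
    ultimately show ?thesis
      using d_triangle[of "pt (y \<otimes> y)" "pt \<one>" "pt (y \<otimes> a [^] j)"] d_triangle[of "pt (y \<otimes> a [^] j)" "pt \<one>" "pt (?g \<otimes> y)"]
        d_triangle[of "pt (?g \<otimes> y)" "pt \<one>" "P ?r"] d_sym[of "pt (y \<otimes> y)" "pt \<one>"]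
      by (simp add: len_def)
  qed
  obtain K' C' where KC': "K' > 0" and grow: "\<And>n::int. real_of_int \<bar>n\<bar> / K' - C' \<le> len (e [^] n)"
    using e by (auto simp: undistorted_def)
  define R where "R = 2 * B + 2 * (real_of_int p * len a)"
  \<comment> \<open>For such \<open>j\<close> the square of the odd power would be longer than
    \<open>R\<close>.\<close>
  obtain j :: nat where j: "K' * (R + C') < real j" using reals_Archimedean2 by blast
  let ?y = "e [^] Suc (2 * j)"
  have "len (?y \<otimes> ?y) \<le> R" using square[OF _ odd] e by (simp add: R_def)
  moreover have "?y \<otimes> ?y = e [^] int (2 * Suc (2 * j))"
    unfolding int_pow_int mult_2 by (rule nat_pow_mult[OF e(1)])
  ultimately have "real (2 * Suc (2 * j)) / K' \<le> R + C'"
    using grow[of "int (2 * Suc (2 * j))"] by simp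
  then have "real (2 * Suc (2 * j)) \<le> K' * (R + C')"
    using KC' by (simp add: pos_divide_le_eq mult.commute)
  then show False using j by simp
qed

end

text \<open>All functions with index above \<open>i\<close> vanish at \<open>F i\<close>, but
  \<open>k i\<close> does not; hence adding the functions in descending order of index preserves
  independence.\<close>

lemma infinite_dimensionalI:
  fixes k :: "nat \<Rightarrow> 'g \<Rightarrow> real"
  assumes k: "\<And>j. k j \<in> W" "\<And>j. k j (F j) \<noteq> 0" "\<And>i j. i < j \<Longrightarrow> k j (F i) = 0"
  shows "infinite_dimensional W"
  unfolding infinite_dimensional_def
proof
  assume "\<exists>B. finite B \<and> B \<subseteq> W \<and> W \<subseteq> real_fun.span B"
  then obtain B where B: "finite B" "W \<subseteq> real_fun.span B" by blast
  have "real_fun.independent (k ` {n - m..<n}) \<and> card (k ` {n - m..<n}) = m" if "m \<le> n" for m n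
    using that
  proof (induction m)
    case 0
    then show ?case using real_fun.independent_empty by simp
  next
    case (Suc m)
    define i where "i = n - Suc m"
    have i: "{n - Suc m..<n} = insert i {n - m..<n}"
      using Suc.prems by (auto simp: i_def)
    have "real_fun.subspace {x :: 'g \<Rightarrow> real. x (F i) = 0}"
      by (rule real_fun.subspaceI) auto
    moreover have "k ` {n - m..<n} \<subseteq> {x. x (F i) = 0}"
      using k(3) Suc.prems by (auto simp: i_def)
    ultimately have "real_fun.span (k ` {n - m..<n}) \<subseteq> {x. x (F i) = 0}"
      by (intro real_fun.span_minimal)
    then have "k i \<notin> real_fun.span (k ` {n - m..<n})" using k(2)[of i] by auto
    moreover then have "k i \<notin> k ` {n - m..<n}" using real_fun.span_base by blast
    ultimately show ?case
      unfolding i using Suc by (simp add: real_fun.independent_insert)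
  qed
  from this[of "Suc (card B)" "Suc (card B)"]
  have "real_fun.independent (k ` {0..<Suc (card B)})" "card (k ` {0..<Suc (card B)}) = Suc (card B)"
    by auto
  moreover have "k ` {0..<Suc (card B)} \<subseteq> real_fun.span B" using k(1) B by blast
  ultimately show False
    using real_fun.independent_span_bound[OF B(1)] by fastforce
qed

section \<open>The path metric of a connected graph\<close>

context
  fixes V :: "'v set" and E :: "('v \<times> 'v) set"
  assumes conn: "connected_graph V E"
begin

private lemma graph_relpow: "x \<in> V \<Longrightarrow> y \<in> V \<Longrightarrow> \<exists>n. (x, y) \<in> E ^^ n"
  using conn rtrancl_imp_relpow unfolding connected_graph_def by metis

lemma graph_dist_le: "(x, y) \<in> E ^^ n \<Longrightarrow> graph_dist E x y \<le> real n"
  unfolding graph_dist_def by (simp add: Least_le)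

lemma graph_dist_attained:
  assumes "x \<in> V" "y \<in> V"
  obtains n where "(x, y) \<in> E ^^ n" "graph_dist E x y = real n"
  using graph_relpow[OF assms] LeastI_ex[of "\<lambda>n. (x, y) \<in> E ^^ n"] by (auto simp: graph_dist_def)

lemma graph_dist_self: "graph_dist E x x = 0"
  using graph_dist_le[of x x 0] by (simp add: graph_dist_def)

lemma graph_dist_sym: "graph_dist E x y = graph_dist E y x"
proof -
  have "(x, y) \<in> E ^^ n \<Longrightarrow> (y, x) \<in> E ^^ n" for x y n
  proof (induction n arbitrary: y)
    case (Suc n)
    then obtain z where "(x, z) \<in> E ^^ n" "(z, y) \<in> E" by auto
    then have "(z, x) \<in> E ^^ n" "(y, z) \<in> E"
      using Suc.IH conn by (auto simp: connected_graph_def dest: symD)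
    then show ?case by (intro relpow_Suc_I2)
  qed simp
  then have "(x, y) \<in> E ^^ n \<longleftrightarrow> (y, x) \<in> E ^^ n" for n by blast
  then show ?thesis by (simp add: graph_dist_def)
qed

lemma graph_dist_triangle:
  assumes "x \<in> V" "y \<in> V" "z \<in> V"
  shows "graph_dist E x z \<le> graph_dist E x y + graph_dist E y z"
proof -
  obtain m n where "(x, y) \<in> E ^^ m" "graph_dist E x y = real m" "(y, z) \<in> E ^^ n" "graph_dist E y z = real n"
    using assms graph_dist_attained by metis
  moreover then have "(x, z) \<in> E ^^ (m + n)" by (auto simp: relpow_add)
  ultimately show ?thesis using graph_dist_le by fastforce
qed

text \<open>A shortest path is cut after \<open>k\<close> steps; the triangle inequality shows that
  both parts are shortest.\<close>

lemma graph_dist_between: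
  assumes xy: "x \<in> V" "y \<in> V" and k: "real k \<le> graph_dist E x y"
  shows "\<exists>c\<in>V. graph_dist E x c = real k \<and> graph_dist E c y = graph_dist E x y - real k"
proof -
  obtain n where n: "(x, y) \<in> E ^^ n" "graph_dist E x y = real n"
    using graph_dist_attained[OF xy] by blast
  have "n = k + (n - k)" using k n by simp
  then have "(x, y) \<in> E ^^ k O E ^^ (n - k)" using n relpow_add by metis
  then obtain c where c: "(x, c) \<in> E ^^ k" "(c, y) \<in> E ^^ (n - k)" by blast
  have "c \<in> V"
    using c(1) xy conn by (cases k) (auto simp: connected_graph_def)
  then have "graph_dist E x y \<le> graph_dist E x c + graph_dist E c y"
    using graph_dist_triangle xy by blast
  moreover have "graph_dist E x c \<le> real k" "graph_dist E c y \<le> real n - real k"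
    using graph_dist_le[OF c(1)] graph_dist_le[OF c(2)] k n by auto
  ultimately have "graph_dist E x c = real k \<and> graph_dist E c y = graph_dist E x y - real k"
    using n by linarith
  then show ?thesis using \<open>c \<in> V\<close> by blast
qed

end

section \<open>Actions on graphs\<close>

locale graph_action =
  fixes G :: "('g, 'b) monoid_scheme" (structure)
    and V :: "'v set" and E :: "('v \<times> 'v) set" and \<phi> :: "'g \<Rightarrow> 'v \<Rightarrow> 'v" and x\<^sub>0 :: 'v and \<delta> :: real
  assumes conn: "connected_graph V E"
    and delta: "0 \<le> \<delta>" "\<And>p x y z. p \<in> V \<Longrightarrow> x \<in> V \<Longrightarrow> y \<in> V \<Longrightarrow> z \<in> V \<Longrightarrow>
        gromov_product (graph_dist E) p x z \<ge>
          min (gromov_product (graph_dist E) p x y) (gromov_product (graph_dist E) p y z) - \<delta>"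
    and acts: "acts_by_isometries G V (graph_dist E) \<phi>"
    and x0: "x\<^sub>0 \<in> V"
begin

text \<open>Collapsing the complement of \<open>V\<close> to the base point makes the path metric total.\<close>

definition ret :: "'v \<Rightarrow> 'v" where "ret x = (if x \<in> V then x else x\<^sub>0)"

definition pdist :: "'v \<Rightarrow> 'v \<Rightarrow> real" where "pdist x y = graph_dist E (ret x) (ret y)"

lemma ret_in [simp]: "ret x \<in> V"
  using x0 by (simp add: ret_def)

lemma pdist_V: "x \<in> V \<Longrightarrow> y \<in> V \<Longrightarrow> pdist x y = graph_dist E x y"
  by (simp add: pdist_def ret_def)

lemma gromov_product_pdist: "gromov_product pdist p x y = gromov_product (graph_dist E) (ret p) (ret x) (ret y)"
  by (simp add: gromov_product_def pdist_def)

sublocale group_action G V \<phi>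
  using acts by (simp add: acts_by_isometries_def)

lemma group_G: "group G"
  using group_hom by (simp add: group_hom_def)

lemma action_in [simp]: "g \<in> carrier G \<Longrightarrow> x \<in> V \<Longrightarrow> \<phi> g x \<in> V"
  using element_image by blast

lemma action_isometry: "g \<in> carrier G \<Longrightarrow> x \<in> V \<Longrightarrow> y \<in> V \<Longrightarrow> pdist (\<phi> g x) (\<phi> g y) = pdist x y"
  using acts by (simp add: acts_by_isometries_def pdist_V)

lemma hyp_metric_pdist: "hyp_metric pdist \<delta>"
proof
  show "pdist x z \<le> pdist x y + pdist y z" for x y z
    unfolding pdist_def by (rule graph_dist_triangle[OF conn]) auto
  show "min (gromov_product pdist p x y) (gromov_product pdist p y z) - \<delta> \<le> gromov_product pdist p x z" for p x y z
    unfolding gromov_product_pdist by (rule delta) auto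
  show "pdist x y = pdist y x" for x y
    unfolding pdist_def by (rule graph_dist_sym[OF conn])
qed (auto simp: pdist_def graph_dist_self[OF conn] delta)

text \<open>On a shortest path from \<open>x\<close> to \<open>y\<close>, take the vertex whose
  distance from \<open>x\<close> is the Gromov product there, rounded down; the four-point condition
  bounds its distance from \<open>z\<close>.\<close>

lemma tripod_centre:
  "\<exists>c. gromov_product pdist c x y \<le> 1 + 2 * \<delta> \<and> gromov_product pdist c y z \<le> 1 + 2 * \<delta> \<and> gromov_product pdist c x z \<le> 1 + 2 * \<delta>"
proof -
  interpret hyp_metric pdist \<delta> by (rule hyp_metric_pdist)
  define t where "t = gp x y z"
  have t: "0 \<le> t" "t \<le> pdist x y"
    using gp_nonneg[of x y z] gp_le_dist[of x y z] d_sym[of x y] by (auto simp: t_def)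
  define k where "k = nat \<lfloor>t\<rfloor>"
  have k: "real k \<le> t" "t \<le> real k + 1"
    using t by (simp_all add: k_def)
  then obtain c where "c \<in> V" "graph_dist E (ret x) c = real k" "graph_dist E c (ret y) = pdist x y - real k"
    using graph_dist_between[OF conn, of "ret x" "ret y" k] t by (auto simp: pdist_def)
  then have c: "pdist x c = real k" "pdist c y = pdist x y - real k"
    by (auto simp: pdist_def ret_def)
  have t2: "2 * t = pdist x y + pdist x z - pdist y z"
    by (simp add: t_def gromov_product_def d_sym)
  have "pdist z c + pdist x y \<le> pdist z x + pdist c y + 2 * \<delta> \<or> pdist z c + pdist x y \<le> pdist z y + pdist c x + 2 * \<delta>"
    by (rule four_point)
  then have zc: "2 * pdist z c \<le> pdist x z + pdist y z - pdist x y + 2 + 4 * \<delta>"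
    using k t2 c d_sym[of z x] d_sym[of z y] d_sym[of c x] by linarith
  have "2 * gp c x y = 0" "2 * gp c y z = pdist x y - real k + pdist z c - pdist y z" "2 * gp c x z = real k + pdist z c - pdist x z"
    using c d_sym[of y c] by (simp_all add: gromov_product_def)
  then show ?thesis
    using k t2 zc delta(1) by (intro exI[of _ c]) linarith
qed

sublocale hyp_group pdist \<delta> G "\<lambda>g. \<phi> g x\<^sub>0" "1 + 2 * \<delta>"
proof -
  interpret group G by (rule group_G)
  interpret hyp_metric pdist \<delta> by (rule hyp_metric_pdist)
  show "hyp_group pdist \<delta> G (\<lambda>g. \<phi> g x\<^sub>0) (1 + 2 * \<delta>)"
  proof
    show "pdist (\<phi> (g \<otimes> h) x\<^sub>0) (\<phi> (g \<otimes> k) x\<^sub>0) = pdist (\<phi> h x\<^sub>0) (\<phi> k x\<^sub>0)"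
      if "g \<in> carrier G" "h \<in> carrier G" "k \<in> carrier G" for g h k
      using that x0 by (simp add: composition_rule action_isometry)
  qed (rule tripod_centre)
qed

lemma base_fixed [simp]: "\<phi> \<one> x\<^sub>0 = x\<^sub>0"
  using id_eq_one x0 by (metis restrict_apply')

lemma loxodromic_growth:
  assumes "f \<in> carrier G" "loxodromic G V (graph_dist E) \<phi> f"
  shows "\<exists>K>0. \<exists>C\<ge>0. \<forall>n::int. real_of_int \<bar>n\<bar> / K - C \<le> len (f [^] n)"
proof -
  obtain K C where "K \<ge> 1" "C \<ge> 0" and
    *: "\<And>m n::int. real_of_int \<bar>m - n\<bar> / K - C \<le> graph_dist E (\<phi> (f [^] m) x\<^sub>0) (\<phi> (f [^] n) x\<^sub>0)"
    using assms(2) x0 unfolding loxodromic_def quasi_isometric_embedding_def by blast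
  have "real_of_int \<bar>n\<bar> / K - C \<le> len (f [^] n)" for n :: int
    using *[of 0 n] x0 assms(1) by (simp add: len_def pdist_V)
  then show ?thesis
    using \<open>K \<ge> 1\<close> \<open>C \<ge> 0\<close> by (intro exI[of _ K]) auto
qed

lemma loxodromic_undistorted:
  "f \<in> carrier G \<Longrightarrow> loxodromic G V (graph_dist E) \<phi> f \<Longrightarrow> undistorted f"
  unfolding undistorted_def by (rule loxodromic_growth)

lemma loxodromic_axis:
  assumes f: "f \<in> carrier G" "loxodromic G V (graph_dist E) \<phi> f" and wpd: "WPD_action G V (graph_dist E) \<phi>"
  shows "\<exists>Q K C. axis pdist \<delta> G (\<lambda>g. \<phi> g x\<^sub>0) (1 + 2 * \<delta>) f Q K C"
proof -
  obtain Q where Q: "0 \<le> Q" "\<And>i j k::int. i \<le> j \<Longrightarrow> j \<le> k \<Longrightarrow> gp (\<phi> (f [^] j) x\<^sub>0) (\<phi> (f [^] i) x\<^sub>0) (\<phi> (f [^] k) x\<^sub>0) \<le> Q"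
    using undistorted_quasi_geodesic[OF f(1) loxodromic_undistorted[OF f]] by blast
  obtain K C where KC: "0 < K" "0 \<le> C" "\<And>n::int. real_of_int \<bar>n\<bar> / K - C \<le> pdist (\<phi> \<one> x\<^sub>0) (\<phi> (f [^] n) x\<^sub>0)"
    using loxodromic_growth[OF f] unfolding len_def by blast
  have "\<exists>n::nat. finite {g \<in> carrier G. pdist (\<phi> \<one> x\<^sub>0) (\<phi> g x\<^sub>0) \<le> R \<and> pdist (\<phi> (f [^] n) x\<^sub>0) (\<phi> (g \<otimes> f [^] n) x\<^sub>0) \<le> R}"
    if R: "0 \<le> R" for R
  proof -
    have "WPD_element G V (graph_dist E) \<phi> f" using wpd f by (simp add: WPD_action_def)
    then obtain n :: nat where n: "finite {g \<in> carrier G. graph_dist E x\<^sub>0 (\<phi> g x\<^sub>0) \<le> R \<and>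
                  graph_dist E (\<phi> (f [^] n) x\<^sub>0) (\<phi> g (\<phi> (f [^] n) x\<^sub>0)) \<le> R}"
      unfolding WPD_element_def using R x0 by meson
    have "{g \<in> carrier G. pdist (\<phi> \<one> x\<^sub>0) (\<phi> g x\<^sub>0) \<le> R \<and> pdist (\<phi> (f [^] n) x\<^sub>0) (\<phi> (g \<otimes> f [^] n) x\<^sub>0) \<le> R} =
        {g \<in> carrier G. graph_dist E x\<^sub>0 (\<phi> g x\<^sub>0) \<le> R \<and> graph_dist E (\<phi> (f [^] n) x\<^sub>0) (\<phi> g (\<phi> (f [^] n) x\<^sub>0)) \<le> R}"
      using f(1) x0 by (auto simp: pdist_V composition_rule)
    with n show ?thesis by (intro exI[of _ n]) simp
  qed
  then have "axis pdist \<delta> G (\<lambda>g. \<phi> g x\<^sub>0) (1 + 2 * \<delta>) f Q K C"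
    by (intro axis.intro axis_axioms.intro hyp_group_axioms f(1) Q KC)
  then show ?thesis by blast
qed

section \<open>Common fixed points on the Gromov boundary\<close>

lemma asymptotic_iff:
  assumes "range s \<subseteq> V" "range t \<subseteq> V"
  shows "asymptotic V (graph_dist E) s t \<longleftrightarrow> (\<forall>Z. \<exists>N. \<forall>i\<ge>N. \<forall>j\<ge>N. Z \<le> gp x\<^sub>0 (s i) (t j))"
proof -
  have gpV: "gromov_product (graph_dist E) p (s i) (t j) = gp p (s i) (t j)" if "p \<in> V" for p i j
    using that assms by (auto simp: gromov_product_def pdist_V range_subsetD)
  have "asymptotic V (graph_dist E) s t \<longleftrightarrow> (\<forall>p\<in>V. \<forall>Z. \<exists>N. \<forall>i\<ge>N. \<forall>j\<ge>N. Z \<le> gp p (s i) (t j))"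
    unfolding asymptotic_def filterlim_at_top eventually_prod_sequentially
    using gpV by (simp add: Ball_def) blast
  also have "\<dots> \<longleftrightarrow> (\<forall>Z. \<exists>N. \<forall>i\<ge>N. \<forall>j\<ge>N. Z \<le> gp x\<^sub>0 (s i) (t j))" (is "?l \<longleftrightarrow> ?r")
  proof
    assume r: ?r
    show ?l
    proof (intro ballI allI)
      fix p Z assume "p \<in> V"
      obtain N where "\<forall>i\<ge>N. \<forall>j\<ge>N. Z + pdist p x\<^sub>0 \<le> gp x\<^sub>0 (s i) (t j)" using r by blast
      then have "\<forall>i\<ge>N. \<forall>j\<ge>N. Z \<le> gp p (s i) (t j)"
        using gp_perturb0[of x\<^sub>0 _ _ p] by (smt (verit))
      then show "\<exists>N. \<forall>i\<ge>N. \<forall>j\<ge>N. Z \<le> gp p (s i) (t j)" by blast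
    qed
  qed (use x0 in blast)
  finally show ?thesis .
qed

text \<open>Moving \<open>s\<close> by a bounded amount keeps it asymptotic to itself, so
  \<open>c\<close> maps the class of \<open>s\<close> into itself; the inverse of \<open>c\<close>
  does too, which gives equality.\<close>

lemma boundary_fixed:
  assumes c: "c \<in> carrier G" and s: "s \<in> sequences_to_infinity V (graph_dist E)"
    and near: "\<And>k. pdist (\<phi> c (s k)) (s k) \<le> R"
  shows "{t \<in> sequences_to_infinity V (graph_dist E). asymptotic V (graph_dist E) s t}
      \<in> boundary_fixed_points V (graph_dist E) (\<phi> c)" (is "?\<xi> \<in> _")
proof -
  interpret group G by (rule group_G)
  have sV: "range s \<subseteq> V" and ss: "asymptotic V (graph_dist E) s s"
    using s by (auto simp: sequences_to_infinity_def)
  let ?r = "{(s, t). s \<in> sequences_to_infinity V (graph_dist E) \<and> t \<in> sequences_to_infinity V (graph_dist E) \<and>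
      asymptotic V (graph_dist E) s t}"
  have "?\<xi> = ?r `` {s}"
    using s by auto
  moreover have "?r `` {s} \<in> gromov_boundary V (graph_dist E)"
    unfolding gromov_boundary_def by (rule quotientI[OF s])
  ultimately have "?\<xi> \<in> gromov_boundary V (graph_dist E)"
    by (simp only:)
  \<comment> \<open>Stated for an arbitrary \<open>g\<close>, to be applied to both \<open>c\<close>
    and \<open>inv c\<close>.\<close>
  moreover have move: "\<phi> g \<circ> t \<in> ?\<xi>"
    if g: "g \<in> carrier G" and gs: "\<And>k. pdist (\<phi> g (s k)) (s k) \<le> R" and t: "t \<in> ?\<xi>" for g t
  proof -
    have tV: "range t \<subseteq> V" and tt: "asymptotic V (graph_dist E) t t" and st: "asymptotic V (graph_dist E) s t"
      using t by (auto simp: sequences_to_infinity_def)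
    have inV: "s k \<in> V" "t k \<in> V" for k using sV tV by auto
    have gtV: "range (\<phi> g \<circ> t) \<subseteq> V" using inV g by auto
    have iso: "gp (\<phi> g x\<^sub>0) (\<phi> g x) (\<phi> g y) = gp x\<^sub>0 x y" if "x \<in> V" "y \<in> V" for x y
      using that g x0 by (simp add: gromov_product_def action_isometry)
    define l where "l = pdist (\<phi> g x\<^sub>0) x\<^sub>0"
    have shift: "gp x\<^sub>0 x y - l \<le> gp x\<^sub>0 (\<phi> g x) (\<phi> g y)" if "x \<in> V" "y \<in> V" for x y
      using gp_perturb0[of "\<phi> g x\<^sub>0" "\<phi> g x" "\<phi> g y" x\<^sub>0] iso[OF that] d_sym[of "\<phi> g x\<^sub>0" x\<^sub>0] by (simp add: l_def)
    have "asymptotic V (graph_dist E) (\<phi> g \<circ> t) (\<phi> g \<circ> t)"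
      unfolding asymptotic_iff[OF gtV gtV]
    proof
      fix Z
      obtain N where "\<forall>i\<ge>N. \<forall>j\<ge>N. Z + l \<le> gp x\<^sub>0 (t i) (t j)"
        using tt unfolding asymptotic_iff[OF tV tV] by blast
      then have "Z \<le> gp x\<^sub>0 (\<phi> g (t i)) (\<phi> g (t j))" if "i \<ge> N" "j \<ge> N" for i j
        using that shift[of "t i" "t j"] inV by fastforce
      then show "\<exists>N. \<forall>i\<ge>N. \<forall>j\<ge>N. Z \<le> gp x\<^sub>0 ((\<phi> g \<circ> t) i) ((\<phi> g \<circ> t) j)"
        by (intro exI[of _ N]) simp
    qed
    moreover have "asymptotic V (graph_dist E) s (\<phi> g \<circ> t)"
      unfolding asymptotic_iff[OF sV gtV]
    proof
      fix Z
      obtain N where N: "\<forall>i\<ge>N. \<forall>j\<ge>N. Z + \<delta> + R \<le> gp x\<^sub>0 (s i) (s j)"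
        using ss unfolding asymptotic_iff[OF sV sV] by blast
      obtain M where M: "\<forall>i\<ge>M. \<forall>j\<ge>M. Z + \<delta> + l \<le> gp x\<^sub>0 (s i) (t j)"
        using st unfolding asymptotic_iff[OF sV tV] by blast
      have "Z \<le> gp x\<^sub>0 (s i) (\<phi> g (t j))" if ij: "i \<ge> max N M" "j \<ge> max N M" for i j
      proof -
        have "Z + \<delta> \<le> gp x\<^sub>0 (s i) (\<phi> g (s i))"
        proof -
          have "Z + \<delta> + R \<le> gp x\<^sub>0 (s i) (s i)" using N ij by simp
          then show ?thesis
            using gp_perturb2[of x\<^sub>0 "s i" "s i" "\<phi> g (s i)"] gs[of i] by linarith
        qed
        moreover have "Z + \<delta> \<le> gp x\<^sub>0 (\<phi> g (s i)) (\<phi> g (t j))"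
        proof -
          have "Z + \<delta> + l \<le> gp x\<^sub>0 (s i) (t j)" using M ij by simp
          then show ?thesis using shift[of "s i" "t j"] inV by simp
        qed
        ultimately show ?thesis
          using hyperbolic[of x\<^sub>0 "s i" "\<phi> g (s i)" "\<phi> g (t j)"] by simp
      qed
      then show "\<exists>N. \<forall>i\<ge>N. \<forall>j\<ge>N. Z \<le> gp x\<^sub>0 (s i) ((\<phi> g \<circ> t) j)"
        by (intro exI[of _ "max N M"]) simp
    qed
    ultimately show ?thesis
      using gtV by (simp add: sequences_to_infinity_def)
  qed
  moreover have "(\<lambda>t. \<phi> c \<circ> t) ` ?\<xi> = ?\<xi>"
  proof
    show "(\<lambda>t. \<phi> c \<circ> t) ` ?\<xi> \<subseteq> ?\<xi>"
      using move[OF c near] by (rule image_subsetI)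
    show "?\<xi> \<subseteq> (\<lambda>t. \<phi> c \<circ> t) ` ?\<xi>"
    proof
      fix t assume t: "t \<in> ?\<xi>"
      have inV: "s k \<in> V" "t k \<in> V" for k
        using t sV by (auto simp: sequences_to_infinity_def)
      have inv: "\<phi> c (\<phi> (inv c) x) = x" "\<phi> (inv c) (\<phi> c x) = x" if "x \<in> V" for x
        using orbit_sym_aux[of "inv c" x] orbit_sym_aux[of c x] that c by auto
      have "pdist (\<phi> (inv c) (s k)) (s k) \<le> R" for k
        using action_isometry[of "inv c" "s k" "\<phi> c (s k)"] near[of k] inV[of k] c inv d_sym[of "s k" "\<phi> c (s k)"] by simp
      then have "\<phi> (inv c) \<circ> t \<in> ?\<xi>"
        using move[of "inv c" t] c t by blast
      moreover have "t = \<phi> c \<circ> (\<phi> (inv c) \<circ> t)"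
        using inv inV by auto
      ultimately show "t \<in> (\<lambda>t. \<phi> c \<circ> t) ` ?\<xi>"
        by - (rule image_eqI, assumption+)
    qed
  qed
  ultimately show ?thesis
    by (simp add: boundary_fixed_points_def)
qed

text \<open>An elementary \<open>b\<close> preserves the direction of the axis, because undistorted
  elements cannot reverse it; then \<open>a\<close> and \<open>b\<close> both fix the positive end
  of the axis.\<close>

lemma independent_not_elementary:
  assumes ax: "axis pdist \<delta> G (\<lambda>g. \<phi> g x\<^sub>0) (1 + 2 * \<delta>) a Q K C"
    and b: "b \<in> carrier G" "loxodromic G V (graph_dist E) \<phi> b"
    and disj: "boundary_fixed_points V (graph_dist E) (\<phi> a) \<inter> boundary_fixed_points V (graph_dist E) (\<phi> b) = {}"
  shows "b \<notin> axis.elementary G a"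
proof
  interpret axis pdist \<delta> G "\<lambda>g. \<phi> g x\<^sub>0" "1 + 2 * \<delta>" a Q K C by (rule ax)
  assume "b \<in> elementary"
  then have "intertwines b 1"
    using undistorted_not_reversing[OF b(1) loxodromic_undistorted[OF b]] by (simp add: elementary_def)
  define s where "s = (\<lambda>n::nat. P (int n))"
  have sV: "range s \<subseteq> V" using x0 by (auto simp: s_def)
  have "asymptotic V (graph_dist E) s s"
    unfolding asymptotic_iff[OF sV sV]
  proof
    fix Z
    obtain N where N: "\<And>n::int. int N \<le> \<bar>n\<bar> \<Longrightarrow> Z + Q \<le> L n" using L_unbounded by blast
    have *: "Z \<le> gp x\<^sub>0 (s i) (s j)" if "N \<le> i" "i \<le> j" for i j
      using quasi_geodesic[of 0 "int i" "int j"] gp_switch[of x\<^sub>0 "s i" "s j"] N[of "int i"] that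
      by (simp add: s_def len_def)
    then have "Z \<le> gp x\<^sub>0 (s i) (s j)" if "N \<le> i" "N \<le> j" for i j
      using that *[of i j] *[of j i] gp_sym[of x\<^sub>0 "s i" "s j"] by (cases "i \<le> j") auto
    then show "\<exists>N. \<forall>i\<ge>N. \<forall>j\<ge>N. Z \<le> gp x\<^sub>0 (s i) (s j)" by blast
  qed
  then have s: "s \<in> sequences_to_infinity V (graph_dist E)"
    using sV by (simp add: sequences_to_infinity_def)
  have fixed: "{t \<in> sequences_to_infinity V (graph_dist E). asymptotic V (graph_dist E) s t}
      \<in> boundary_fixed_points V (graph_dist E) (\<phi> c)" if c: "c \<in> carrier G" "intertwines c 1" for c
  proof -
    obtain R where R: "\<And>k::int. pdist (\<phi> (c \<otimes> a [^] k) x\<^sub>0) (P k) \<le> R"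
      using intertwines_one_bounded[OF c] by blast
    have "pdist (\<phi> c (s k)) (s k) \<le> R" for k
      using R[of "int k"] c x0 by (simp add: s_def composition_rule)
    then show ?thesis by (rule boundary_fixed[OF c(1) s])
  qed
  have "intertwines a 1" using intertwines_pow[of 1] a by simp
  then show False
    using fixed[OF a] fixed[OF b(1) \<open>intertwines b 1\<close>] disj by blast
qed

end

theorem theorem4p2:
  fixes G :: "('g, 'b) monoid_scheme"
    and V :: "'v set" and E :: "('v \<times> 'v) set"
    and \<phi> :: "'g \<Rightarrow> 'v \<Rightarrow> 'v"
  assumes "hyperbolic_graph V E"
    and "acts_by_isometries G V (graph_dist E) \<phi>"
    and "nonelementary G V (graph_dist E) \<phi> (carrier G)"
    and "WPD_action G V (graph_dist E) \<phi>"
  shows "(\<forall>f\<in>carrier G. chiral G f \<and> loxodromic G V (graph_dist E) \<phi> f \<longrightarrow>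
            (\<exists>h\<in>Qh G. h f \<noteq> 0)) \<and>
         (\<forall>H. subgroup H G \<and> nonelementary G V (graph_dist E) \<phi> H \<longrightarrow>
            infinite_dimensional (restriction_map H ` Qh G))"
proof -
  obtain x0 where x0: "x0 \<in> V"
    using assms(1) by (auto simp: hyperbolic_graph_def connected_graph_def)
  obtain \<delta>' where \<delta>': "\<forall>p\<in>V. \<forall>x\<in>V. \<forall>y\<in>V. \<forall>z\<in>V. gromov_product (graph_dist E) p x z \<ge>
      min (gromov_product (graph_dist E) p x y) (gromov_product (graph_dist E) p y z) - \<delta>'"
    using assms(1) by (auto simp: hyperbolic_graph_def gromov_hyperbolic_def)
  \<comment> \<open>\<open>gromov_hyperbolic\<close> puts no sign on its constant, whereas
    \<open>graph_action\<close> asks for a nonnegative one.\<close>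
  define \<delta> where "\<delta> = max 0 \<delta>'"
  interpret graph_action G V E \<phi> x0 \<delta>
  proof
    show "min (gromov_product (graph_dist E) p x y) (gromov_product (graph_dist E) p y z) - \<delta>
        \<le> gromov_product (graph_dist E) p x z" if "p \<in> V" "x \<in> V" "y \<in> V" "z \<in> V" for p x y z
      using \<delta>' that unfolding \<delta>_def by (smt (verit))
  qed (use assms x0 in \<open>auto simp: hyperbolic_graph_def \<delta>_def\<close>)
  have "\<exists>h\<in>Qh G. h f \<noteq> 0"
    if f: "f \<in> carrier G" "loxodromic G V (graph_dist E) \<phi> f" and chiral: "chiral G f" for f
  proof -
    obtain Q K C where ax: "axis pdist \<delta> G (\<lambda>g. \<phi> g x0) (1 + 2 * \<delta>) f Q K C"
      using loxodromic_axis[OF f assms(4)] by blast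
    interpret axis pdist \<delta> G "\<lambda>g. \<phi> g x0" "1 + 2 * \<delta>" f Q K C by (rule ax)
    show ?thesis
    proof (rule chiral_detected)
      fix e assume e: "e \<in> carrier G"
      show "\<not> intertwines e (- 1)"
      proof
        assume "intertwines e (- 1)"
        then obtain p :: int where "p > 0" "e \<otimes>\<^bsub>G\<^esub> f [^]\<^bsub>G\<^esub> p = f [^]\<^bsub>G\<^esub> (- p) \<otimes>\<^bsub>G\<^esub> e"
          by (auto simp: intertwines_def)
        moreover from this have "e \<otimes>\<^bsub>G\<^esub> f [^]\<^bsub>G\<^esub> p \<otimes>\<^bsub>G\<^esub> inv\<^bsub>G\<^esub> e = f [^]\<^bsub>G\<^esub> (- p)"
          using e by (simp add: m_assoc)
        ultimately have "achiral G f"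
          using e unfolding achiral_def by (intro exI[of _ p] conjI bexI[of _ e]) auto
        then show False using chiral by simp
      qed
    qed
  qed
  moreover have "infinite_dimensional (restriction_map H ` Qh G)"
    if H: "subgroup H G" and "nonelementary G V (graph_dist E) \<phi> H" for H
  proof -
    obtain a b where ab: "a \<in> H" "b \<in> H" "loxodromic G V (graph_dist E) \<phi> a" "loxodromic G V (graph_dist E) \<phi> b"
      and disj: "boundary_fixed_points V (graph_dist E) (\<phi> a) \<inter> boundary_fixed_points V (graph_dist E) (\<phi> b) = {}"
      using \<open>nonelementary G V (graph_dist E) \<phi> H\<close> by (auto simp: nonelementary_def)
    have carr: "a \<in> carrier G" "b \<in> carrier G" using ab H subgroup.subset by blast+
    obtain Q K C where ax: "axis pdist \<delta> G (\<lambda>g. \<phi> g x0) (1 + 2 * \<delta>) a Q K C"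
      using loxodromic_axis[OF carr(1) ab(3) assms(4)] by blast
    interpret axis pdist \<delta> G "\<lambda>g. \<phi> g x0" "1 + 2 * \<delta>" a Q K C by (rule ax)
    have be: "b \<notin> elementary"
      by (rule independent_not_elementary[OF ax carr(2) ab(4) disj])
    obtain T where T: "0 \<le> T" "\<And>(m::int) (n::int). gp (\<phi> \<one>\<^bsub>G\<^esub> x0) (P m) (\<phi> (b \<otimes>\<^bsub>G\<^esub> a [^]\<^bsub>G\<^esub> n) x0) \<le> T"
      using transversal[OF carr(2) be] by blast
    interpret transversal_axis pdist \<delta> G "\<lambda>g. \<phi> g x0" "1 + 2 * \<delta>" a Q K C b T
      by unfold_locales (use carr be T in auto)
    obtain h F where hF: "\<And>j::nat. h j \<in> Qh G" "\<And>j. h j (F j) \<noteq> 0" "\<And>i j. i < j \<Longrightarrow> h j (F i) = 0"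
      "\<And>j. \<exists>n. F j = word n \<otimes>\<^bsub>G\<^esub> rest n"
      using independent_family by blast
    \<comment> \<open>The test elements are words in \<open>a\<close> and \<open>b\<close>, so
      restriction to \<open>H\<close> keeps the values there.\<close>
    have FH: "F j \<in> H" for j
      using hF(4)[of j] H ab subgroup_int_pow_closed[OF H ab(1)]
      by (auto simp: word_def rest_def intro!: subgroup.m_closed[OF H])
    show ?thesis
      by (rule infinite_dimensionalI[of "\<lambda>j. restriction_map H (h j)" _ F])
        (use hF FH in \<open>auto simp: restriction_map_def\<close>)
  qed
  ultimately show ?thesis by blast
qed

end
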